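(* Let $T$ be a locally finite tree all of whose vertices have degree $\geq 2$. For any $C>0$, let $\mathbf{Sub}(\mathrm{Aut}(T))_{\leq C}$ be the set of closed subgroups of $\mathrm{Aut}(T)$ having at most $C$ orbits on the vertex set of $T$. Then the closure, in the Chabauty topology, of the set of topologically simple groups belonging to $\mathbf{Sub}(\mathrm{Aut}(T))_{\leq C}$ is the set of those groups in $\mathbf{Sub}(\mathrm{Aut}(T))_{\leq C}$ that have no proper open subgroup of finite index.
   Context: $\mathrm{Aut}(T)$ carries the topology of pointwise convergence on vertices (equivalently the compact-open topology); it is a second countable totally disconnected locally compact group. For a locally compact group $G$, $\mathbf{Sub}(G)$ is the set of closed subgroups of $G$ with the Chabauty topology, in which a base of neighborhoods of $H$ is given by the sets $\{J \in \mathbf{Sub}(G) \mid J\cap K\subseteq HU,\ H\cap K\subseteq JU\}$ with $K\subseteq G$ compact and $U$ an open identity neighborhood; it is compact Hausdorff. A topological group is topologically simple if it is non-trivial and its only closed normal subgroups are the trivial group and the whole group. *)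

theory Defs
  imports "HOL-Analysis.Analysis" "HOL-Algebra.Group_Action"
begin

section \<open>Trees\<close>

text \<open>
  Simple undirected graphs are given by a vertex set \<open>V\<close> and a set \<open>E\<close> of unordered pairs.
\<close>

definition simple_graph :: "'v set \<Rightarrow> 'v set set \<Rightarrow> bool" where
  "simple_graph V E \<longleftrightarrow> (\<forall>e\<in>E. e \<subseteq> V \<and> card e = 2)"

definition nbrs :: "'v set set \<Rightarrow> 'v \<Rightarrow> 'v set" where
  "nbrs E v = {w. {v, w} \<in> E}"

definition locally_finite :: "'v set \<Rightarrow> 'v set set \<Rightarrow> bool" where
  "locally_finite V E \<longleftrightarrow> (\<forall>v\<in>V. finite (nbrs E v))"

definition vertex_degree :: "'v set set \<Rightarrow> 'v \<Rightarrow> nat" where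
  "vertex_degree E v = card (nbrs E v)"

definition connected_graph :: "'v set \<Rightarrow> 'v set set \<Rightarrow> bool" where
  "connected_graph V E \<longleftrightarrow> V \<noteq> {} \<and> (\<forall>u\<in>V. \<forall>v\<in>V. (\<lambda>x y. {x, y} \<in> E)\<^sup>*\<^sup>* u v)"

definition graph_cycle :: "'v set set \<Rightarrow> 'v list \<Rightarrow> bool" where
  "graph_cycle E p \<longleftrightarrow> 3 \<le> length p \<and> distinct p \<and>
     successively (\<lambda>x y. {x, y} \<in> E) p \<and> {last p, hd p} \<in> E"

definition is_tree :: "'v set \<Rightarrow> 'v set set \<Rightarrow> bool" where
  "is_tree V E \<longleftrightarrow> simple_graph V E \<and> connected_graph V E \<and> (\<nexists>p. graph_cycle E p)"


section \<open>The topological group of automorphisms of a graph\<close>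

text \<open>
  An automorphism is an element of \<^const>\<open>Bij\<close>, that is, a bijection of \<open>V\<close>
  extended by \<^const>\<open>undefined\<close> outside \<open>V\<close>.
\<close>

definition auts :: "'v set \<Rightarrow> 'v set set \<Rightarrow> ('v \<Rightarrow> 'v) set" where
  "auts V E = {g \<in> Bij V. \<forall>u\<in>V. \<forall>v\<in>V. {g u, g v} \<in> E \<longleftrightarrow> {u, v} \<in> E}"

definition Aut :: "'v set \<Rightarrow> 'v set set \<Rightarrow> ('v \<Rightarrow> 'v) monoid" where
  "Aut V E = BijGroup V \<lparr>carrier := auts V E\<rparr>"

text \<open>
  Pointwise convergence on vertices: the topology induced by the product of discrete spaces.
\<close>

definition aut_topology :: "'v set \<Rightarrow> 'v set set \<Rightarrow> ('v \<Rightarrow> 'v) topology" where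
  "aut_topology V E = subtopology (product_topology (\<lambda>_. discrete_topology V) V) (auts V E)"

lemma carrier_Aut [simp]: "carrier (Aut V E) = auts V E"
  by (simp add: Aut_def)

lemma topspace_aut_topology [simp]: "topspace (aut_topology V E) = auts V E"
  by (auto simp: aut_topology_def auts_def Bij_def PiE_def bij_betw_def)

lemma subgroup_auts: "subgroup (auts V E) (BijGroup V)"
proof (rule group.subgroupI[OF group_BijGroup])
  show "auts V E \<subseteq> carrier (BijGroup V)"
    by (auto simp: auts_def BijGroup_def)
  have "(\<lambda>x\<in>V. x) \<in> auts V E"
    by (simp add: auts_def id_Bij)
  then show "auts V E \<noteq> {}" by blast
next
  fix g assume g: "g \<in> auts V E"
  then have gB: "g \<in> Bij V" and bij: "bij_betw g V V"
    by (auto simp: auts_def Bij_def)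
  have "{inv_into V g u, inv_into V g v} \<in> E \<longleftrightarrow> {u, v} \<in> E" if "u \<in> V" "v \<in> V" for u v
  proof -
    have "inv_into V g u \<in> V" "inv_into V g v \<in> V"
      using that bij by (metis bij_betw_def inv_into_into)+
    moreover have "g (inv_into V g u) = u" "g (inv_into V g v) = v"
      using that bij by (auto simp: bij_betw_inv_into_right)
    moreover have "{g x, g y} \<in> E \<longleftrightarrow> {x, y} \<in> E" if "x \<in> V" "y \<in> V" for x y
      using g that by (simp add: auts_def)
    ultimately show ?thesis by metis
  qed
  then show "inv\<^bsub>BijGroup V\<^esub> g \<in> auts V E"
    using gB by (simp add: inv_BijGroup auts_def restrict_inv_into_Bij)
next
  fix g h assume gh: "g \<in> auts V E" "h \<in> auts V E"
  then have B: "g \<in> Bij V" "h \<in> Bij V" by (auto simp: auts_def)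
  have "h x \<in> V" if "x \<in> V" for x
    using B(2) that by (auto simp: Bij_def bij_betw_def)
  then have "compose V g h \<in> auts V E"
    using gh B by (simp add: auts_def compose_Bij compose_eq)
  then show "g \<otimes>\<^bsub>BijGroup V\<^esub> h \<in> auts V E"
    using B unfolding BijGroup_def by simp
qed

lemma group_Aut: "group (Aut V E)"
  unfolding Aut_def by (rule group.subgroup_imp_group[OF group_BijGroup subgroup_auts])


section \<open>The Chabauty space of a topological group\<close>

text \<open>
  In what follows, a topological group is a group \<open>G\<close> together with a topology \<open>X\<close> on its carrier.
\<close>

definition closed_subgroups :: "('a, 'b) monoid_scheme \<Rightarrow> 'a topology \<Rightarrow> 'a set set" where
  "closed_subgroups G X = {H. subgroup H G \<and> closedin X H}"

definition chabauty_nbhd ::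
  "('a, 'b) monoid_scheme \<Rightarrow> 'a topology \<Rightarrow> 'a set \<Rightarrow> 'a set \<Rightarrow> 'a set \<Rightarrow> 'a set set" where
  "chabauty_nbhd G X K U H =
     {J \<in> closed_subgroups G X. J \<inter> K \<subseteq> H <#>\<^bsub>G\<^esub> U \<and> H \<inter> K \<subseteq> J <#>\<^bsub>G\<^esub> U}"

text \<open>
  A set of closed subgroups is open iff it contains, with each of its points \<open>H\<close>, a basic
  neighborhood of \<open>H\<close>.
\<close>

definition chabauty :: "('a, 'b) monoid_scheme \<Rightarrow> 'a topology \<Rightarrow> 'a set topology" where
  "chabauty G X = topology (\<lambda>S. S \<subseteq> closed_subgroups G X \<and>
     (\<forall>H\<in>S. \<exists>K U. compactin X K \<and> openin X U \<and> \<one>\<^bsub>G\<^esub> \<in> U \<and> chabauty_nbhd G X K U H \<subseteq> S))"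

lemma openin_chabauty:
  "openin (chabauty G X) S \<longleftrightarrow> S \<subseteq> closed_subgroups G X \<and>
     (\<forall>H\<in>S. \<exists>K U. compactin X K \<and> openin X U \<and> \<one>\<^bsub>G\<^esub> \<in> U \<and> chabauty_nbhd G X K U H \<subseteq> S)"
proof -
  let ?P = "\<lambda>S H. \<exists>K U. compactin X K \<and> openin X U \<and> \<one>\<^bsub>G\<^esub> \<in> U \<and> chabauty_nbhd G X K U H \<subseteq> S"
  have "istopology (\<lambda>S. S \<subseteq> closed_subgroups G X \<and> (\<forall>H\<in>S. ?P S H))"
    unfolding istopology_def
  proof (intro conjI allI impI ballI)
    fix S T H
    assume S: "S \<subseteq> closed_subgroups G X \<and> (\<forall>H\<in>S. ?P S H)"
      and T: "T \<subseteq> closed_subgroups G X \<and> (\<forall>H\<in>T. ?P T H)" and H: "H \<in> S \<inter> T"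
    obtain K U where KU: "compactin X K" "openin X U" "\<one>\<^bsub>G\<^esub> \<in> U" "chabauty_nbhd G X K U H \<subseteq> S"
      using S H by blast
    obtain L W where LW: "compactin X L" "openin X W" "\<one>\<^bsub>G\<^esub> \<in> W" "chabauty_nbhd G X L W H \<subseteq> T"
      using T H by blast
    have "chabauty_nbhd G X (K \<union> L) (U \<inter> W) H \<subseteq> chabauty_nbhd G X K U H \<inter> chabauty_nbhd G X L W H"
    proof
      fix J assume J: "J \<in> chabauty_nbhd G X (K \<union> L) (U \<inter> W) H"
      have "A <#>\<^bsub>G\<^esub> (U \<inter> W) \<subseteq> A <#>\<^bsub>G\<^esub> U" "A <#>\<^bsub>G\<^esub> (U \<inter> W) \<subseteq> A <#>\<^bsub>G\<^esub> W" for A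
        by (simp_all add: mono_set_mult)
      with J show "J \<in> chabauty_nbhd G X K U H \<inter> chabauty_nbhd G X L W H"
        unfolding chabauty_nbhd_def by fast
    qed
    moreover have "compactin X (K \<union> L)" "openin X (U \<inter> W)" "\<one>\<^bsub>G\<^esub> \<in> U \<inter> W"
      using KU LW by (auto intro: compactin_Un)
    ultimately show "?P (S \<inter> T) H" using KU(4) LW(4) by blast
  next
    fix \<K> H
    assume "\<forall>S\<in>\<K>. S \<subseteq> closed_subgroups G X \<and> (\<forall>H\<in>S. ?P S H)" "H \<in> \<Union>\<K>"
    then obtain S where S: "S \<in> \<K>" "?P S H" by auto
    from S(2) obtain K U where KU: "compactin X K" "openin X U" "\<one>\<^bsub>G\<^esub> \<in> U"
        "chabauty_nbhd G X K U H \<subseteq> S" by auto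
    from KU(4) S(1) have "chabauty_nbhd G X K U H \<subseteq> \<Union>\<K>" by auto
    with KU(1-3) show "?P (\<Union>\<K>) H" by auto
  qed auto
  then show ?thesis by (simp add: chabauty_def)
qed

lemma topspace_chabauty:
  assumes "\<one>\<^bsub>G\<^esub> \<in> topspace X"
  shows "topspace (chabauty G X) = closed_subgroups G X"
proof
  show "topspace (chabauty G X) \<subseteq> closed_subgroups G X"
    using openin_topspace openin_chabauty by blast
  have "chabauty_nbhd G X {} (topspace X) H \<subseteq> closed_subgroups G X" for H
    by (auto simp: chabauty_nbhd_def)
  then have "openin (chabauty G X) (closed_subgroups G X)"
    unfolding openin_chabauty using assms by (blast intro: compactin_empty)
  then show "closed_subgroups G X \<subseteq> topspace (chabauty G X)"
    by (rule openin_subset)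
qed


section \<open>Properties of closed subgroups\<close>

definition topologically_simple :: "('a, 'b) monoid_scheme \<Rightarrow> 'a topology \<Rightarrow> bool" where
  "topologically_simple G X \<longleftrightarrow> carrier G \<noteq> {\<one>\<^bsub>G\<^esub>} \<and>
     (\<forall>N. N \<lhd> G \<and> closedin X N \<longrightarrow> N = {\<one>\<^bsub>G\<^esub>} \<or> N = carrier G)"

definition no_proper_open_finite_index :: "('a, 'b) monoid_scheme \<Rightarrow> 'a topology \<Rightarrow> bool" where
  "no_proper_open_finite_index G X \<longleftrightarrow>
     (\<forall>L. subgroup L G \<and> openin X L \<and> finite (rcosets\<^bsub>G\<^esub> L) \<longrightarrow> L = carrier G)"

definition Sub_le :: "'v set \<Rightarrow> 'v set set \<Rightarrow> real \<Rightarrow> ('v \<Rightarrow> 'v) set set" where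
  "Sub_le V E C = {H \<in> closed_subgroups (Aut V E) (aut_topology V E).
     finite (orbits (Aut V E \<lparr>carrier := H\<rparr>) V (\<lambda>g. g)) \<and>
     real (card (orbits (Aut V E \<lparr>carrier := H\<rparr>) V (\<lambda>g. g))) \<le> C}"

end

theory Submission
  imports Defs
begin

text \<open>
  The idea is due to Caprace and Radu. Let \<open>H\<close> be a group with finitely many orbits of vertices and
  without proper open subgroups of finite index.

  \<^item> Counting the edges of an \<open>H\<close>-orbit crossed by a path gives homomorphisms from \<open>H\<close> to the integers.
    These vanish, so \<open>H\<close> is generated by its vertex stabilisers. If \<open>N\<close> is open and normal in \<open>H\<close>, then
    each \<open>H\<^sub>v/(H\<^sub>v \<inter> N)\<close> is finite, and as for graphs of finite groups one finds an action of \<open>H\<close> on a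
    finite set in which these quotients act freely. Hence \<open>H\<close> has no discrete quotients.

  \<^item> The \<open>k\<close>-closures of \<open>H\<close> (all automorphisms agreeing with some element of \<open>H\<close> on each ball of
    radius \<open>k\<close>) converge to \<open>H\<close>, and they satisfy the independence property of Banks, Elder and Willis.
    By the argument of Tits, a nontrivial normal subgroup contains all pointwise stabilisers of
    \<open>k\<close>-balls; these generate an open normal subgroup, which contains \<open>H\<close> by the first item.

  \<^item> Conversely, a finite quotient of a cocompact group \<open>H\<close> restricts to a partial homomorphism on
    the elements of small displacement of any nearby group. As the tree is simply connected, it
    extends to a homomorphism, so groups with proper open subgroups of finite index form an open set.
\<close>

text \<open>The finite action behind the first item and the homomorphism of the third arise from one
  construction: a cocycle with values in the permutations of a finite set, with a compatible
  parallel transport along edges. Finiteness of the number of orbits keeps this set finite in the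
  first case; in the third, a bound on that number places a translate of every vertex within a fixed
  radius of the base vertex, so that one ball and one displacement bound serve all groups near
  \<open>H\<close>. A simple group satisfies the condition on open subgroups because the kernel of a
  finite quotient is closed and normal: were it trivial, the group would be finite, while it has
  finitely many orbits on an infinite vertex set. The argument of Tits needs elements of the normal
  subgroup that push a given half-tree far away from itself. They are found without discussing fixed
  ends: the vanishing of the edge counts yields a disjoint translate of every half-tree, and the
  rest is ping-pong.\<close>

lemma rtranclp_imp_distinct_path:
  assumes "r\<^sup>*\<^sup>* x y"
  shows "\<exists>p. p \<noteq> [] \<and> hd p = x \<and> last p = y \<and> distinct p \<and> successively r p"
  using assms
proof (induction rule: converse_rtranclp_induct)
  case base
  show ?case by (rule exI[of _ "[y]"]) simp
next
  case (step x z)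
  then obtain p where p: "p \<noteq> []" "hd p = z" "last p = y" "distinct p" "successively r p" by blast
  show ?case
  proof (cases "x \<in> set p")
    case True
    \<comment> \<open>Loop erasure: the part of the path before \<open>x\<close> is dropped.\<close>
    then obtain ys zs where "p = ys @ x # zs" by (meson split_list)
    with p show ?thesis by (intro exI[of _ "x # zs"]) (auto simp: successively_append_iff)
  next
    case False
    with p step.hyps show ?thesis
      by (intro exI[of _ "x # p"]) (auto simp: successively_Cons)
  qed
qed

section \<open>Adjacency and bridges\<close>

locale leafless_tree =
  fixes V :: "'v set" and E :: "'v set set"
  assumes tree: "is_tree V E"
    and loc_fin: "locally_finite V E"
    and deg: "\<forall>v\<in>V. vertex_degree E v \<ge> 2"
begin

definition adj :: "'v \<Rightarrow> 'v \<Rightarrow> bool" where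
  "adj u v \<longleftrightarrow> {u, v} \<in> E"

lemma adj_sym: "adj u v \<Longrightarrow> adj v u"
  by (simp add: adj_def insert_commute)

lemma adjD: assumes "adj u v" shows "u \<in> V" "v \<in> V" "u \<noteq> v"
proof -
  have "{u, v} \<subseteq> V \<and> card {u, v} = 2"
    using tree assms by (auto simp: is_tree_def simple_graph_def adj_def)
  then show "u \<in> V" "v \<in> V" "u \<noteq> v" by (auto simp: card_insert_if split: if_splits)
qed

lemma V_ne: "V \<noteq> {}"
  using tree by (auto simp: is_tree_def connected_graph_def)

lemma connected: "u \<in> V \<Longrightarrow> v \<in> V \<Longrightarrow> adj\<^sup>*\<^sup>* u v"
  using tree unfolding is_tree_def connected_graph_def adj_def[abs_def] by blast

text \<open>This is where the absence of cycles enters: a simple path from \<open>b\<close> to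
  \<open>a\<close> that avoids the edge would close up with the edge to a cycle.\<close>

lemma bridge:
  assumes "adj a b"
  shows "\<not> (\<lambda>x y. adj x y \<and> {x, y} \<noteq> {a, b})\<^sup>*\<^sup>* b a"
proof
  assume "(\<lambda>x y. adj x y \<and> {x, y} \<noteq> {a, b})\<^sup>*\<^sup>* b a"
  from rtranclp_imp_distinct_path[OF this] obtain p where p: "p \<noteq> []" "hd p = b" "last p = a"
    "distinct p" "successively (\<lambda>x y. adj x y \<and> {x, y} \<noteq> {a, b}) p"
    by blast
  have "a \<noteq> b" using adjD assms by blast
  obtain q where q: "p = b # q" using p by (cases p) auto
  have "q \<noteq> []" using q p \<open>a \<noteq> b\<close> by auto
  then obtain c r where r: "q = c # r" by (cases q) auto
  \<comment> \<open>The path with only the vertices \<open>b\<close> and \<open>a\<close> would use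
    the forbidden edge, so a third vertex exists.\<close>
  have "r \<noteq> []" using r q p by (auto simp: insert_commute)
  then have "length p \<ge> 3" using q r by (cases r) auto
  moreover have "successively (\<lambda>x y. {x, y} \<in> E) p"
    using p(5) by (rule successively_mono) (auto simp: adj_def)
  moreover have "{last p, hd p} \<in> E" using p assms by (simp add: adj_def)
  ultimately have "graph_cycle E p" using p by (simp add: graph_cycle_def)
  then show False using tree by (auto simp: is_tree_def)
qed

section \<open>The path metric\<close>

definition d :: "'v \<Rightarrow> 'v \<Rightarrow> nat" where
  "d u v = (LEAST n. (adj ^^ n) u v)"

lemma walk_d: "u \<in> V \<Longrightarrow> v \<in> V \<Longrightarrow> (adj ^^ d u v) u v"
  unfolding d_def by (rule LeastI_ex) (metis connected rtranclp_imp_relpowp)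

lemma d_le: "(adj ^^ n) u v \<Longrightarrow> d u v \<le> n"
  unfolding d_def by (rule Least_le)

lemma d_self [simp]: "d u u = 0"
  using d_le[of 0 u u] by simp

lemma d_eq_0 [simp]: "u \<in> V \<Longrightarrow> v \<in> V \<Longrightarrow> d u v = 0 \<longleftrightarrow> u = v"
  using walk_d[of u v] by auto

lemma d_triangle:
  assumes "u \<in> V" "v \<in> V" "w \<in> V" shows "d u w \<le> d u v + d v w"
proof -
  have "(adj ^^ (d u v + d v w)) u w"
    using assms by (auto simp: relpowp_add intro!: relcomppI walk_d)
  then show ?thesis by (rule d_le)
qed

lemma walk_rev: "(adj ^^ n) u v \<Longrightarrow> (adj ^^ n) v u"
proof (induction n arbitrary: v)
  case (Suc n)
  then obtain w where "(adj ^^ n) u w" "adj w v" by auto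
  then show ?case using Suc.IH adj_sym by (blast intro: relpowp_Suc_I2)
qed auto

lemma d_sym: "u \<in> V \<Longrightarrow> v \<in> V \<Longrightarrow> d u v = d v u"
  by (meson d_le walk_d walk_rev antisym)

lemma d_adj: assumes "adj u v" shows "d u v = 1"
proof -
  have "d u v \<le> 1" using assms by (intro d_le) auto
  moreover have "d u v \<noteq> 0" using adjD[OF assms] by auto
  ultimately show ?thesis by simp
qed

lemma d_step:
  assumes "u \<in> V" "v \<in> V" "d u v = Suc n"
  obtains w where "adj u w" "d w v = n"
proof -
  have "(adj ^^ Suc n) u v" using walk_d assms by metis
  then obtain w where w: "adj u w" "(adj ^^ n) w v" by (metis relpowp_Suc_D2)
  have "d w v \<le> n" using w d_le by blast
  moreover have "d u v \<le> d u w + d w v" using w assms adjD d_triangle by blast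
  moreover have "d u w = 1" using w d_adj by simp
  ultimately have "d w v = n" using assms by linarith
  with w that show thesis by blast
qed

lemma d_adj_le: "adj u v \<Longrightarrow> w \<in> V \<Longrightarrow> d u w \<le> Suc (d v w)"
  using d_triangle[of u v w] d_adj adjD by fastforce

text \<open>\<open>P\<close> is required only on geodesics from \<open>u\<close> to
  \<open>v\<close>. Comparisons of distances propagate along these from \<open>u\<close>, which is
  how the walks around an edge are kept on one side of it.\<close>

lemma geodesic_reach:
  assumes "u \<in> V" "v \<in> V" and "\<And>x. x \<in> V \<Longrightarrow> d u v = d u x + d x v \<Longrightarrow> P x"
  shows "(\<lambda>x y. adj x y \<and> P x \<and> P y)\<^sup>*\<^sup>* u v"
  using assms
proof (induction "d u v" arbitrary: u)
  case 0
  have "u = v" using d_eq_0[OF 0(2,3)] 0(1) by simp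
  then show ?case by simp
next
  case (Suc n)
  obtain w where w: "adj u w" "d w v = n"
    using d_step[OF Suc.prems(1,2)] Suc.hyps(2) by metis
  have wV: "w \<in> V" using w adjD by blast
  have P: "P x" if "x \<in> V" "d w v = d w x + d x v" for x
  proof (rule Suc.prems(3)[OF that(1)])
    have "d u x \<le> Suc (d w x)" using w that d_adj_le by blast
    moreover have "d u v \<le> d u x + d x v" using Suc.prems that d_triangle by blast
    ultimately show "d u v = d u x + d x v" using w that Suc.hyps by linarith
  qed
  have "(\<lambda>x y. adj x y \<and> P x \<and> P y)\<^sup>*\<^sup>* w v"
    using Suc.hyps(1)[of w] w wV Suc.prems(2) P by blast
  moreover have "P u" using Suc.prems(3)[of u] Suc.prems(1) by simp
  moreover have "P w" using P[of w] wV by simp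
  ultimately show ?case using w(1) converse_rtranclp_into_rtranclp[of "\<lambda>x y. adj x y \<and> P x \<and> P y" u w v]
    by simp
qed

section \<open>Half-trees\<close>

text \<open>The half-tree on the side of \<open>b\<close> when the edge between \<open>a\<close> and
  \<open>b\<close> is removed. Its description by distances makes equivariance under automorphisms
  immediate.\<close>

definition h :: "'v \<Rightarrow> 'v \<Rightarrow> 'v set" where
  "h a b = {u \<in> V. d u b < d u a}"

lemma h_sub: "h a b \<subseteq> V" by (auto simp: h_def)

text \<open>A geodesic from \<open>u\<close> to \<open>b\<close> stays weakly nearer to
  \<open>b\<close>, one from \<open>v\<close> to \<open>a\<close> weakly nearer to \<open>a\<close>,
  so neither uses the edge; joined at \<open>u\<close> and \<open>v\<close> they contradict
  \<open>bridge\<close>. The case \<open>u = v\<close> excludes ties, hence makes opposite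
  half-trees complementary; the case of adjacent vertices shows that only the given edge leads out
  of a half-tree.\<close>

lemma no_crossing_walk:
  assumes ab: "adj a b" and uv: "u \<in> V" "v \<in> V" and "d u b \<le> d u a" "d v a \<le> d v b"
    and "u = v \<or> adj u v \<and> {u, v} \<noteq> {a, b}"
  shows False
proof -
  let ?r = "\<lambda>x y. adj x y \<and> {x, y} \<noteq> {a, b}"
  have abV: "a \<in> V" "b \<in> V" using adjD ab by auto
  have "(\<lambda>x y. adj x y \<and> d x b \<le> d x a \<and> d y b \<le> d y a)\<^sup>*\<^sup>* u b"
  proof (rule geodesic_reach)
    fix x assume "x \<in> V" "d u b = d u x + d x b"
    then show "d x b \<le> d x a" using d_triangle[of u x a] assms abV by simp
  qed (use uv abV in auto)
  then have ub: "?r\<^sup>*\<^sup>* u b"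
    by (rule rtranclp_mono[THEN predicate2D, rotated])
       (use ab d_adj[OF ab] in \<open>auto simp: doubleton_eq_iff\<close>)
  have "symp ?r" by (auto simp: symp_def insert_commute dest: adj_sym)
  then have 1: "?r\<^sup>*\<^sup>* b u" by (rule sympD[OF symp_rtranclp ub])
  have "(\<lambda>x y. adj x y \<and> d x a \<le> d x b \<and> d y a \<le> d y b)\<^sup>*\<^sup>* v a"
  proof (rule geodesic_reach)
    fix x assume "x \<in> V" "d v a = d v x + d x a"
    then show "d x a \<le> d x b" using d_triangle[of v x b] assms abV by simp
  qed (use uv abV in auto)
  then have 2: "?r\<^sup>*\<^sup>* v a"
    by (rule rtranclp_mono[THEN predicate2D, rotated])
       (use ab d_adj[OF adj_sym[OF ab]] in \<open>auto simp: doubleton_eq_iff\<close>)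
  have "?r\<^sup>*\<^sup>* u v" using assms(6) by auto
  then have "?r\<^sup>*\<^sup>* b a" using 1 2 by (meson rtranclp_trans)
  then show False using bridge ab by blast
qed

lemma d_neq: "adj a b \<Longrightarrow> u \<in> V \<Longrightarrow> d u a \<noteq> d u b"
  using no_crossing_walk[of a b u u] by auto

lemma h_compl: "adj a b \<Longrightarrow> V - h a b = h b a"
  using d_neq by (force simp: h_def)

lemma h_compl_iff: "adj a b \<Longrightarrow> u \<in> V \<Longrightarrow> u \<in> h b a \<longleftrightarrow> u \<notin> h a b"
  using h_compl by blast

lemma h_snd: "adj a b \<Longrightarrow> b \<in> h a b"
  using d_adj[OF adj_sym] adjD by (auto simp: h_def)

lemma h_fst: "adj a b \<Longrightarrow> a \<notin> h a b"
  using d_adj adjD by (auto simp: h_def)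

lemma h_cross:
  assumes "adj a b" "adj u v" "u \<in> h a b" "v \<notin> h a b"
  shows "u = b" "v = a"
proof -
  have "{u, v} = {a, b}"
    using no_crossing_walk[of a b u v] assms adjD[OF assms(2)] by (auto simp: h_def)
  then show "u = b" "v = a" using assms h_snd h_fst by (auto simp: doubleton_eq_iff)
qed

text \<open>A walk leaving the half-tree must step from \<open>b\<close> to \<open>a\<close>, which
  gives the lower bound; the upper bound is the triangle inequality.\<close>

lemma d_h_sep:
  assumes ab: "adj a b" and "u \<in> h a b" "x \<in> V" "x \<notin> h a b"
  shows "d u x = d u b + 1 + d a x"
proof -
  have abV: "a \<in> V" "b \<in> V" using adjD ab by auto
  have "d u x \<ge> d u b + 1 + d a x" using assms(2)
  proof (induction "d u x" arbitrary: u)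
    case 0
    have "u \<in> V" using 0(2) h_sub by blast
    then have "u = x" using d_eq_0[of u x] 0(1) assms(3) by simp
    then show ?case using 0 assms by simp
  next
    case (Suc n)
    have uV: "u \<in> V" using Suc.prems h_sub by auto
    obtain w where w: "adj u w" "d w x = n" using d_step[OF uV assms(3)] Suc.hyps by metis
    show ?case
    proof (cases "w \<in> h a b")
      case True
      then have "d w b + 1 + d a x \<le> d w x" using Suc.hyps(1)[of w] w by simp
      moreover have "d u b \<le> Suc (d w b)" using d_adj_le w abV by blast
      ultimately show ?thesis using w Suc.hyps by simp
    next
      case False
      then have "u = b" "w = a" using h_cross ab w Suc.prems by blast+
      then show ?thesis using w Suc.hyps by simp
    qed
  qed
  moreover have "d u x \<le> d u b + 1 + d a x"
    using d_triangle[of u b x] d_triangle[of b a x] d_adj[OF adj_sym[OF ab]] abV assms h_sub[of a b] by fastforce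
  ultimately show ?thesis by simp
qed

text \<open>Membership in \<open>h c e\<close> changes only across the edge between \<open>c\<close>
  and \<open>e\<close>. That edge has no endpoint in \<open>h a b\<close>, so membership is constant
  there and is decided at \<open>b\<close>.\<close>

lemma h_disjoint_or_subset:
  assumes ab: "adj a b" and cd: "adj c e" and "c \<notin> h a b" "e \<notin> h a b"
  shows "if b \<in> h c e then h a b \<subseteq> h c e else h a b \<inter> h c e = {}"
proof -
  have "u \<in> h c e \<longleftrightarrow> b \<in> h c e" if "u \<in> h a b" for u
    using that
  proof (induction "d u b" arbitrary: u)
    case 0
    have "u \<in> V" using 0(2) h_sub by blast
    then have "u = b" using d_eq_0[of u b] 0(1) adjD[OF ab] by simp
    then show ?case by simp
  next
    case (Suc n)
    have uV: "u \<in> V" using Suc.prems h_sub by auto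
    have abV: "a \<in> V" "b \<in> V" using adjD ab by auto
    obtain w where w: "adj u w" "d w b = n" using d_step[OF uV abV(2)] Suc.hyps by metis
    have wh: "w \<in> h a b"
    proof (rule ccontr)
      assume "w \<notin> h a b"
      then have "u = b" using h_cross[OF ab w(1)] Suc.prems by blast
      then show False using Suc.hyps by simp
    qed
    then have "w \<in> h c e \<longleftrightarrow> b \<in> h c e" using Suc.hyps(1)[of w] w by simp
    moreover have "u \<in> h c e \<longleftrightarrow> w \<in> h c e"
      using h_cross[OF cd w(1)] h_cross[OF cd adj_sym[OF w(1)]] Suc.prems wh assms(3,4) by blast
    ultimately show ?case by simp
  qed
  then show ?thesis by auto
qed

lemma h_outside_cases:
  assumes "adj a b" "adj c e" "c \<notin> h a b" "e \<notin> h a b"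
  obtains "h a b \<subseteq> h c e" | "h a b \<inter> h c e = {}"
  using h_disjoint_or_subset[OF assms] by (metis (full_types))

lemma parent_unique:
  assumes "adj u v" "adj u w" "x \<in> V" "d v x < d u x" "d w x < d u x"
  shows "v = w"
proof (rule ccontr)
  assume "v \<noteq> w"
  have V: "u \<in> V" "v \<in> V" "w \<in> V" using adjD assms by auto
  have xv: "x \<in> h u v" and xw: "x \<in> h u w" using assms V by (auto simp: h_def d_sym)
  have "d w x = 1 + d v x + 1"
  proof -
    have "w \<notin> h u v" using h_cross[OF assms(1) adj_sym[OF assms(2)]] \<open>v \<noteq> w\<close> h_fst[OF assms(1)] by blast
    then have "d x w = d x v + 1 + d u w" using d_h_sep[OF assms(1) xv] V by blast
    then show ?thesis using d_adj[OF assms(2)] d_sym V assms by simp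
  qed
  moreover have "d u x \<le> Suc (d v x)" using assms d_adj_le by blast
  ultimately show False using assms by linarith
qed

text \<open>This is where the minimal degree enters: of two neighbours at most one is closer to
  \<open>x\<close>, and none is equally far.\<close>

lemma exists_farther:
  assumes "u \<in> V" "x \<in> V"
  obtains w where "adj u w" "d w x = Suc (d u x)"
proof -
  have "card (nbrs E u) \<ge> 2" using deg assms by (simp add: vertex_degree_def)
  then obtain v w where vw: "v \<in> nbrs E u" "w \<in> nbrs E u" "v \<noteq> w"
    by (metis card_le_Suc0_iff_eq not_less_eq_eq numeral_2_eq_2 card.infinite zero_le le_0_eq Suc_neq_Zero)
  then have adj: "adj u v" "adj u w" by (auto simp: nbrs_def adj_def)
  have "\<not> (d v x < d u x \<and> d w x < d u x)" using parent_unique adj vw assms by blast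
  moreover have "d v x \<noteq> d u x" "d w x \<noteq> d u x"
    using d_neq[OF adj(1) assms(2)] d_neq[OF adj(2) assms(2)] adjD[OF adj(1)] adjD[OF adj(2)] assms d_sym by metis+
  moreover have "d v x \<le> Suc (d u x)" "d w x \<le> Suc (d u x)"
    using d_adj_le[OF adj_sym[OF adj(1)]] d_adj_le[OF adj_sym[OF adj(2)]] assms by auto
  ultimately have "d v x = Suc (d u x) \<or> d w x = Suc (d u x)" by linarith
  then show thesis using adj that by blast
qed

lemma h_deep:
  assumes "adj a b"
  shows "\<exists>u\<in>h a b. d u a = Suc n"
proof (induction n)
  case 0
  then show ?case using h_snd[OF assms] d_adj[OF adj_sym[OF assms]] by auto
next
  case (Suc n)
  then obtain u where u: "u \<in> h a b" "d u a = Suc n" by blast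
  have V: "u \<in> V" "a \<in> V" using u h_sub adjD assms by auto
  obtain w where w: "adj u w" "d w a = Suc (d u a)" using exists_farther[OF V] .
  have "w \<in> h a b"
  proof (rule ccontr)
    assume "w \<notin> h a b"
    then have "w = a" using h_cross[OF assms w(1)] u by blast
    then show False using w by simp
  qed
  then show ?case using w u by auto
qed

section \<open>Balls, unboundedness and bipartiteness\<close>

definition B :: "'v \<Rightarrow> nat \<Rightarrow> 'v set" where
  "B v n = {u \<in> V. d v u \<le> n}"

lemma B_sub: "B v n \<subseteq> V" by (auto simp: B_def)

lemma B_self: "v \<in> V \<Longrightarrow> v \<in> B v n" by (auto simp: B_def)

lemma B_mono: "m \<le> n \<Longrightarrow> B v m \<subseteq> B v n" by (auto simp: B_def)

lemma B_adj: "adj u v \<Longrightarrow> n \<ge> 1 \<Longrightarrow> v \<in> B u n"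
  using d_adj adjD by (auto simp: B_def)

lemma finite_B: "v \<in> V \<Longrightarrow> finite (B v n)"
proof (induction n)
  case 0
  then have "B v 0 \<subseteq> {v}" by (auto simp: B_def)
  then show ?case using finite_subset by blast
next
  case (Suc n)
  have "B v (Suc n) \<subseteq> B v n \<union> (\<Union>u\<in>B v n. nbrs E u)"
  proof
    fix u assume u: "u \<in> B v (Suc n)"
    show "u \<in> B v n \<union> (\<Union>u\<in>B v n. nbrs E u)"
    proof (cases "d v u \<le> n")
      case True then show ?thesis using u by (auto simp: B_def)
    next
      case False
      then have "d u v = Suc n" using u Suc.prems d_sym by (auto simp: B_def)
      then obtain w where w: "adj u w" "d w v = n" using d_step u Suc.prems B_sub by blast
      then have "w \<in> B v n" "u \<in> nbrs E w"
        using adjD[OF w(1)] d_sym Suc.prems adj_sym by (auto simp: B_def nbrs_def adj_def)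
      then show ?thesis by blast
    qed
  qed
  moreover have "finite (nbrs E u)" if "u \<in> B v n" for u
    using that loc_fin B_sub by (auto simp: locally_finite_def)
  ultimately show ?case using Suc by (meson finite_UN_I finite_UnI finite_subset)
qed

lemma finite_in_B:
  assumes "v \<in> V" "finite S" "S \<subseteq> V"
  obtains n where "S \<subseteq> B v n"
proof -
  have "S \<subseteq> B v (Max (insert 0 (d v ` S)))" using assms by (auto simp: B_def intro!: Max_ge)
  then show thesis using that by blast
qed

lemma infinite_V: "infinite V"
proof
  assume fin: "finite V"
  obtain v where v: "v \<in> V" using V_ne by blast
  obtain w where "adj v w" using exists_farther[OF v v] by blast
  then have "\<exists>u\<in>V. d u v = Suc n" for n using h_deep h_sub by blast
  then have "range Suc \<subseteq> (\<lambda>u. d u v) ` V" by (auto simp: image_iff) metis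
  then have "finite (range Suc)" using fin finite_subset by blast
  then show False using finite_imageD[of Suc UNIV] by auto
qed

lemma parity:
  assumes "adj u v" "x \<in> V" shows "even (d x u) \<longleftrightarrow> odd (d x v)"
proof -
  have "d x u \<noteq> d x v" using d_neq assms by blast
  moreover have "d x u \<le> Suc (d x v)" "d x v \<le> Suc (d x u)"
    using d_adj_le[OF assms] d_adj_le[OF adj_sym[OF assms(1)] assms(2)] adjD[OF assms(1)] assms d_sym by auto
  ultimately have "d x u = Suc (d x v) \<or> d x v = Suc (d x u)" by linarith
  then show ?thesis by auto
qed

lemma parity_add:
  assumes "u \<in> V" "v \<in> V" "x \<in> V"
  shows "even (d u v) \<longleftrightarrow> (even (d x u) \<longleftrightarrow> even (d x v))"
  using assms(1)
proof (induction "d u v" arbitrary: u)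
  case 0
  then show ?case using assms by simp
next
  case (Suc n)
  then obtain w where w: "adj u w" "d w v = n" using d_step assms by metis
  then have "even (d w v) \<longleftrightarrow> (even (d x w) \<longleftrightarrow> even (d x v))" using Suc adjD by metis
  then show ?case using parity[OF w(1) assms(3)] w Suc.hyps by (metis even_Suc)
qed

section \<open>Automorphisms\<close>

sublocale A: group "Aut V E" by (rule group_Aut)

abbreviation mul (infixl "\<odot>" 70) where "g \<odot> k \<equiv> g \<otimes>\<^bsub>Aut V E\<^esub> k"
abbreviation inv' where "inv' g \<equiv> inv\<^bsub>Aut V E\<^esub> g"
abbreviation one' where "one' \<equiv> \<one>\<^bsub>Aut V E\<^esub>"
abbreviation sub where "sub H \<equiv> subgroup H (Aut V E)"

lemmas mul_closed [simp, intro] = A.m_closed[unfolded carrier_Aut]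
lemmas inv_closed [simp, intro] = A.inv_closed[unfolded carrier_Aut]
lemmas one_closed [simp, intro] = A.one_closed[unfolded carrier_Aut]
lemmas mul_assoc = A.m_assoc[unfolded carrier_Aut]
lemmas l_one' [simp] = A.l_one[unfolded carrier_Aut]
lemmas r_one' [simp] = A.r_one[unfolded carrier_Aut]
lemmas l_inv' [simp] = A.l_inv[unfolded carrier_Aut]
lemmas r_inv' [simp] = A.r_inv[unfolded carrier_Aut]
lemmas inv_mul = A.inv_mult_group[unfolded carrier_Aut]
lemmas inv_inv' [simp] = A.inv_inv[unfolded carrier_Aut]

lemma auts_Bij: "g \<in> auts V E \<Longrightarrow> g \<in> Bij V"
  by (simp add: auts_def)

lemma app_closed [simp, intro]: "g \<in> auts V E \<Longrightarrow> v \<in> V \<Longrightarrow> g v \<in> V"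
  using auts_Bij[of g] by (auto simp: Bij_def bij_betw_def)

lemma app_mul [simp]: "g \<in> auts V E \<Longrightarrow> k \<in> auts V E \<Longrightarrow> v \<in> V \<Longrightarrow> (g \<odot> k) v = g (k v)"
  by (simp add: Aut_def BijGroup_def auts_Bij compose_eq)

lemma app_one [simp]: "v \<in> V \<Longrightarrow> one' v = v"
  by (simp add: Aut_def BijGroup_def)

lemma app_inv [simp]:
  assumes "g \<in> auts V E" "v \<in> V" shows "inv' g (g v) = v" "g (inv' g v) = v"
  using app_mul[of "inv' g" g v] app_mul[of g "inv' g" v] assms by auto

lemma auts_eqI: "g \<in> auts V E \<Longrightarrow> k \<in> auts V E \<Longrightarrow> (\<And>v. v \<in> V \<Longrightarrow> g v = k v) \<Longrightarrow> g = k"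
  by (auto dest!: auts_Bij simp: Bij_def intro!: extensionalityI[of _ V])

lemma app_inj: "g \<in> auts V E \<Longrightarrow> u \<in> V \<Longrightarrow> v \<in> V \<Longrightarrow> g u = g v \<longleftrightarrow> u = v"
  by (metis app_inv(1))

lemma adj_app:
  assumes "g \<in> auts V E" "u \<in> V" "v \<in> V" shows "adj (g u) (g v) \<longleftrightarrow> adj u v"
  using assms by (simp add: auts_def adj_def)

lemma adj_app': "g \<in> auts V E \<Longrightarrow> adj u v \<Longrightarrow> adj (g u) (g v)"
  using adj_app[of g u v] adjD[of u v] by simp

lemma autsI:
  assumes "g \<in> extensional V" "\<And>v. v \<in> V \<Longrightarrow> g v \<in> V" "inj_on g V" "V \<subseteq> g ` V"
    "\<And>u v. u \<in> V \<Longrightarrow> v \<in> V \<Longrightarrow> adj (g u) (g v) \<longleftrightarrow> adj u v"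
  shows "g \<in> auts V E"
  using assms by (auto simp: auts_def Bij_def bij_betw_def adj_def)

lemma d_app_le:
  assumes "g \<in> auts V E" "u \<in> V" "v \<in> V" shows "d (g u) (g v) \<le> d u v"
  using assms
proof (induction "d u v" arbitrary: u)
  case 0
  have "u = v" using d_eq_0[OF 0(3,4)] 0(1) by simp
  then show ?case by simp
next
  case (Suc n)
  obtain w where w: "adj u w" "d w v = n" using d_step[OF Suc.prems(2,3)] Suc.hyps(2) by metis
  have "d (g w) (g v) \<le> n" using Suc.hyps(1)[of w] w Suc.prems adjD(2) by blast
  moreover have "d (g u) (g v) \<le> Suc (d (g w) (g v))"
    using d_adj_le[OF adj_app'[OF assms(1) w(1)]] assms by blast
  ultimately show ?case using Suc.hyps(2) by linarith
qed

lemma d_app [simp]: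
  assumes "g \<in> auts V E" "u \<in> V" "v \<in> V" shows "d (g u) (g v) = d u v"
  using d_app_le[of "inv' g" "g u" "g v"] d_app_le[of g u v] assms by simp

lemma app_h [simp]:
  assumes "g \<in> auts V E" "a \<in> V" "b \<in> V" "u \<in> V"
  shows "g u \<in> h (g a) (g b) \<longleftrightarrow> u \<in> h a b"
  using assms by (simp add: h_def)

lemma image_h:
  assumes "g \<in> auts V E" "a \<in> V" "b \<in> V" shows "g ` h a b = h (g a) (g b)"
proof
  show "g ` h a b \<subseteq> h (g a) (g b)" using assms h_sub[of a b] by auto
  show "h (g a) (g b) \<subseteq> g ` h a b"
  proof
    fix u assume u: "u \<in> h (g a) (g b)"
    have uV: "u \<in> V" using u h_sub by blast
    have "inv' g u \<in> h a b"
      using app_h[of g a b "inv' g u"] assms u uV by simp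
    moreover have "u = g (inv' g u)" using u h_sub[of "g a" "g b"] assms by auto
    ultimately show "u \<in> g ` h a b" by blast
  qed
qed

lemma app_B:
  assumes "g \<in> auts V E" "u \<in> V" "v \<in> V" shows "g u \<in> B (g v) n \<longleftrightarrow> u \<in> B v n"
  using assms by (simp add: B_def)

lemma image_B:
  assumes "g \<in> auts V E" "v \<in> V" shows "g ` B v n = B (g v) n"
proof
  show "g ` B v n \<subseteq> B (g v) n" using assms by (auto simp: B_def)
  show "B (g v) n \<subseteq> g ` B v n"
  proof
    fix u assume u: "u \<in> B (g v) n"
    have uV: "u \<in> V" using u B_sub by blast
    have "inv' g u \<in> B v n"
      using app_B[of g "inv' g u" v] assms u uV by simp
    moreover have "u = g (inv' g u)" using u B_sub[of "g v" n] assms by auto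
    ultimately show "u \<in> g ` B v n" by blast
  qed
qed

lemma sub_auts: "sub H \<Longrightarrow> g \<in> H \<Longrightarrow> g \<in> auts V E"
  using subgroup.subset by force
lemma sub_mul [simp, intro]: "sub H \<Longrightarrow> g \<in> H \<Longrightarrow> k \<in> H \<Longrightarrow> g \<odot> k \<in> H"
  by (rule subgroup.m_closed)
lemma sub_inv [simp, intro]: "sub H \<Longrightarrow> g \<in> H \<Longrightarrow> inv' g \<in> H"
  by (rule subgroup.m_inv_closed)
lemma sub_one [simp, intro]: "sub H \<Longrightarrow> one' \<in> H"
  by (rule subgroup.one_closed)

lemma subI:
  assumes "H \<subseteq> auts V E" "one' \<in> H" "\<And>g k. g \<in> H \<Longrightarrow> k \<in> H \<Longrightarrow> g \<odot> k \<in> H"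
    "\<And>g. g \<in> H \<Longrightarrow> inv' g \<in> H"
  shows "sub H"
  by (rule A.subgroupI) (use assms in auto)

lemma inv_sub: "sub H \<Longrightarrow> g \<in> H \<Longrightarrow> inv\<^bsub>Aut V E\<lparr>carrier := H\<rparr>\<^esub> g = inv' g"
  using A.m_inv_consistent by metis

section \<open>Pointwise stabilisers and orbits\<close>

definition Fix :: "('v \<Rightarrow> 'v) set \<Rightarrow> 'v set \<Rightarrow> ('v \<Rightarrow> 'v) set" where
  "Fix H S = {g \<in> H. \<forall>v\<in>S. g v = v}"

lemma sub_Fix: "sub H \<Longrightarrow> S \<subseteq> V \<Longrightarrow> sub (Fix H S)"
proof (rule subI)
  fix g assume *: "sub H" "S \<subseteq> V" "g \<in> Fix H S"
  have g: "g \<in> auts V E" using * sub_auts by (auto simp: Fix_def)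
  have "inv' g v = v" if "v \<in> S" for v
  proof -
    have "g v = v" "v \<in> V" using * that by (auto simp: Fix_def)
    then show ?thesis using app_inv(1)[OF g, of v] by simp
  qed
  then show "inv' g \<in> Fix H S" using * by (auto simp: Fix_def)
qed (auto simp: Fix_def dest: sub_auts, auto simp: subset_iff sub_auts)

definition orb :: "('v \<Rightarrow> 'v) set \<Rightarrow> 'v \<Rightarrow> 'v set" where
  "orb H v = (\<lambda>g. g v) ` H"

lemma orb_self: "sub H \<Longrightarrow> v \<in> V \<Longrightarrow> v \<in> orb H v"
  unfolding orb_def by (rule image_eqI[of _ _ one']) auto

lemma orb_sub: "sub H \<Longrightarrow> v \<in> V \<Longrightarrow> orb H v \<subseteq> V"
  by (auto simp: orb_def sub_auts)

lemma orb_app: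
  assumes "sub H" "v \<in> V" "g \<in> H" shows "orb H (g v) = orb H v"
proof
  have g: "g \<in> auts V E" using assms sub_auts by blast
  show "orb H (g v) \<subseteq> orb H v"
  proof
    fix u assume "u \<in> orb H (g v)"
    then obtain k where k: "k \<in> H" "u = k (g v)" by (auto simp: orb_def)
    then have "u = (k \<odot> g) v" using assms g sub_auts by auto
    then show "u \<in> orb H v" using k assms by (auto simp: orb_def)
  qed
  show "orb H v \<subseteq> orb H (g v)"
  proof
    fix u assume "u \<in> orb H v"
    then obtain k where k: "k \<in> H" "u = k v" by (auto simp: orb_def)
    then have "u = (k \<odot> inv' g) (g v)" using assms g sub_auts by auto
    then show "u \<in> orb H (g v)" using k assms by (auto simp: orb_def)
  qed
qed

lemma orb_eq_iff: "sub H \<Longrightarrow> u \<in> V \<Longrightarrow> v \<in> V \<Longrightarrow> orb H u = orb H v \<longleftrightarrow> (\<exists>g\<in>H. g u = v)"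
  using orb_self[of H v] orb_app[of H u]
  unfolding orb_def[of H u] by (metis (no_types, lifting) imageE)

lemma orbits_eq: "orbits (Aut V E\<lparr>carrier := H\<rparr>) V (\<lambda>g. g) = orb H ` V"
  by (auto simp: orbits_def orbit_def orb_def)

lemma Sub_le_iff: "H \<in> Sub_le V E C \<longleftrightarrow> sub H \<and> closedin (aut_topology V E) H
    \<and> finite (orb H ` V) \<and> real (card (orb H ` V)) \<le> C"
  by (auto simp: Sub_le_def orbits_eq closed_subgroups_def)

text \<open>The number of orbits meeting a ball increases strictly with the radius until it stabilises.\<close>

lemma orbits_meet_ball:
  assumes H: "sub H" and fin: "finite (orb H ` V)" and c: "card (orb H ` V) \<le> n" and v: "v \<in> V" "u \<in> V"
  obtains g where "g \<in> H" "g u \<in> B v n"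
proof -
  define M where "M m = orb H ` B v m" for m
  have fO: "finite (M m)" for m using finite_B v by (simp add: M_def)
  have mono: "M m \<subseteq> M (Suc m)" for m using B_mono[of m "Suc m" v] by (auto simp: M_def)
  have stable: "M (Suc m) \<subseteq> M (Suc n)" if "M (Suc n) = M n" for n m
  proof (induction m)
    case 0
    show ?case using B_mono[of "Suc 0" "Suc n" v] by (auto simp: M_def)
  next
    case (Suc m)
    show ?case
    proof
      fix o1 assume "o1 \<in> M (Suc (Suc m))"
      then obtain x where x: "x \<in> B v (Suc (Suc m))" "o1 = orb H x" by (auto simp: M_def)
      show "o1 \<in> M (Suc n)"
      proof (cases "d x v = Suc (Suc m)")
        case False
        then have "x \<in> B v (Suc m)" using x v d_sym[of x v] by (auto simp: B_def)
        then show ?thesis using Suc x by (auto simp: M_def)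
      next
        case True
        have xV: "x \<in> V" using x B_sub by blast
        obtain w where w: "adj x w" "d w v = Suc m" using d_step[OF xV v(1) True] .
        have wV: "w \<in> V" using w adjD by blast
        have "w \<in> B v (Suc m)" using w wV v d_sym[of w v] by (auto simp: B_def)
        then have "orb H w \<in> M n" using Suc that by (auto simp: M_def)
        then obtain y where y: "y \<in> B v n" "orb H w = orb H y" by (auto simp: M_def)
        have yV: "y \<in> V" using y B_sub by blast
        \<comment> \<open>Moving \<open>w\<close>, the neighbour of \<open>x\<close> on the way to
          \<open>v\<close>, into the ball of radius \<open>n\<close> brings \<open>x\<close> into
          the ball of radius \<open>n + 1\<close>.\<close>
        obtain g where g: "g \<in> H" "g w = y" using y orb_eq_iff[OF H wV yV] by blast
        have "adj y (g x)" using g w adj_app'[of g w x] adj_sym H sub_auts by metis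
        then have "d v (g x) \<le> Suc n"
          using d_triangle[of v y "g x"] d_adj[of y "g x"] adjD v y by (fastforce simp: B_def)
        then have "g x \<in> B v (Suc n)" using g xV H sub_auts by (auto simp: B_def)
        moreover have "orb H (g x) = orb H x" using orb_app H xV g by blast
        ultimately show ?thesis using x by (auto simp: M_def)
      qed
    qed
  qed
  have all: "orb H ` V \<subseteq> (\<Union>m. M (Suc m))"
  proof
    fix o1 assume "o1 \<in> orb H ` V"
    then obtain x where "x \<in> V" "o1 = orb H x" by auto
    then have "o1 \<in> M (Suc (d v x))" by (auto simp: M_def B_def)
    then show "o1 \<in> (\<Union>m. M (Suc m))" by blast
  qed
  have "orb H ` V \<subseteq> M m \<or> card (M m) \<ge> Suc m" for m
  proof (induction m)
    case 0
    have "M 0 \<noteq> {}" using v B_self by (auto simp: M_def)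
    then show ?case using fO[of 0] by (simp add: Suc_le_eq card_gt_0_iff)
  next
    case (Suc m)
    show ?case
    proof (cases "M (Suc m) = M m")
      case True
      have "(\<Union>m. M (Suc m)) \<subseteq> M (Suc m)" using stable[OF True] by (intro UN_least)
      then have "orb H ` V \<subseteq> M (Suc m)" using all by (rule subset_trans[rotated])
      then show ?thesis ..
    next
      case False
      then have "card (M m) < card (M (Suc m))" using mono fO by (intro psubset_card_mono) auto
      moreover have "orb H ` V \<subseteq> M m \<Longrightarrow> orb H ` V \<subseteq> M (Suc m)" using mono[of m] by (rule subset_trans[rotated])
      ultimately show ?thesis using Suc.IH by linarith
    qed
  qed
  moreover have "M n \<subseteq> orb H ` V" using B_sub by (auto simp: M_def)
  then have "card (M n) \<le> n" using card_mono[OF fin] c by (meson le_trans)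
  ultimately have "orb H ` V \<subseteq> M n" by (metis not_less_eq_eq)
  then obtain y where y: "y \<in> B v n" "orb H u = orb H y" using v by (auto simp: M_def)
  then obtain g where "g \<in> H" "g u = y" using orb_eq_iff[OF H v(2), of y] B_sub by blast
  then show thesis using y that by blast
qed

section \<open>The topology\<close>

abbreviation X where "X \<equiv> aut_topology V E"
abbreviation prodV where "prodV \<equiv> product_topology (\<lambda>_. discrete_topology V) V"
abbreviation nofi where
  "nofi H \<equiv> no_proper_open_finite_index (Aut V E\<lparr>carrier := H\<rparr>) (subtopology X H)"

lemma openin_prodV:
  "openin prodV W \<longleftrightarrow> W \<subseteq> V \<rightarrow>\<^sub>E V \<and> (\<forall>g\<in>W. \<exists>S. finite S \<and> S \<subseteq> V \<and>
     (\<forall>g'\<in>V \<rightarrow>\<^sub>E V. (\<forall>v\<in>S. g' v = g v) \<longrightarrow> g' \<in> W))" (is "?l \<longleftrightarrow> ?r")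
proof
  assume l: ?l
  have sub: "W \<subseteq> V \<rightarrow>\<^sub>E V" using openin_subset[OF l] by simp
  moreover have "\<exists>S. finite S \<and> S \<subseteq> V \<and> (\<forall>g'\<in>V \<rightarrow>\<^sub>E V. (\<forall>v\<in>S. g' v = g v) \<longrightarrow> g' \<in> W)"
    if g: "g \<in> W" for g
  proof -
    obtain U where U: "finite {i \<in> V. U i \<noteq> V}" "\<forall>i\<in>V. U i \<subseteq> V" "g \<in> Pi\<^sub>E V U" "Pi\<^sub>E V U \<subseteq> W"
      using l g by (auto simp: openin_product_topology_alt)
    show ?thesis
    proof (intro exI conjI ballI impI)
      fix g' assume g': "g' \<in> V \<rightarrow>\<^sub>E V" "\<forall>v\<in>{i \<in> V. U i \<noteq> V}. g' v = g v"
      have "g' i \<in> U i" if "i \<in> V" for i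
        using that g' U(3) by (cases "U i = V") (auto simp: PiE_iff)
      then have "g' \<in> Pi\<^sub>E V U" using g' by (auto simp: PiE_iff)
      then show "g' \<in> W" using U(4) by blast
    qed (use U in auto)
  qed
  ultimately show ?r by (intro conjI ballI)
next
  assume r: ?r
  show ?l unfolding openin_product_topology_alt
  proof
    fix g assume g: "g \<in> W"
    then obtain S where S: "finite S" "S \<subseteq> V" "\<forall>g'\<in>V \<rightarrow>\<^sub>E V. (\<forall>v\<in>S. g' v = g v) \<longrightarrow> g' \<in> W"
      using r by blast
    define U where "U i = (if i \<in> S then {g i} else V)" for i
    have gV: "g \<in> V \<rightarrow>\<^sub>E V" using g r by blast
    have "{i \<in> V. U i \<noteq> V} \<subseteq> S" by (auto simp: U_def)
    then have "finite {i \<in> V. U i \<noteq> topspace (discrete_topology V)}" using S finite_subset by auto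
    moreover have "\<forall>i\<in>V. openin (discrete_topology V) (U i)" using gV by (auto simp: U_def PiE_iff)
    moreover have "g \<in> Pi\<^sub>E V U" using gV by (auto simp: U_def PiE_iff)
    moreover have "Pi\<^sub>E V U \<subseteq> W"
    proof
      fix g' assume g': "g' \<in> Pi\<^sub>E V U"
      have "g' v = g v" if "v \<in> S" for v using PiE_mem[OF g', of v] that S by (auto simp: U_def)
      moreover have "g' v \<in> V" if "v \<in> V" for v
        using PiE_mem[OF g', of v] that gV by (auto simp: U_def PiE_iff split: if_splits)
      ultimately show "g' \<in> W" using S(3) g' by (auto simp: PiE_iff)
    qed
    ultimately show "\<exists>U. finite {i \<in> V. U i \<noteq> topspace (discrete_topology V)} \<and>
      (\<forall>i\<in>V. openin (discrete_topology V) (U i)) \<and> g \<in> Pi\<^sub>E V U \<and> Pi\<^sub>E V U \<subseteq> W" by blast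
  qed
qed

lemma auts_sub_prod: "auts V E \<subseteq> V \<rightarrow>\<^sub>E V"
  by (auto simp: auts_def Bij_def PiE_def bij_betw_def)

text \<open>Reduces all later topological questions to agreement on finite sets of vertices.\<close>

lemma openin_aut:
  "openin X W \<longleftrightarrow> W \<subseteq> auts V E \<and> (\<forall>g\<in>W. \<exists>S. finite S \<and> S \<subseteq> V \<and>
     (\<forall>g'\<in>auts V E. (\<forall>v\<in>S. g' v = g v) \<longrightarrow> g' \<in> W))" (is "?l \<longleftrightarrow> ?r")
proof
  assume ?l
  then obtain T where T: "openin prodV T" "W = T \<inter> auts V E"
    by (auto simp: aut_topology_def openin_subtopology)
  then show ?r using auts_sub_prod unfolding openin_prodV by (auto 4 4)
next
  assume r: ?r
  \<comment> \<open>\<open>W\<close> has to be the trace of an open set of functions: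
    \<open>T\<close> is the union of the cylinders around points of \<open>W\<close> whose
    automorphisms all lie in \<open>W\<close>.\<close>
  define T where "T = {f \<in> V \<rightarrow>\<^sub>E V. \<exists>g\<in>W. \<exists>S. finite S \<and> S \<subseteq> V \<and> (\<forall>v\<in>S. f v = g v) \<and>
     (\<forall>g'\<in>auts V E. (\<forall>v\<in>S. g' v = g v) \<longrightarrow> g' \<in> W)}"
  have "openin prodV T" unfolding openin_prodV
  proof (intro conjI ballI)
    fix f assume "f \<in> T"
    then obtain g S where gS: "g \<in> W" "finite S" "S \<subseteq> V" "\<forall>v\<in>S. f v = g v"
      "\<forall>g'\<in>auts V E. (\<forall>v\<in>S. g' v = g v) \<longrightarrow> g' \<in> W" by (auto simp: T_def)
    show "\<exists>S. finite S \<and> S \<subseteq> V \<and> (\<forall>g'\<in>V \<rightarrow>\<^sub>E V. (\<forall>v\<in>S. g' v = f v) \<longrightarrow> g' \<in> T)"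
    proof (intro exI[of _ S] conjI ballI impI)
      fix f' assume "f' \<in> V \<rightarrow>\<^sub>E V" "\<forall>v\<in>S. f' v = f v"
      then show "f' \<in> T" unfolding T_def using gS by auto
    qed (use gS in auto)
  qed (auto simp: T_def)
  moreover have "W = T \<inter> auts V E"
  proof
    show "W \<subseteq> T \<inter> auts V E"
    proof
      fix g assume g: "g \<in> W"
      then have gA: "g \<in> auts V E" using r by blast
      obtain S where "finite S" "S \<subseteq> V" "\<forall>g'\<in>auts V E. (\<forall>v\<in>S. g' v = g v) \<longrightarrow> g' \<in> W"
        using r g by blast
      then have "g \<in> T" unfolding T_def using g gA auts_sub_prod by blast
      then show "g \<in> T \<inter> auts V E" using gA by blast
    qed
    show "T \<inter> auts V E \<subseteq> W" by (auto simp: T_def)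
  qed
  ultimately show ?l by (auto simp: aut_topology_def openin_subtopology)
qed

text \<open>A bound on the displacement of \<open>v0\<close> confines the image of every vertex to a
  finite ball, so the set lies in a compact product. It is closed since a function that agrees on
  every ball around \<open>v0\<close> with such an automorphism is one itself.\<close>

lemma compactin_displacement:
  assumes v0: "v0 \<in> V"
  shows "compactin X {g \<in> auts V E. d v0 (g v0) \<le> D}"
proof -
  let ?K = "{g \<in> auts V E. d v0 (g v0) \<le> D}"
  let ?P = "Pi\<^sub>E V (\<lambda>v. B v0 (D + d v0 v))"
  have "compactin prodV ?P"
    using finite_B[OF v0] B_sub by (auto simp: compactin_PiE compactin_discrete_topology)
  moreover have "?K \<subseteq> ?P"
  proof
    fix g assume g: "g \<in> ?K"
    have "d v0 (g v) \<le> D + d v0 v" if "v \<in> V" for v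
      using d_triangle[of v0 "g v0" "g v"] g v0 that by simp
    then show "g \<in> ?P" using g auts_sub_prod by (auto simp: PiE_iff B_def)
  qed
  moreover have "closedin prodV ?K" unfolding closedin_def
  proof
    show "?K \<subseteq> topspace prodV" using auts_sub_prod by auto
    have "\<exists>S. finite S \<and> S \<subseteq> V \<and> (\<forall>g'\<in>V \<rightarrow>\<^sub>E V. (\<forall>v\<in>S. g' v = f v) \<longrightarrow> g' \<in> (V \<rightarrow>\<^sub>E V) - ?K)"
      if f: "f \<in> (V \<rightarrow>\<^sub>E V) - ?K" for f
    proof (rule ccontr)
      assume neg: "\<not> ?thesis"
      have ex: "\<exists>k\<in>?K. \<forall>v\<in>B v0 n. k v = f v" for n
      proof (rule ccontr)
        assume *: "\<not> ?thesis"
        show False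
          by (rule notE[OF neg], rule exI[of _ "B v0 n"]) (use * finite_B[OF v0] B_sub in auto)
      qed
      have agree: "\<exists>k\<in>?K. k v0 = f v0 \<and> k u = f u \<and> k v = f v" if "u \<in> V" "v \<in> V" for u v
      proof -
        have "{v0, u, v} \<subseteq> B v0 (max (d v0 u) (d v0 v))" using that v0 by (auto simp: B_def)
        then show ?thesis using ex[of "max (d v0 u) (d v0 v)"] by auto
      qed
      have "f \<in> auts V E"
      proof (rule autsI)
        show "f \<in> extensional V" "\<And>v. v \<in> V \<Longrightarrow> f v \<in> V" using f by (auto simp: PiE_iff)
        show "inj_on f V"
        proof (rule inj_onI)
          fix u v assume uv: "u \<in> V" "v \<in> V" "f u = f v"
          from agree[OF uv(1,2)] obtain k where "k \<in> ?K" "k u = f u" "k v = f v" by blast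
          then show "u = v" using app_inj[of k u v] uv by simp
        qed
        show "V \<subseteq> f ` V"
        proof
          fix y assume y: "y \<in> V"
          \<comment> \<open>Surjectivity: \<open>k\<close> maps the ball of this radius around
            \<open>v0\<close> onto the ball around \<open>f v0\<close> that just reaches
            \<open>y\<close>.\<close>
          from ex[of "d (f v0) y"] obtain k where k: "k \<in> ?K" "\<forall>v\<in>B v0 (d (f v0) y). k v = f v" by blast
          then have "f v0 = k v0" using B_self v0 by auto
          then have "y \<in> B (k v0) (d (f v0) y)" using y by (auto simp: B_def)
          then obtain x where "x \<in> B v0 (d (f v0) y)" "y = k x" using image_B[of k v0] k v0 by blast
          then show "y \<in> f ` V" using k B_sub by (metis image_eqI subsetD)
        qed
        fix u v assume uv: "u \<in> V" "v \<in> V"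
        from agree[OF uv(1,2)] obtain k where "k \<in> ?K" "k u = f u" "k v = f v" by blast
        then show "adj (f u) (f v) \<longleftrightarrow> adj u v" using adj_app[of k u v] uv by simp
      qed
      moreover have "d v0 (f v0) \<le> D" using agree[OF v0 v0] by auto
      ultimately show False using f by blast
    qed
    then show "openin prodV (topspace prodV - ?K)" unfolding openin_prodV by auto
  qed
  ultimately have "compactin prodV ?K" by (rule closed_compactin)
  then show ?thesis by (auto simp: aut_topology_def compactin_subtopology)
qed

section \<open>Open subgroups of finite index\<close>

lemma rcos_eq:
  "r_coset (Aut V E\<lparr>carrier := H\<rparr>) L x = r_coset (Aut V E) L x"
  by (simp add: r_coset_def)

lemma openin_sub:
  assumes H: "sub H" and L: "sub L" "L \<subseteq> H" and S: "finite S" "S \<subseteq> V" "Fix H S \<subseteq> L"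
  shows "openin (subtopology X H) L"
proof -
  define T where "T = {g \<in> auts V E. \<exists>l\<in>L. \<forall>v\<in>S. g v = l v}"
  have "openin X T" unfolding openin_aut
  proof (intro conjI ballI)
    fix g assume g: "g \<in> T"
    then obtain l where "l \<in> L" "\<forall>v\<in>S. g v = l v" by (auto simp: T_def)
    then show "\<exists>S. finite S \<and> S \<subseteq> V \<and> (\<forall>g'\<in>auts V E. (\<forall>v\<in>S. g' v = g v) \<longrightarrow> g' \<in> T)"
      using S by (intro exI[of _ S]) (auto simp: T_def)
  qed (auto simp: T_def)
  moreover have "L = T \<inter> H"
  proof
    show "L \<subseteq> T \<inter> H" using L sub_auts[OF L(1)] by (auto simp: T_def)
    show "T \<inter> H \<subseteq> L"
    proof
      fix g assume g: "g \<in> T \<inter> H"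
      then obtain l where l: "l \<in> L" "\<forall>v\<in>S. g v = l v" by (auto simp: T_def)
      have A: "g \<in> auts V E" "l \<in> auts V E" using g l L sub_auts by (auto simp: T_def)
      have "inv' l \<odot> g \<in> Fix H S"
        using g l L H S A by (auto simp: Fix_def subset_iff)
      then have "l \<odot> (inv' l \<odot> g) \<in> L" using S l L by auto
      then show "g \<in> L" using A by (simp add: mul_assoc[symmetric])
    qed
  qed
  ultimately show ?thesis by (auto simp: openin_subtopology)
qed

text \<open>The form in which the hypothesis is applied. The finite set \<open>S\<close> witnesses
  openness of \<open>L\<close>, and \<open>\<Phi>\<close>, which need not be a homomorphism,
  witnesses finite index: it has finite range and separates the right cosets of
  \<open>L\<close>.\<close>

lemma nofi_eq:
  assumes H: "sub H" "nofi H" and L: "sub L" "L \<subseteq> H" and S: "finite S" "S \<subseteq> V" "Fix H S \<subseteq> L"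
    and fin: "finite (\<Phi> ` H)" and \<Phi>: "\<And>g k. g \<in> H \<Longrightarrow> k \<in> H \<Longrightarrow> \<Phi> g = \<Phi> k \<Longrightarrow> g \<odot> inv' k \<in> L"
  shows "L = H"
proof -
  let ?G = "Aut V E\<lparr>carrier := H\<rparr>"
  have "subgroup L ?G" using A.subgroup_incl L H by blast
  moreover have "openin (subtopology X H) L" using openin_sub H L S by blast
  moreover have "finite (rcosets\<^bsub>?G\<^esub> L)"
  proof -
    let ?c = "\<lambda>p. r_coset (Aut V E) L (SOME x. x \<in> H \<and> \<Phi> x = p)"
    have "rcosets\<^bsub>?G\<^esub> L \<subseteq> ?c ` \<Phi> ` H"
    proof
      fix R assume "R \<in> rcosets\<^bsub>?G\<^esub> L"
      then obtain x where x: "x \<in> H" "R = r_coset (Aut V E) L x" by (auto simp: RCOSETS_def rcos_eq)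
      define y where "y = (SOME y. y \<in> H \<and> \<Phi> y = \<Phi> x)"
      have "\<exists>y. y \<in> H \<and> \<Phi> y = \<Phi> x" using x by blast
      from someI_ex[OF this] have y: "y \<in> H \<and> \<Phi> y = \<Phi> x" by (simp add: y_def)
      have A: "x \<in> auts V E" "y \<in> auts V E" using x y H sub_auts by auto
      have Lc: "L \<subseteq> auts V E" using L sub_auts by blast
      have "y \<odot> inv' x \<in> L" using \<Phi> x y by blast
      then have "r_coset (Aut V E) L (y \<odot> inv' x) = L" using A.coset_join2 L A by auto
      then have "r_coset (Aut V E) L (y \<odot> inv' x \<odot> x) = r_coset (Aut V E) L x"
        using A.coset_mult_assoc[of L "y \<odot> inv' x" x] A Lc by simp
      then have "R = r_coset (Aut V E) L y" using x A by (simp add: mul_assoc)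
      then show "R \<in> ?c ` \<Phi> ` H" using x unfolding y_def by blast
    qed
    then show ?thesis using fin finite_subset by blast
  qed
  ultimately show ?thesis using H(2) by (simp add: no_proper_open_finite_index_def)
qed

text \<open>A continuous action on a finite set, with \<open>S\<close> witnessing continuity. The
  permutations are functions on the whole type that are the identity outside \<open>F\<close>, so
  that acting trivially means being equal to \<open>id\<close>.\<close>

definition finite_quotient :: "('v \<Rightarrow> 'v) set \<Rightarrow> 'f set \<Rightarrow> (('v \<Rightarrow> 'v) \<Rightarrow> 'f \<Rightarrow> 'f) \<Rightarrow> 'v set \<Rightarrow> bool" where
  "finite_quotient H F \<pi> S \<longleftrightarrow> finite F \<and> (\<forall>g\<in>H. \<pi> g permutes F) \<and>
     (\<forall>g\<in>H. \<forall>k\<in>H. \<pi> (g \<odot> k) = \<pi> g \<circ> \<pi> k) \<and> finite S \<and> S \<subseteq> V \<and> (\<forall>g\<in>Fix H S. \<pi> g = id)"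

lemma finite_quotient_one:
  assumes "sub H" "finite_quotient H F \<pi> S" shows "\<pi> one' = id"
proof -
  have "one' \<in> Fix H S" using assms by (auto simp: Fix_def finite_quotient_def subset_iff)
  then show ?thesis using assms by (auto simp: finite_quotient_def)
qed

lemma finite_quotient_inv:
  assumes H: "sub H" "finite_quotient H F \<pi> S" and g: "g \<in> H"
  shows "\<pi> g \<circ> \<pi> (inv' g) = id" "\<pi> (inv' g) \<circ> \<pi> g = id"
proof -
  have gA: "g \<in> auts V E" using g H sub_auts by blast
  have "\<pi> (g \<odot> inv' g) = \<pi> g \<circ> \<pi> (inv' g)" "\<pi> (inv' g \<odot> g) = \<pi> (inv' g) \<circ> \<pi> g"
    using H g by (auto simp: finite_quotient_def)
  then show "\<pi> g \<circ> \<pi> (inv' g) = id" "\<pi> (inv' g) \<circ> \<pi> g = id"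
    using finite_quotient_one[OF H] gA by auto
qed

lemma sub_kernel:
  assumes H: "sub H" "finite_quotient H F \<pi> S"
  shows "sub {g \<in> H. \<pi> g = id}"
proof (rule subI)
  show "one' \<in> {g \<in> H. \<pi> g = id}" using finite_quotient_one[OF H] H by auto
  fix g assume g: "g \<in> {g \<in> H. \<pi> g = id}"
  then show "inv' g \<in> {g \<in> H. \<pi> g = id}" using finite_quotient_inv(1)[OF H, of g] H by auto
next
  fix g k assume "g \<in> {g \<in> H. \<pi> g = id}" "k \<in> {g \<in> H. \<pi> g = id}"
  then show "g \<odot> k \<in> {g \<in> H. \<pi> g = id}" using H by (auto simp: finite_quotient_def)
qed (use H sub_auts in auto)

lemma finite_quotient_kernel:
  assumes H: "sub H" "finite_quotient H F \<pi> S" and gk: "g \<in> H" "k \<in> H" "\<pi> g = \<pi> k"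
  shows "\<pi> (g \<odot> inv' k) = id"
proof -
  have "\<pi> (g \<odot> inv' k) = \<pi> g \<circ> \<pi> (inv' k)" using H gk by (auto simp: finite_quotient_def)
  then show ?thesis using finite_quotient_inv(1)[OF H gk(2)] gk by simp
qed

lemma nofi_quotient_trivial:
  assumes H: "sub H" "nofi H" and q: "finite_quotient H F \<pi> S" and g: "g \<in> H"
  shows "\<pi> g = id"
proof -
  have "{g \<in> H. \<pi> g = id} = H"
  proof (rule nofi_eq[OF H sub_kernel[OF H(1) q]])
    have "\<pi> ` H \<subseteq> {p. p permutes F}" using q by (auto simp: finite_quotient_def)
    then show "finite (\<pi> ` H)" using q finite_subset finite_permutations by (auto simp: finite_quotient_def)
    show "g \<odot> inv' k \<in> {g \<in> H. \<pi> g = id}" if "g \<in> H" "k \<in> H" "\<pi> g = \<pi> k" for g k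
      using finite_quotient_kernel[OF H(1) q that] H that by auto
    show "finite S" "S \<subseteq> V" "Fix H S \<subseteq> {g \<in> H. \<pi> g = id}" using q by (auto simp: finite_quotient_def Fix_def)
  qed auto
  then show ?thesis using g by blast
qed

lemma inverse_permutes:
  assumes "f \<circ> f' = id" "f' \<circ> f = id" "\<And>x. x \<notin> F \<Longrightarrow> f x = x"
  shows "f permutes F"
  using assms o_bij[of f' f] by (auto simp: permutes_def bij_iff)

text \<open>The action on the right cosets of a proper open subgroup \<open>L\<close> of finite
  index, turned into a left action by inversion; an element outside \<open>L\<close> moves the coset
  \<open>L\<close>.\<close>

lemma not_nofi_quotient:
  assumes H: "sub H" "\<not> nofi H"
  obtains F :: "('v \<Rightarrow> 'v) set set" and \<pi> S h where "finite_quotient H F \<pi> S" "h \<in> H" "\<pi> h \<noteq> id"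
proof -
  let ?G = "Aut V E\<lparr>carrier := H\<rparr>"
  obtain L where L: "subgroup L ?G" "openin (subtopology X H) L" "finite (rcosets\<^bsub>?G\<^esub> L)" "L \<noteq> H"
    using H by (auto simp: no_proper_open_finite_index_def)
  have LH: "L \<subseteq> H" using subgroup.subset[OF L(1)] by simp
  have subL: "sub L" using A.incl_subgroup[OF H(1) L(1)] .
  obtain T where T: "openin X T" "L = T \<inter> H" using L by (auto simp: openin_subtopology)
  have oneL: "one' \<in> L" using subL by auto
  then obtain S where S: "finite S" "S \<subseteq> V" "\<forall>g'\<in>auts V E. (\<forall>v\<in>S. g' v = one' v) \<longrightarrow> g' \<in> T"
    using T unfolding openin_aut by blast
  have FixL: "Fix H S \<subseteq> L" using S T sub_auts[OF H(1)] by (auto simp: Fix_def subset_iff)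
  let ?c = "\<lambda>x. r_coset (Aut V E) L x"
  define F where "F = ?c ` H"
  have "rcosets\<^bsub>?G\<^esub> L = F" by (auto simp: RCOSETS_def F_def rcos_eq)
  then have finF: "finite F" using L by simp
  define \<pi> where "\<pi> g R = (if R \<in> F then r_coset (Aut V E) R (inv' g) else R)" for g R
  have Lc: "L \<subseteq> auts V E" using sub_auts[OF subL] by blast
  have HA: "g \<in> auts V E" if "g \<in> H" for g using sub_auts H that by blast
  have act: "\<pi> g (?c x) = ?c (x \<odot> inv' g)" if "g \<in> H" "x \<in> H" for g x
    using that A.coset_mult_assoc[of L x "inv' g"] Lc HA by (auto simp: \<pi>_def F_def)
  have hom: "\<pi> (g \<odot> k) = \<pi> g \<circ> \<pi> k" if gk: "g \<in> H" "k \<in> H" for g k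
  proof
    fix R show "\<pi> (g \<odot> k) R = (\<pi> g \<circ> \<pi> k) R"
    proof (cases "R \<in> F")
      case True
      then obtain x where x: "x \<in> H" "R = ?c x" by (auto simp: F_def)
      show ?thesis using x act gk H HA by (simp add: inv_mul mul_assoc)
    qed (simp add: \<pi>_def)
  qed
  have "\<pi> one' = id"
  proof
    fix R show "\<pi> one' R = id R"
    proof (cases "R \<in> F")
      case True
      then obtain x where x: "x \<in> H" "R = ?c x" by (auto simp: F_def)
      have "inv' one' = one'" by (rule A.inv_one)
      then show ?thesis using x act[of one' x] H HA by simp
    qed (simp add: \<pi>_def)
  qed
  then have inv: "\<pi> g \<circ> \<pi> (inv' g) = id \<and> \<pi> (inv' g) \<circ> \<pi> g = id" if "g \<in> H" for g
    using hom[of g "inv' g"] hom[of "inv' g" g] that H HA by auto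
  have perm: "\<pi> g permutes F" if "g \<in> H" for g
    using inv[OF that] by (intro inverse_permutes[of _ "\<pi> (inv' g)"]) (auto simp: \<pi>_def)
  have "\<forall>R\<in>F. \<exists>x. x \<in> H \<and> R = ?c x" by (auto simp: F_def)
  then obtain r where r: "\<forall>R\<in>F. r R \<in> H \<and> R = ?c (r R)" by metis
  \<comment> \<open>The stabiliser of the coset of \<open>x\<close> is the conjugate of
    \<open>L\<close> by the inverse of \<open>x\<close>, which contains the elements fixing
    \<open>inv' x\<close> applied to \<open>S\<close>. One representative \<open>x\<close> per coset
    suffices.\<close>
  define S' where "S' = (\<Union>R\<in>F. inv' (r R) ` S)"
  have "finite_quotient H F \<pi> S'"
    unfolding finite_quotient_def
  proof (intro conjI ballI)
    show "finite F" "finite S'" using finF S by (auto simp: S'_def)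
    show "S' \<subseteq> V" using r HA S by (auto simp: S'_def)
    fix g assume g: "g \<in> Fix H S'"
    then have gH: "g \<in> H" by (auto simp: Fix_def)
    show "\<pi> g = id"
    proof
      fix R show "\<pi> g R = id R"
      proof (cases "R \<in> F")
        case True
        let ?x = "r R"
        have x: "?x \<in> H" "R = ?c ?x" using r True by auto
        have "(?x \<odot> inv' g \<odot> inv' ?x) v = v" if v: "v \<in> S" for v
        proof -
          have vV: "v \<in> V" using v S by blast
          have "g (inv' ?x v) = inv' ?x v" using g v True by (auto simp: Fix_def S'_def)
          then have "inv' g (inv' ?x v) = inv' ?x v"
            using app_inv(1)[of g "inv' ?x v"] gH x HA vV by simp
          then show ?thesis using gH x HA vV by simp
        qed
        then have "?x \<odot> inv' g \<odot> inv' ?x \<in> L"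
          using FixL gH x H by (auto simp: Fix_def)
        then have "?c (?x \<odot> inv' g \<odot> inv' ?x) = L" using A.coset_join2 subL Lc by auto
        then have "?c (?x \<odot> inv' g \<odot> inv' ?x \<odot> ?x) = ?c ?x"
          using A.coset_mult_assoc[of L "?x \<odot> inv' g \<odot> inv' ?x" ?x] x gH HA Lc by simp
        then show ?thesis using act[OF gH x(1)] x gH HA by (simp add: mul_assoc)
      qed (simp add: \<pi>_def)
    qed
  qed (use perm hom S in auto)
  moreover obtain h where h: "h \<in> H" "h \<notin> L" using L LH by blast
  moreover have "\<pi> h \<noteq> id"
  proof
    assume "\<pi> h = id"
    moreover have "?c one' = L" using A.coset_mult_one Lc by simp
    ultimately have "?c (inv' h) = L" using act[of h one'] h H HA by simp
    then have "inv' h \<in> L" using A.coset_join1[of L "inv' h"] subL Lc h HA by auto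
    then have "inv' (inv' h) \<in> L" using subL by blast
    then show False using h HA by simp
  qed
  ultimately show thesis using that by blast
qed

section \<open>Counting edges along a path\<close>

text \<open>The edges crossed on the way from \<open>u\<close> to \<open>v\<close>, oriented in the
  direction of travel.\<close>

definition Sep :: "'v \<Rightarrow> 'v \<Rightarrow> ('v \<times> 'v) set" where
  "Sep u v = {(a, b). adj a b \<and> u \<notin> h a b \<and> v \<in> h a b}"

lemma finite_Sep:
  assumes "u \<in> V" "v \<in> V" shows "finite (Sep u v)"
  using assms
proof (induction "d u v" arbitrary: u)
  case 0
  have "u = v" using d_eq_0[OF 0(2,3)] 0(1) by simp
  then have "Sep u v = {}" by (auto simp: Sep_def)
  then show ?case by simp
next
  case (Suc n)
  obtain w where w: "adj u w" "d w v = n" using d_step[OF Suc.prems(1,2)] Suc.hyps(2) by metis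
  have "Sep u v \<subseteq> insert (u, w) (Sep w v)"
  proof
    fix e assume e: "e \<in> Sep u v"
    obtain a b where ab: "e = (a, b)" by fastforce
    show "e \<in> insert (u, w) (Sep w v)"
    proof (cases "w \<in> h a b")
      case True
      then have "w = b" "u = a" using h_cross[OF _ adj_sym[OF w(1)]] e ab by (auto simp: Sep_def)
      then show ?thesis using ab by simp
    next
      case False
      then show ?thesis using e ab by (auto simp: Sep_def)
    qed
  qed
  moreover have "finite (Sep w v)" using Suc.hyps(1)[of w] w Suc.prems adjD(2)[OF w(1)] by simp
  ultimately show ?case by (meson finite.insertI finite_subset)
qed

definition ind :: "'v \<times> 'v \<Rightarrow> 'v \<Rightarrow> int" where
  "ind e u = of_bool (u \<in> h (fst e) (snd e))"

text \<open>The signed number of edges of \<open>D\<close> crossed on the way from \<open>u\<close>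
  to \<open>v\<close>: those crossed forwards count 1, those crossed backwards -1. Restricting to
  separating edges makes the sum finite.\<close>

definition flow :: "('v \<times> 'v) set \<Rightarrow> 'v \<Rightarrow> 'v \<Rightarrow> int" where
  "flow D u v = (\<Sum>e\<in>D \<inter> (Sep u v \<union> Sep v u). ind e v - ind e u)"

text \<open>Edges that do not separate \<open>u\<close> from \<open>v\<close> contribute 0, so flows
  between different pairs can be computed over a common finite set.\<close>

lemma flow_superset:
  assumes "\<forall>(a, b)\<in>D. adj a b" "u \<in> V" "v \<in> V" "finite S" "D \<inter> (Sep u v \<union> Sep v u) \<subseteq> S" "S \<subseteq> D"
  shows "flow D u v = (\<Sum>e\<in>S. ind e v - ind e u)"
  unfolding flow_def
proof (rule sum.mono_neutral_left)
  show "\<forall>e\<in>S - D \<inter> (Sep u v \<union> Sep v u). ind e v - ind e u = 0"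
  proof
    fix e assume "e \<in> S - D \<inter> (Sep u v \<union> Sep v u)"
    then have "e \<in> D" "e \<notin> Sep u v" "e \<notin> Sep v u" using assms by auto
    then show "ind e v - ind e u = 0" using assms(1) by (cases e) (auto simp: Sep_def ind_def)
  qed
qed (use assms in auto)

lemma flow_add:
  assumes D: "\<forall>(a, b)\<in>D. adj a b" and V: "u \<in> V" "v \<in> V" "w \<in> V"
  shows "flow D u w = flow D u v + flow D v w"
proof -
  let ?S = "D \<inter> (Sep u v \<union> Sep v u \<union> Sep v w \<union> Sep w v \<union> Sep u w \<union> Sep w u)"
  have fin: "finite ?S" using finite_Sep V by blast
  have "flow D u w = (\<Sum>e\<in>?S. ind e w - ind e u)"
    "flow D u v = (\<Sum>e\<in>?S. ind e v - ind e u)" "flow D v w = (\<Sum>e\<in>?S. ind e w - ind e v)"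
    by (rule flow_superset[OF D _ _ fin]; use V in auto)+
  then show ?thesis by (simp add: sum.distrib[symmetric])
qed

lemma flow_self: "flow D u u = 0"
  by (simp add: flow_def)

lemma Sep_app:
  assumes g: "g \<in> auts V E" and uv: "u \<in> V" "v \<in> V" and "(a, b) \<in> Sep u v"
  shows "(g a, g b) \<in> Sep (g u) (g v)"
proof -
  have ab: "adj a b" "u \<notin> h a b" "v \<in> h a b" using assms by (auto simp: Sep_def)
  then show ?thesis using g uv adjD[OF ab(1)] adj_app'[OF g] by (simp add: Sep_def)
qed

lemma flow_app:
  assumes D: "\<forall>(a, b)\<in>D. adj a b" and H: "sub H" "g \<in> H"
    and inv: "\<forall>k\<in>H. \<forall>(a, b)\<in>D. (k a, k b) \<in> D" and V: "u \<in> V" "v \<in> V"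
  shows "flow D (g u) (g v) = flow D u v"
proof -
  have gA: "g \<in> auts V E" "inv' g \<in> auts V E" "inv' g \<in> H" using H sub_auts by auto
  let ?m = "\<lambda>k (a, b). (k a, k b) :: 'v \<times> 'v"
  show ?thesis unfolding flow_def
  proof (rule sum.reindex_bij_witness[of _ "?m g" "?m (inv' g)"])
    fix e assume e: "e \<in> D \<inter> (Sep (g u) (g v) \<union> Sep (g v) (g u))"
    obtain a b where ab: "e = (a, b)" by fastforce
    have adj: "adj a b" using e ab D by auto
    show "?m g (?m (inv' g) e) = e" using ab adjD[OF adj] gA by simp
    show "?m (inv' g) e \<in> D \<inter> (Sep u v \<union> Sep v u)"
      using bspec[OF bspec[OF inv gA(3)], of "(a, b)"] e ab Sep_app[OF gA(2), of "g u" "g v" a b]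
        Sep_app[OF gA(2), of "g v" "g u" a b] V gA by auto
    show "ind (?m (inv' g) e) v - ind (?m (inv' g) e) u = ind e (g v) - ind e (g u)"
      using app_h[OF gA(2), of a b "g u"] app_h[OF gA(2), of a b "g v"] ab adjD[OF adj] V gA
      by (simp add: ind_def)
  next
    fix e assume e: "e \<in> D \<inter> (Sep u v \<union> Sep v u)"
    obtain a b where ab: "e = (a, b)" by fastforce
    have adj: "adj a b" using e ab D by auto
    show "?m (inv' g) (?m g e) = e" using ab adjD[OF adj] gA by simp
    show "?m g e \<in> D \<inter> (Sep (g u) (g v) \<union> Sep (g v) (g u))"
      using bspec[OF bspec[OF inv H(2)], of "(a, b)"] e ab Sep_app[OF gA(1), of u v a b]
        Sep_app[OF gA(1), of v u a b] V gA by auto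
  qed
qed

text \<open>A forward crossing contributes 1, so a vanishing total requires a backward one.\<close>

lemma flow_zero_reverse:
  assumes D: "\<forall>(a, b)\<in>D. adj a b" and V: "u \<in> V" "v \<in> V" and "flow D u v = 0" "e \<in> D" "e \<in> Sep u v"
  obtains a b where "(a, b) \<in> D" "(a, b) \<in> Sep v u"
proof -
  have "\<exists>e\<in>D. e \<in> Sep v u"
  proof (rule ccontr)
    assume no: "\<not> ?thesis"
    let ?S = "D \<inter> (Sep u v \<union> Sep v u)"
    have one: "ind x v - ind x u = 1" if "x \<in> ?S" for x
      using that no by (auto simp: Sep_def ind_def)
    have "flow D u v = int (card ?S)" unfolding flow_def using one by simp
    moreover have "finite ?S" using finite_Sep V by blast
    moreover have "?S \<noteq> {}" using assms by blast
    ultimately show False using assms(4) by simp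
  qed
  then show thesis using that by fastforce
qed

text \<open>By invariance of \<open>D\<close>, the flow from \<open>v\<close> to \<open>k v\<close>
  is a homomorphism to the integers that vanishes on the stabiliser of \<open>v\<close>. Its
  reductions modulo positive integers have open kernels of finite index, so it must be zero.\<close>

lemma nofi_flow_zero:
  assumes H: "sub H" "nofi H" and D: "\<forall>(a, b)\<in>D. adj a b"
    and inv: "\<forall>k\<in>H. \<forall>(a, b)\<in>D. (k a, k b) \<in> D" and g: "g \<in> H" and v: "v \<in> V"
  shows "flow D v (g v) = 0"
proof -
  define c where "c k = flow D v (k v)" for k
  note HA = sub_auts[OF H(1)]
  have c_add: "c (k \<odot> l) = c k + c l" if "k \<in> H" "l \<in> H" for k l
  proof -
    have "c (k \<odot> l) = flow D v (k v) + flow D (k v) (k (l v))"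
      unfolding c_def using flow_add[OF D, of v "k v" "k (l v)"] that HA v by simp
    then show ?thesis using flow_app[OF D H(1) that(1) inv, of v "l v"] that HA v by (simp add: c_def)
  qed
  have c_one: "c one' = 0" using v by (simp add: c_def flow_self)
  have c_inv: "c (inv' k) = - c k" if "k \<in> H" for k
    using c_add[of k "inv' k"] that H HA c_one by simp
  \<comment> \<open>A modulus larger than the absolute value of \<open>c g\<close>, so that
    divisibility forces \<open>c g = 0\<close>.\<close>
  define m where "m = \<bar>c g\<bar> + 1"
  have m: "m > 0" by (simp add: m_def)
  have "{k \<in> H. m dvd c k} = H"
  proof (rule nofi_eq[OF H, where S = "{v}" and \<Phi> = "\<lambda>k. c k mod m"])
    show "sub {k \<in> H. m dvd c k}"
      by (rule subI) (use H HA c_add c_one c_inv in auto)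
    have "(\<lambda>k. c k mod m) ` H \<subseteq> {0..<m}" using m by auto
    then show "finite ((\<lambda>k. c k mod m) ` H)" using finite_subset by blast
    show "Fix H {v} \<subseteq> {k \<in> H. m dvd c k}" by (auto simp: Fix_def c_def flow_self)
    show "k \<odot> inv' l \<in> {k \<in> H. m dvd c k}" if "k \<in> H" "l \<in> H" "c k mod m = c l mod m" for k l
      using that c_add[of k "inv' l"] c_inv[of l] H by (auto simp: mod_eq_dvd_iff)
  qed (use v in auto)
  then have "m dvd c g" using g by blast
  then have "c g = 0" using zdvd_imp_le[of m "\<bar>c g\<bar>"] by (auto simp: m_def)
  then show ?thesis by (simp add: c_def)
qed

text \<open>Elements preserving the bipartition form an open subgroup of index at most 2.\<close>

lemma nofi_even:
  assumes H: "sub H" "nofi H" and g: "g \<in> H" and v: "v \<in> V"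
  shows "even (d v (g v))"
proof -
  note HA = sub_auts[OF H(1)]
  have add: "even (d v ((k \<odot> l) v)) \<longleftrightarrow> (even (d v (k v)) \<longleftrightarrow> even (d v (l v)))" if "k \<in> H" "l \<in> H" for k l
    using parity_add[of v "k (l v)" "k v"] d_app[of k v "l v"] d_sym[of "k v" v] that HA v by simp
  have inv: "even (d v (inv' k v)) \<longleftrightarrow> even (d v (k v))" if "k \<in> H" for k
    using add[of k "inv' k"] that H HA v by simp
  have "{k \<in> H. even (d v (k v))} = H"
  proof (rule nofi_eq[OF H, where S = "{v}" and \<Phi> = "\<lambda>k. even (d v (k v))"])
    show "sub {k \<in> H. even (d v (k v))}"
      by (rule subI) (use H HA add inv v in \<open>auto simp del: app_mul\<close>)
    show "Fix H {v} \<subseteq> {k \<in> H. even (d v (k v))}" by (auto simp: Fix_def)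
    show "k \<odot> inv' l \<in> {k \<in> H. even (d v (k v))}" if "k \<in> H" "l \<in> H" "even (d v (k v)) = even (d v (l v))" for k l
      using that add[of k "inv' l"] inv[of l] H by auto
  qed (use v in auto)
  then show ?thesis using g by blast
qed

lemma nofi_no_inversion:
  assumes H: "sub H" "nofi H" and g: "g \<in> H" and ab: "adj a b"
  shows "g a \<noteq> b"
  using nofi_even[OF H g, of a] d_adj[OF ab] adjD[OF ab] by auto

text \<open>Otherwise choose \<open>g\<close> outside \<open>N\<close> and \<open>v\<close> with \<open>d v (g v)\<close> minimal. As the flow vanishes, the path
  from \<open>v\<close> to \<open>g v\<close> crosses some translate of its first edge backwards, which yields an element
  outside \<open>N\<close> of smaller displacement.\<close>

lemma nofi_generated_by_stabilizers:
  assumes H: "sub H" "nofi H" and N: "sub N" "\<And>v. v \<in> V \<Longrightarrow> Fix H {v} \<subseteq> N"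
  shows "H \<subseteq> N"
proof (rule ccontr)
  assume "\<not> H \<subseteq> N"
  note HA = sub_auts[OF H(1)]
  define P where "P n \<longleftrightarrow> (\<exists>g v. g \<in> H \<and> g \<notin> N \<and> v \<in> V \<and> d v (g v) = n)" for n
  have "\<exists>n. P n" using \<open>\<not> H \<subseteq> N\<close> V_ne by (auto simp: P_def)
  then have "P (LEAST n. P n)" by (rule LeastI_ex)
  then obtain g v where gv: "g \<in> H" "g \<notin> N" "v \<in> V" "d v (g v) = (LEAST n. P n)"
    by (auto simp: P_def)
  have minimal: "d v (g v) \<le> d w (k w)" if "k \<in> H" "k \<notin> N" "w \<in> V" for k w
    unfolding gv(4) by (rule Least_le) (use that in \<open>auto simp: P_def\<close>)
  have gvV: "g v \<in> V" using gv HA by blast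
  have "g v \<noteq> v" using N(2)[OF gv(3)] gv by (auto simp: Fix_def)
  then obtain n where n: "d v (g v) = Suc n" using d_eq_0 gv gvV by (metis not0_implies_Suc)
  obtain w where w: "adj v w" "d w (g v) = n" using d_step[OF gv(3) gvV n] .
  have wV: "w \<in> V" using w adjD by blast
  have gvh: "g v \<in> h v w" using w n d_sym gvV gv(3) wV by (auto simp: h_def)
  define D where "D = (\<lambda>k. (k v, k w)) ` H"
  have D: "\<forall>(a, b)\<in>D. adj a b" using adj_app'[OF HA w(1)] by (auto simp: D_def)
  have inv: "\<forall>k\<in>H. \<forall>(a, b)\<in>D. (k a, k b) \<in> D"
  proof (clarify)
    fix k a b assume that: "k \<in> H" "(a, b) \<in> D"
    obtain l where l: "l \<in> H" "a = l v" "b = l w" using \<open>(a, b) \<in> D\<close> by (auto simp: D_def)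
    then have "(k a, k b) = ((k \<odot> l) v, (k \<odot> l) w)" using HA that gv wV by simp
    then show "(k a, k b) \<in> D" using l that H by (auto simp: D_def)
  qed
  have "flow D v (g v) = 0" using nofi_flow_zero[OF H D inv gv(1,3)] .
  moreover have "(one' v, one' w) \<in> D" unfolding D_def using H by blast
  then have "(v, w) \<in> D" using gv wV by simp
  moreover have "(v, w) \<in> Sep v (g v)" using w gvh h_fst by (auto simp: Sep_def)
  ultimately obtain a b where ab: "(a, b) \<in> D" "(a, b) \<in> Sep (g v) v"
    using flow_zero_reverse[OF D gv(3) gvV] by blast
  obtain q where q: "q \<in> H" "a = q v" "b = q w" using ab by (auto simp: D_def)
  have qV: "q v \<in> V" "q w \<in> V" using q HA gv wV by auto
  have adjq: "adj (q v) (q w)" "v \<in> h (q v) (q w)" "g v \<notin> h (q v) (q w)"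
    using ab q by (auto simp: Sep_def)
  have dist: "d v (g v) = d v (q w) + 1 + d (q v) (g v)" using d_h_sep[OF adjq(1,2) gvV adjq(3)] .
  show False
  proof (cases "q \<in> N")
    case True
    \<comment> \<open>If \<open>q\<close> lies in \<open>N\<close>, then moving \<open>g v\<close>
      back by \<open>q\<close> gives an element outside \<open>N\<close> that displaces
      \<open>v\<close> only by the distance from \<open>q v\<close> to \<open>g v\<close>.\<close>
    have "inv' q \<odot> g \<notin> N"
    proof
      assume "inv' q \<odot> g \<in> N"
      then have "q \<odot> (inv' q \<odot> g) \<in> N" using True N by blast
      then show False using gv HA q by (simp add: mul_assoc[symmetric])
    qed
    then have "d v (g v) \<le> d v ((inv' q \<odot> g) v)" using minimal gv q H by blast
    also have "\<dots> = d (q v) (g v)"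
      using d_app[of q v "inv' q (g v)"] q gv HA gvV by simp
    finally show False using dist by linarith
  next
    case False
    \<comment> \<open>Otherwise minimality is applied to \<open>q\<close> at \<open>w\<close>. If
      \<open>q w\<close> lies beyond the first edge, then \<open>q w\<close> is too far from
      \<open>v\<close>; if only \<open>q v\<close> does, then \<open>q\<close> inverts that edge; if
      neither does, then \<open>g v\<close> is at least as far from \<open>q v\<close> as from
      \<open>v\<close>, against \<open>dist\<close>.\<close>
    have le: "d v (g v) \<le> d w (q w)" using minimal[OF q(1) False wV] .
    show False
    proof (cases "q w \<in> h v w")
      case True
      have "d (q w) v = d (q w) w + 1 + d v v" using d_h_sep[OF w(1) True gv(3) h_fst[OF w(1)]] .
      then have "d v (q w) = Suc (d w (q w))" using d_sym qV wV gv by simp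
      then show False using le dist by linarith
    next
      case qw: False
      show False
      proof (cases "q v \<in> h v w")
        case True
        then have "q v = w" using h_cross[OF w(1) adjq(1) True qw] by blast
        then show False using nofi_no_inversion[OF H q(1) w(1)] by blast
      next
        case False
        have "d (g v) (q v) = d (g v) w + 1 + d v (q v)" using d_h_sep[OF w(1) gvh qV(1) False] .
        then show False using dist n w d_sym qV wV gv gvV by simp
      qed
    qed
  qed
qed

end

text \<open>In both actions every point has the same stabiliser, common to the two, so
  \<open>F\<close> splits into orbits that are all isomorphic. A maximal equivariant partial
  injection is therefore total: otherwise it could be extended by one more orbit.\<close>

lemma semiregular_conjugate:
  fixes \<alpha> \<beta> :: "'k \<Rightarrow> 'f \<Rightarrow> 'f"
  assumes F: "finite F"
    and K: "\<And>k l. k \<in> K \<Longrightarrow> l \<in> K \<Longrightarrow> m k l \<in> K" "e \<in> K"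
      "\<And>k. k \<in> K \<Longrightarrow> i k \<in> K"
    and \<alpha>: "\<And>k. k \<in> K \<Longrightarrow> \<alpha> k permutes F" "\<And>k l. k \<in> K \<Longrightarrow> l \<in> K \<Longrightarrow> \<alpha> (m k l) = \<alpha> k \<circ> \<alpha> l"
      "\<And>k. k \<in> K \<Longrightarrow> \<alpha> (i k) \<circ> \<alpha> k = id" "\<alpha> e = id"
    and \<beta>: "\<And>k. k \<in> K \<Longrightarrow> \<beta> k permutes F" "\<And>k l. k \<in> K \<Longrightarrow> l \<in> K \<Longrightarrow> \<beta> (m k l) = \<beta> k \<circ> \<beta> l"
      "\<And>k. k \<in> K \<Longrightarrow> \<beta> (i k) \<circ> \<beta> k = id" "\<beta> e = id"
    and semireg: "\<And>k x y. k \<in> K \<Longrightarrow> x \<in> F \<Longrightarrow> y \<in> F \<Longrightarrow> \<alpha> k x = x \<longleftrightarrow> \<beta> k y = y"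
  obtains \<sigma> where "\<sigma> permutes F" "\<And>k. k \<in> K \<Longrightarrow> \<sigma> \<circ> \<alpha> k = \<beta> k \<circ> \<sigma>"
proof -
  define P where "P A s \<longleftrightarrow> A \<subseteq> F \<and> inj_on s A \<and> s ` A \<subseteq> F \<and>
    (\<forall>k\<in>K. \<forall>x\<in>A. \<alpha> k x \<in> A \<and> s (\<alpha> k x) = \<beta> k (s x))" for A s
  have "P {} id" by (simp add: P_def)
  moreover have "\<And>A s. P A s \<Longrightarrow> card A \<le> card F" using F by (auto simp: P_def intro: card_mono)
  ultimately have "\<exists>z. (case z of (A, s) \<Rightarrow> P A s) \<and> (\<forall>w. (case w of (A, s) \<Rightarrow> P A s) \<longrightarrow> card (fst w) \<le> card (fst z))"
    by (intro ex_has_greatest_nat[of _ "({}, id)" _ "Suc (card F)"]) (auto simp: less_Suc_eq_le)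
  then obtain A s where As: "P A s" and max: "\<And>A' s'. P A' s' \<Longrightarrow> card A' \<le> card A" by fastforce
  have A: "A \<subseteq> F" "inj_on s A" "s ` A \<subseteq> F" and eq: "\<And>k x. k \<in> K \<Longrightarrow> x \<in> A \<Longrightarrow> \<alpha> k x \<in> A \<and> s (\<alpha> k x) = \<beta> k (s x)"
    using As by (auto simp: P_def)
  have AF: "A = F"
  proof (rule ccontr)
    assume "A \<noteq> F"
    then obtain x where x: "x \<in> F" "x \<notin> A" using A by blast
    have "A \<subset> F" using A \<open>A \<noteq> F\<close> by blast
    then have "card (s ` A) < card F" using F A by (metis card_image psubset_card_mono)
    then have "s ` A \<noteq> F" by auto
    then obtain y where y: "y \<in> F" "y \<notin> s ` A" using A by blast
    have \<alpha>F: "\<alpha> k z \<in> F" if "k \<in> K" "z \<in> F" for k z using that \<alpha>(1) by (simp add: permutes_in_image)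
    have \<beta>F: "\<beta> k z \<in> F" if "k \<in> K" "z \<in> F" for k z using that \<beta>(1) by (simp add: permutes_in_image)
    have ai: "\<alpha> (i k) (\<alpha> k z) = z" if "k \<in> K" for k z using \<alpha>(3)[OF that] by (simp add: fun_eq_iff)
    have bi: "\<beta> (i k) (\<beta> k z) = z" if "k \<in> K" for k z using \<beta>(3)[OF that] by (simp add: fun_eq_iff)
    define A' where "A' = (\<lambda>k. \<alpha> k x) ` K"
    have fresh: "\<alpha> k x \<notin> A" if "k \<in> K" for k
    proof
      assume "\<alpha> k x \<in> A"
      then have "\<alpha> (i k) (\<alpha> k x) \<in> A" using eq K that by blast
      then show False using ai that x by simp
    qed
    have fresh': "\<beta> k y \<notin> s ` A" if "k \<in> K" for k
    proof
      assume "\<beta> k y \<in> s ` A"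
      then obtain z where z: "z \<in> A" "\<beta> k y = s z" by blast
      then have "y = s (\<alpha> (i k) z)" using eq[OF K(3)[OF that] z(1)] bi[OF that, of y] by simp
      then show False using y eq[OF K(3)[OF that] z(1)] by blast
    qed
    \<comment> \<open>Equality of stabilisers makes the map from the orbit of \<open>x\<close> to
      the orbit of \<open>y\<close> both well defined and injective.\<close>
    have same: "\<alpha> k x = \<alpha> l x \<longleftrightarrow> \<beta> k y = \<beta> l y" if kl: "k \<in> K" "l \<in> K" for k l
    proof -
      have "\<alpha> k x = \<alpha> l x \<longleftrightarrow> \<alpha> (m (i l) k) x = x"
        using \<alpha>(2)[OF K(3)[OF kl(2)] kl(1)] ai[OF kl(2)] permutes_inj[OF \<alpha>(1)[OF K(3)[OF kl(2)]]]
        by (simp add: inj_def) (metis ai kl(2))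
      also have "\<dots> \<longleftrightarrow> \<beta> (m (i l) k) y = y"
        using semireg K kl x y by blast
      also have "\<dots> \<longleftrightarrow> \<beta> k y = \<beta> l y"
        using \<beta>(2)[OF K(3)[OF kl(2)] kl(1)] bi[OF kl(2)] permutes_inj[OF \<beta>(1)[OF K(3)[OF kl(2)]]]
        by (simp add: inj_def) (metis bi kl(2))
      finally show ?thesis .
    qed
    define s' where "s' z = (if z \<in> A then s z else \<beta> (SOME k. k \<in> K \<and> \<alpha> k x = z) y)" for z
    have s'1: "s' z = s z" if "z \<in> A" for z using that by (simp add: s'_def)
    have s'2: "s' (\<alpha> k x) = \<beta> k y" if "k \<in> K" for k
    proof -
      have "\<exists>l. l \<in> K \<and> \<alpha> l x = \<alpha> k x" using that by blast
      from someI_ex[OF this] have "\<beta> (SOME l. l \<in> K \<and> \<alpha> l x = \<alpha> k x) y = \<beta> k y"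
        using same that by blast
      then show ?thesis using fresh[OF that] by (simp add: s'_def)
    qed
    have "P (A \<union> A') s'" unfolding P_def
    proof (intro conjI ballI)
      show "A \<union> A' \<subseteq> F" using A x \<alpha>F by (auto simp: A'_def)
      have "inj_on s' A" using A(2) s'1 by (simp add: inj_on_def)
      moreover have "inj_on s' A'" using s'2 same by (auto simp: inj_on_def A'_def)
      moreover have "s' ` A \<inter> s' ` A' = {}" using s'1 s'2 fresh' by (auto simp: A'_def) (metis imageI)
      ultimately show "inj_on s' (A \<union> A')" unfolding inj_on_Un by blast
      show "s' ` (A \<union> A') \<subseteq> F" using s'1 s'2 A(3) \<beta>F y by (auto simp: A'_def)
      fix k z assume k: "k \<in> K" and z: "z \<in> A \<union> A'"
      have "\<alpha> k z \<in> A \<union> A' \<and> s' (\<alpha> k z) = \<beta> k (s' z)"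
      proof (cases "z \<in> A")
        case True then show ?thesis using eq[OF k True] s'1 by simp
      next
        case False
        then obtain l where l: "l \<in> K" "z = \<alpha> l x" using z by (auto simp: A'_def)
        have "\<alpha> k z = \<alpha> (m k l) x" "\<beta> k (s' z) = \<beta> (m k l) y" using \<alpha>(2) \<beta>(2) k l s'2 by auto
        then show ?thesis using s'2[OF K(1)[OF k l(1)]] K(1)[OF k l(1)] by (auto simp: A'_def)
      qed
      then show "\<alpha> k z \<in> A \<union> A'" "s' (\<alpha> k z) = \<beta> k (s' z)" by auto
    qed
    then have "card (A \<union> A') \<le> card A" by (rule max)
    moreover have "finite (A \<union> A')" using F \<open>P (A \<union> A') s'\<close> finite_subset by (auto simp: P_def)
    ultimately have "A \<union> A' = A" by (metis Un_upper1 card_seteq)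
    moreover have "\<alpha> e x \<in> A'" using K by (auto simp: A'_def)
    ultimately show False using fresh[OF K(2)] by blast
  qed
  define \<sigma> where "\<sigma> x = (if x \<in> F then s x else x)" for x
  have "bij_betw s F F" using A AF F by (metis bij_betw_def endo_inj_surj)
  then have "bij_betw \<sigma> F F" by (rule bij_betw_cong[THEN iffD1, rotated]) (simp add: \<sigma>_def)
  then have \<sigma>: "\<sigma> permutes F" by (rule bij_imp_permutes) (simp add: \<sigma>_def)
  moreover have "\<sigma> \<circ> \<alpha> k = \<beta> k \<circ> \<sigma>" if k: "k \<in> K" for k
  proof
    fix x show "(\<sigma> \<circ> \<alpha> k) x = (\<beta> k \<circ> \<sigma>) x"
    proof (cases "x \<in> F")
      case True
      then show ?thesis using eq[OF k, of x] AF by (simp add: \<sigma>_def)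
    next
      case False
      then show ?thesis using permutes_not_in[OF \<alpha>(1)[OF k] False] permutes_not_in[OF \<beta>(1)[OF k] False]
        by (simp add: \<sigma>_def)
    qed
  qed
  ultimately show thesis using that by blast
qed

context leafless_tree
begin

section \<open>Representations from cocycles with equivariant parallel transport\<close>

text \<open>Since the tree is simply connected, the parallel transport \<open>p\<close> along edges trivialises the
  bundle with fibre \<open>F\<close> over the vertices, and the action \<open>c\<close> becomes an action on one fibre.\<close>

lemma cocycle_representation:
  fixes c :: "('v \<Rightarrow> 'v) \<Rightarrow> 'v \<Rightarrow> 'f \<Rightarrow> 'f"
  assumes H: "sub H" and v0: "v0 \<in> V"
    and c: "\<And>g v. g \<in> H \<Longrightarrow> v \<in> V \<Longrightarrow> c g v permutes F"
      "\<And>g k v. g \<in> H \<Longrightarrow> k \<in> H \<Longrightarrow> v \<in> V \<Longrightarrow> c (g \<odot> k) v = c g (k v) \<circ> c k v"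
    and p: "\<And>v w. adj v w \<Longrightarrow> p v w permutes F" "\<And>v w. adj v w \<Longrightarrow> p w v \<circ> p v w = id"
      "\<And>g v w. g \<in> H \<Longrightarrow> adj v w \<Longrightarrow> p (g v) (g w) \<circ> c g v = c g w \<circ> p v w"
  obtains \<gamma> \<Phi> where "\<gamma> v0 = id" "\<And>v w. adj v w \<Longrightarrow> \<gamma> w = p v w \<circ> \<gamma> v"
    "\<And>v. v \<in> V \<Longrightarrow> \<gamma> v permutes F" "\<And>g. g \<in> H \<Longrightarrow> \<Phi> g permutes F"
    "\<And>g k. g \<in> H \<Longrightarrow> k \<in> H \<Longrightarrow> \<Phi> (g \<odot> k) = \<Phi> g \<circ> \<Phi> k"
    "\<And>g v. g \<in> H \<Longrightarrow> v \<in> V \<Longrightarrow> \<gamma> (g v) \<circ> \<Phi> g = c g v \<circ> \<gamma> v"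
proof -
  note HA = sub_auts[OF H]
  define par where "par w = (SOME u. adj w u \<and> d u v0 < d w v0)" for w
  have par: "adj w (par w) \<and> d (par w) v0 < d w v0" if wV: "w \<in> V" and w0: "w \<noteq> v0" for w
  proof -
    obtain n where n: "d w v0 = Suc n" using d_eq_0[OF wV v0] w0 not0_implies_Suc by blast
    obtain u where "adj w u" "d u v0 = n" using d_step[OF wV v0 n] .
    then have "\<exists>u. adj w u \<and> d u v0 < d w v0" using n by auto
    from someI_ex[OF this] show ?thesis by (simp add: par_def)
  qed
  have par_eq: "par w = u" if "adj w u" "d u v0 < d w v0" for u w
  proof -
    have "w \<in> V" "w \<noteq> v0" using that adjD[OF that(1)] by auto
    then show ?thesis using par parent_unique[of w "par w" u v0] that v0 by blast
  qed
  \<comment> \<open>\<open>\<gamma> w\<close> composes the transports along the path from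
    \<open>v0\<close> to \<open>w\<close>, by recursion on the distance to \<open>v0\<close> through
    the parent of \<open>w\<close>.\<close>
  define R where "R = rec_nat (\<lambda>w. id) (\<lambda>n r w. p (par w) w \<circ> r (par w))"
  define \<gamma> where "\<gamma> w = R (d w v0) w" for w
  have \<gamma>0: "\<gamma> v0 = id" by (simp add: \<gamma>_def R_def)
  have down: "\<gamma> w = p u w \<circ> \<gamma> u" if "adj w u" "d u v0 < d w v0" for u w
  proof -
    have "d w v0 \<le> Suc (d u v0)" using d_adj_le[OF that(1) v0] .
    then have "d w v0 = Suc (d u v0)" using that by simp
    then show ?thesis using par_eq[OF that] by (simp add: \<gamma>_def R_def)
  qed
  have step: "\<gamma> w = p v w \<circ> \<gamma> v" if "adj v w" for v w
  proof (cases "d v v0 < d w v0")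
    case True
    then show ?thesis using down[OF adj_sym[OF that]] by blast
  next
    case False
    moreover have "d w v0 \<noteq> d v v0"
      using d_neq[OF that v0] d_sym[OF v0] adjD[OF that] by simp
    ultimately have "\<gamma> v = p w v \<circ> \<gamma> w" using down[OF that] by simp
    then have "p v w \<circ> \<gamma> v = (p v w \<circ> p w v) \<circ> \<gamma> w" by (simp add: comp_assoc)
    then show ?thesis using p(2)[OF adj_sym[OF that]] by simp
  qed
  have \<gamma>F: "\<gamma> v permutes F" if "v \<in> V" for v
    using that
  proof (induction "d v v0" arbitrary: v)
    case 0
    have "v = v0" using d_eq_0[OF 0(2) v0] 0(1) by simp
    then show ?case using \<gamma>0 permutes_id by metis
  next
    case (Suc n)
    obtain w where w: "adj v w" "d w v0 = n" using d_step[OF Suc.prems v0] Suc.hyps(2) by metis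
    have "\<gamma> w permutes F" using Suc.hyps(1)[of w] w adjD[OF w(1)] by simp
    then show ?case using step[OF adj_sym[OF w(1)]] p(1)[OF adj_sym[OF w(1)]] permutes_compose by metis
  qed
  have gv: "g v \<in> V" if "g \<in> H" "v \<in> V" for g v using HA that by blast
  define T where "T g v = inv_into UNIV (\<gamma> (g v)) \<circ> c g v \<circ> \<gamma> v" for g v
  have T: "\<gamma> (g v) \<circ> T g v = c g v \<circ> \<gamma> v" if "g \<in> H" "v \<in> V" for g v
    using permutes_inv_o(1)[OF \<gamma>F[OF gv[OF that]]] by (simp add: T_def o_assoc)
  have T_eq: "T g v = q" if "g \<in> H" "v \<in> V" "\<gamma> (g v) \<circ> q = c g v \<circ> \<gamma> v" for g v q
  proof -
    have "T g v = inv_into UNIV (\<gamma> (g v)) \<circ> (\<gamma> (g v) \<circ> q)" unfolding that(3) by (simp add: T_def o_assoc)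
    then show ?thesis using permutes_inv_o(2)[OF \<gamma>F[OF gv[OF that(1,2)]]] by (simp add: o_assoc)
  qed
  \<comment> \<open>\<open>T g v\<close> is the action of \<open>g\<close> from the fibre at
    \<open>v\<close> to that at \<open>g v\<close>, read in the fibre at \<open>v0\<close>.
    Equivariance of \<open>p\<close> makes it independent of \<open>v\<close> along edges, hence
    constant by connectedness.\<close>
  have T_adj: "T g w = T g v" if g: "g \<in> H" and vw: "adj v w" for g v w
  proof (rule T_eq[OF g])
    show "w \<in> V" using adjD[OF vw] by simp
    have v: "v \<in> V" using adjD[OF vw] by simp
    have "\<gamma> (g w) \<circ> T g v = p (g v) (g w) \<circ> (\<gamma> (g v) \<circ> T g v)"
      using step[OF adj_app'[OF HA[OF g] vw]] by (simp add: o_assoc)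
    also have "\<dots> = (p (g v) (g w) \<circ> c g v) \<circ> \<gamma> v" using T[OF g v] by (simp add: o_assoc)
    also have "\<dots> = c g w \<circ> (p v w \<circ> \<gamma> v)" using p(3)[OF g vw] by (simp add: o_assoc)
    also have "\<dots> = c g w \<circ> \<gamma> w" using step[OF vw] by simp
    finally show "\<gamma> (g w) \<circ> T g v = c g w \<circ> \<gamma> w" .
  qed
  have T_const: "T g v = T g v0" if g: "g \<in> H" and v: "v \<in> V" for g v
    using v
  proof (induction "d v v0" arbitrary: v)
    case 0
    have "v = v0" using d_eq_0[OF 0(2) v0] 0(1) by simp
    then show ?case by simp
  next
    case (Suc n)
    obtain w where w: "adj v w" "d w v0 = n" using d_step[OF Suc.prems v0] Suc.hyps(2) by metis
    have "T g w = T g v0" using Suc.hyps(1)[of w] w adjD[OF w(1)] by simp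
    then show ?case using T_adj[OF g w(1)] by simp
  qed
  define \<Phi> where "\<Phi> g = T g v0" for g
  have \<Phi>: "\<gamma> (g v) \<circ> \<Phi> g = c g v \<circ> \<gamma> v" if "g \<in> H" "v \<in> V" for g v
    using T[OF that] T_const[OF that] by (simp add: \<Phi>_def)
  have "\<Phi> g permutes F" if "g \<in> H" for g
    unfolding \<Phi>_def T_def using that v0 \<gamma>F gv c(1) by (intro permutes_compose permutes_inv) auto
  moreover have "\<Phi> (g \<odot> k) = \<Phi> g \<circ> \<Phi> k" if g: "g \<in> H" and k: "k \<in> H" for g k
  proof -
    have "\<gamma> ((g \<odot> k) v0) \<circ> (\<Phi> g \<circ> \<Phi> k) = (\<gamma> (g (k v0)) \<circ> \<Phi> g) \<circ> \<Phi> k"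
      using g k HA v0 by (simp add: o_assoc)
    also have "\<dots> = c g (k v0) \<circ> (\<gamma> (k v0) \<circ> \<Phi> k)" using \<Phi>[OF g gv[OF k v0]] by (simp add: o_assoc)
    also have "\<dots> = c (g \<odot> k) v0 \<circ> \<gamma> v0" using \<Phi>[OF k v0] c(2)[OF g k v0] by (simp add: o_assoc)
    finally show ?thesis using T_eq[of "g \<odot> k" v0 "\<Phi> g \<circ> \<Phi> k"] g k H v0 by (simp add: \<Phi>_def)
  qed
  ultimately show thesis using that[of \<gamma> \<Phi>] \<gamma>0 step \<gamma>F \<Phi> by blast
qed

end

lemma finite_image_factor:
  assumes "finite (\<Phi> ` A)" "\<And>a b. a \<in> A \<Longrightarrow> b \<in> A \<Longrightarrow> \<Phi> a = \<Phi> b \<Longrightarrow> f a = f b"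
  shows "finite (f ` A)"
proof -
  have "f ` A \<subseteq> (\<lambda>p. f (SOME a. a \<in> A \<and> \<Phi> a = p)) ` \<Phi> ` A"
  proof
    fix y assume "y \<in> f ` A"
    then obtain a where a: "a \<in> A" "y = f a" by blast
    then have "\<exists>b. b \<in> A \<and> \<Phi> b = \<Phi> a" by blast
    from someI_ex[OF this] have "f (SOME b. b \<in> A \<and> \<Phi> b = \<Phi> a) = f a" using assms(2) a by blast
    then show "y \<in> (\<lambda>p. f (SOME a. a \<in> A \<and> \<Phi> a = p)) ` \<Phi> ` A" using a by force
  qed
  then show ?thesis using assms(1) finite_subset by blast
qed

lemma permutes_cancel_right:
  assumes "q permutes F" "f \<circ> q = f' \<circ> q" shows "f = f'"
proof -
  have "f \<circ> (q \<circ> inv_into UNIV q) = f' \<circ> (q \<circ> inv_into UNIV q)" using assms(2) by (simp add: o_assoc)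
  then show ?thesis using permutes_inv_o(1)[OF assms(1)] by simp
qed

context leafless_tree
begin

lemma mul_inv_cancel:
  assumes "x \<in> auts V E" "y \<in> auts V E"
  shows "x \<odot> (inv' x \<odot> y) = y" "inv' x \<odot> (x \<odot> y) = y"
  using assms by (simp_all add: mul_assoc[symmetric])

text \<open>The fibre \<open>F\<close> is the product of the finite coset spaces \<open>H\<^sub>x/(H\<^sub>x \<inter> N)\<close> over representatives \<open>x\<close> of
  the orbits of vertices, so that every vertex stabiliser acts on \<open>F\<close>, semiregularly modulo \<open>N\<close>. The
  stabiliser of an edge then acts in two ways on \<open>F\<close>, which are conjugate; the conjugating
  permutations provide the parallel transport. Edges are oriented by the parity of the distance of
  their endpoints to \<open>v0\<close>, which \<open>H\<close> preserves.\<close>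

lemma stabilizers_le_open_normal:
  assumes H: "sub H" "nofi H" and fin: "finite (orb H ` V)"
    and N: "sub N" "N \<subseteq> H" "\<And>g n. g \<in> H \<Longrightarrow> n \<in> N \<Longrightarrow> g \<odot> n \<odot> inv' g \<in> N"
    and S: "finite S" "S \<subseteq> V" "Fix H S \<subseteq> N" and v0: "v0 \<in> V"
  shows "Fix H {v0} \<subseteq> N"
proof -
  note HA = sub_auts[OF H(1)]
  have HV: "k u \<in> V" if "k \<in> H" "u \<in> V" for k u using HA that by blast
  note NA = sub_auts[OF N(1)]
  \<comment> \<open>Chosen from the orbit as a set, so that \<open>r\<close> is constant on
    orbits.\<close>
  define r where "r u = (SOME x. x \<in> orb H u)" for u
  have r: "r u \<in> orb H u" if "u \<in> V" for u
    unfolding r_def by (rule someI[of "\<lambda>x. x \<in> orb H u"]) (rule orb_self[OF H(1) that])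
  have r_app: "r (g u) = r u" if "g \<in> H" "u \<in> V" for g u
    using orb_app[OF H(1) that(2,1)] by (simp add: r_def)
  have rV: "r u \<in> V" if "u \<in> V" for u using r[OF that] orb_sub[OF H(1) that] by blast
  have "r ` V = (\<lambda>A. SOME x. x \<in> A) ` orb H ` V" by (simp add: r_def image_image)
  then have finr: "finite (r ` V)" using fin by simp
  have "\<forall>u. u \<in> V \<longrightarrow> (\<exists>k. k \<in> H \<and> k (r u) = u)"
  proof (intro allI impI)
    fix u assume u: "u \<in> V"
    obtain k where k: "k \<in> H" "r u = k u" using r[OF u] by (auto simp: orb_def)
    then have "inv' k \<in> H \<and> inv' k (r u) = u" using HA u H by simp
    then show "\<exists>k. k \<in> H \<and> k (r u) = u" by blast
  qed
  then obtain a where a: "\<And>u. u \<in> V \<Longrightarrow> a u \<in> H \<and> a u (r u) = u" by metis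
  define lc where "lc g A = (\<lambda>n. g \<odot> n) ` A" for g A
  have lc_lc: "lc g (lc k N) = lc (g \<odot> k) N" if "g \<in> H" "k \<in> H" for g k
    using that HA NA by (simp add: lc_def image_image mul_assoc cong: image_cong)
  have lc_eq: "lc g N = lc k N \<longleftrightarrow> inv' k \<odot> g \<in> N" if gk: "g \<in> H" "k \<in> H" for g k
  proof
    assume "lc g N = lc k N"
    moreover have "g \<odot> one' \<in> lc g N" using N by (auto simp: lc_def)
    ultimately obtain n where "n \<in> N" "g = k \<odot> n" using gk HA by (auto simp: lc_def)
    then show "inv' k \<odot> g \<in> N" using gk HA NA by (simp add: mul_assoc[symmetric])
  next
    assume n: "inv' k \<odot> g \<in> N"
    let ?n = "inv' k \<odot> g"
    have "lc (k \<odot> ?n) N = lc k N"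
    proof -
      have "lc ?n N = N"
      proof
        show "lc ?n N \<subseteq> N" using n N by (auto simp: lc_def)
        show "N \<subseteq> lc ?n N"
        proof
          fix x assume x: "x \<in> N"
          have "x = ?n \<odot> (inv' ?n \<odot> x)" using x n NA by (simp add: mul_assoc[symmetric])
          then show "x \<in> lc ?n N" unfolding lc_def using x n N by blast
        qed
      qed
      moreover have "?n \<in> H" using n N by blast
      ultimately show ?thesis using lc_lc[OF gk(2), of ?n] by simp
    qed
    then show "lc g N = lc k N" using gk HA by (simp add: mul_assoc[symmetric])
  qed
  have conj_iff: "inv' k \<odot> g \<odot> k \<in> N \<longleftrightarrow> g \<in> N" if gk: "g \<in> H" "k \<in> H" for g k
  proof
    assume "inv' k \<odot> g \<odot> k \<in> N"
    then have "k \<odot> (inv' k \<odot> g \<odot> k) \<odot> inv' k \<in> N" using N gk by blast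
    then show "g \<in> N" using gk HA by (simp add: mul_assoc) (simp add: mul_assoc[symmetric])
  next
    assume "g \<in> N"
    then have "inv' k \<odot> g \<odot> inv' (inv' k) \<in> N" using N(3)[of "inv' k" g] gk H by blast
    then show "inv' k \<odot> g \<odot> k \<in> N" using gk HA by simp
  qed
  \<comment> \<open>By normality every coset of \<open>N\<close> has stabiliser \<open>N\<close>;
    this is the source of semiregularity modulo \<open>N\<close>.\<close>
  have lc_fix: "lc g (lc k N) = lc k N \<longleftrightarrow> g \<in> N" if "g \<in> H" "k \<in> H" for g k
    using lc_lc[OF that] lc_eq[of "g \<odot> k" k] that H HA conj_iff[OF that] by (simp add: mul_assoc)
  define C where "C x = (\<lambda>g. lc g N) ` Fix H {x}" for x
  have finC: "finite (C x)" if x: "x \<in> V" for x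
  proof -
    \<comment> \<open>Since \<open>N\<close> contains \<open>Fix H S\<close>, the coset of an
      element fixing \<open>x\<close> is determined by its action on a ball around \<open>x\<close>
      that contains \<open>S\<close>, and that finite ball is preserved.\<close>
    obtain m where m: "S \<subseteq> B x m" using finite_in_B[OF x S(1,2)] .
    have im: "restrict g (B x m) \<in> B x m \<rightarrow>\<^sub>E B x m" if g: "g \<in> Fix H {x}" for g
    proof -
      have "g \<in> auts V E" "g x = x" using g HA by (auto simp: Fix_def)
      then have "g ` B x m = B x m" using image_B[of g x m] x by simp
      then show ?thesis by auto
    qed
    have "(\<lambda>g. restrict g (B x m)) ` Fix H {x} \<subseteq> B x m \<rightarrow>\<^sub>E B x m" using im by blast
    then have "finite ((\<lambda>g. restrict g (B x m)) ` Fix H {x})"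
      using finite_B[OF x] finite_PiE[of "B x m" "\<lambda>_. B x m"] finite_subset by blast
    then show ?thesis unfolding C_def
    proof (rule finite_image_factor)
      fix g k assume gk: "g \<in> Fix H {x}" "k \<in> Fix H {x}" and e: "restrict g (B x m) = restrict k (B x m)"
      have gkH: "g \<in> H" "k \<in> H" using gk by (auto simp: Fix_def)
      have "g s = k s" if "s \<in> S" for s using e m that by (metis restrict_apply' subsetD)
      then have "inv' k \<odot> g \<in> Fix H S" using gkH HA H S by (auto simp: Fix_def subset_iff)
      then show "lc g N = lc k N" using lc_eq[OF gkH] S by blast
    qed
  qed
  define F where "F = Pi\<^sub>E (r ` V) C"
  have finF: "finite F" unfolding F_def using finC rV finr by (intro finite_PiE) auto
  have oneC: "lc one' N \<in> C x" if "x \<in> V" for x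
    using that H by (auto simp: C_def Fix_def)
  define f0 where "f0 = (\<lambda>x\<in>r ` V. lc one' N)"
  have f0: "f0 \<in> F" unfolding F_def f0_def using oneC rV by auto
  \<comment> \<open>The stabiliser of \<open>x\<close> moves only the coordinate at
    \<open>x\<close>, yet one of its elements fixes a point of \<open>F\<close> iff it lies in
    \<open>N\<close>. Taking the product over all orbits provides one set for all vertices.\<close>
  define \<rho> where "\<rho> x g f = (if f \<in> F then f(x := lc g (f x)) else f)" for x g f
  have lcC: "lc g A \<in> C x" if "g \<in> Fix H {x}" and A: "A \<in> C x" and "x \<in> V" for g A x
  proof -
    obtain k where k: "k \<in> Fix H {x}" "A = lc k N" using A by (auto simp: C_def)
    have "g \<odot> k \<in> Fix H {x}" using sub_mul[OF sub_Fix[OF H(1)]] that k by simp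
    moreover have "lc g A = lc (g \<odot> k) N" using lc_lc k that by (auto simp: Fix_def)
    ultimately show ?thesis by (auto simp: C_def)
  qed
  have \<rho>F: "\<rho> x g f \<in> F" if "f \<in> F" "x \<in> r ` V" "g \<in> Fix H {x}" for x g f
  proof -
    have "x \<in> V" using that rV by auto
    moreover have "f x \<in> C x" using that by (auto simp: F_def)
    ultimately have "lc g (f x) \<in> C x" using lcC that by blast
    then show ?thesis using that unfolding \<rho>_def F_def by (auto simp: PiE_iff extensional_def)
  qed
  have \<rho>_mul: "\<rho> x (g \<odot> k) = \<rho> x g \<circ> \<rho> x k" if x: "x \<in> r ` V" and gk: "g \<in> Fix H {x}" "k \<in> Fix H {x}" for x g k
  proof
    fix f show "\<rho> x (g \<odot> k) f = (\<rho> x g \<circ> \<rho> x k) f"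
    proof (cases "f \<in> F")
      case True
      then have "f x \<in> C x" using x by (auto simp: F_def)
      then obtain l where l: "l \<in> H" "f x = lc l N" by (auto simp: C_def Fix_def)
      have H': "g \<in> H" "k \<in> H" using gk by (auto simp: Fix_def)
      have "lc (g \<odot> k) (f x) = lc g (lc k (f x))"
        using lc_lc H' l H HA by (simp add: mul_assoc)
      then show ?thesis using True \<rho>F[OF True x gk(2)] by (simp add: \<rho>_def)
    qed (simp add: \<rho>_def)
  qed
  have \<rho>_fix: "\<rho> x g f = f \<longleftrightarrow> g \<in> N" if x: "x \<in> r ` V" and g: "g \<in> Fix H {x}" and f: "f \<in> F" for x g f
  proof -
    have "f x \<in> C x" using x f by (auto simp: F_def)
    then obtain l where l: "l \<in> H" "f x = lc l N" by (auto simp: C_def Fix_def)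
    have "g \<in> H" using g by (auto simp: Fix_def)
    then have "lc g (f x) = f x \<longleftrightarrow> g \<in> N" using lc_fix l by simp
    moreover have "f(x := lc g (f x)) = f \<longleftrightarrow> lc g (f x) = f x" by (metis fun_upd_idem_iff)
    ultimately show ?thesis using f by (simp add: \<rho>_def)
  qed
  have \<rho>_N: "\<rho> x g = id" if "x \<in> r ` V" "g \<in> Fix H {x}" "g \<in> N" for x g
  proof
    fix f show "\<rho> x g f = id f" using \<rho>_fix[OF that(1,2)] that(3) by (cases "f \<in> F") (auto simp: \<rho>_def)
  qed
  have \<rho>_perm: "\<rho> x g permutes F" if x: "x \<in> r ` V" and g: "g \<in> Fix H {x}" for x g
  proof (rule inverse_permutes)
    have xV: "x \<in> V" using x rV by auto
    have g': "inv' g \<in> Fix H {x}" using sub_inv[OF sub_Fix[OF H(1)] g] xV by simp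
    have gA: "g \<in> auts V E" using g HA by (auto simp: Fix_def)
    have "one' \<in> Fix H {x}" using H xV by (auto simp: Fix_def)
    then have "\<rho> x one' = id" using \<rho>_N[OF x] N by blast
    then show "\<rho> x g \<circ> \<rho> x (inv' g) = id" "\<rho> x (inv' g) \<circ> \<rho> x g = id"
      using \<rho>_mul[OF x g g'] \<rho>_mul[OF x g' g] gA by auto
  qed (simp add: \<rho>_def)
  \<comment> \<open>The usual cocycle of an induced action: from \<open>r v\<close> to
    \<open>v\<close>, on to \<open>g v\<close>, and back to \<open>r v\<close>.\<close>
  define s where "s g v = inv' (a (g v)) \<odot> g \<odot> a v" for g v
  have s: "s g v \<in> Fix H {r v}" if gv: "g \<in> H" "v \<in> V" for g v
  proof -
    have *: "a v \<in> H" "a v (r v) = v" "a (g v) \<in> H" "a (g v) (r v) = g v"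
      using a[OF gv(2)] a[OF HV[OF gv]] r_app[OF gv] by auto
    have "s g v (r v) = inv' (a (g v)) (g v)" using * gv HA rV by (simp add: s_def)
    also have "\<dots> = r v" using app_inv(1)[OF HA[OF *(3)] rV[OF gv(2)]] * by simp
    finally show ?thesis using * gv H by (auto simp: Fix_def s_def)
  qed
  define c where "c g v = \<rho> (r v) (s g v)" for g v
  have c_perm: "c g v permutes F" if "g \<in> H" "v \<in> V" for g v
    unfolding c_def using \<rho>_perm s that by blast
  have c_mul: "c (g \<odot> k) v = c g (k v) \<circ> c k v" if gk: "g \<in> H" "k \<in> H" and v: "v \<in> V" for g k v
  proof -
    have kv: "k v \<in> V" using HV gk v by blast
    have aA: "a u \<in> auts V E" if "u \<in> V" for u using a[OF that] HA by blast
    have gkv: "g (k v) \<in> V" using HV gk kv by blast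
    have "s (g \<odot> k) v = s g (k v) \<odot> s k v"
    proof -
      have "s g (k v) \<odot> s k v = inv' (a (g (k v))) \<odot> (g \<odot> ((a (k v) \<odot> inv' (a (k v))) \<odot> (k \<odot> a v)))"
        using aA[OF v] aA[OF kv] aA[OF gkv] HA[OF gk(1)] HA[OF gk(2)] by (simp add: s_def mul_assoc mul_inv_cancel)
      also have "\<dots> = s (g \<odot> k) v"
        using aA[OF v] aA[OF kv] aA[OF gkv] HA[OF gk(1)] HA[OF gk(2)] v by (simp add: s_def mul_assoc)
      finally show ?thesis by simp
    qed
    moreover have "s g (k v) \<in> Fix H {r v}" using s[OF gk(1) kv] r_app[OF gk(2) v] by simp
    ultimately show ?thesis
      using \<rho>_mul[of "r v" "s g (k v)" "s k v"] s[OF gk(2) v] v r_app[OF gk(2) v] by (simp add: c_def)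
  qed
  have s_N: "s g v \<in> N \<longleftrightarrow> g \<in> N" if g: "g \<in> H" "v \<in> V" "g v = v" for g v
    using conj_iff[OF g(1), of "a v"] a[OF g(2)] g by (simp add: s_def)
  have c_fix: "c g v f = f \<longleftrightarrow> g \<in> N" if "g \<in> H" "v \<in> V" "g v = v" "f \<in> F" for g v f
    using \<rho>_fix[of "r v" "s g v" f] s[OF that(1,2)] s_N[OF that(1-3)] that by (simp add: c_def)
  have c_id: "c g v = id" if "g \<in> N" "v \<in> V" "g v = v" for g v
    using \<rho>_N[of "r v" "s g v"] s[of g v] s_N[of g v] that N by (auto simp: c_def)
  have c_one: "c one' v = id" if "v \<in> V" for v using c_id N that by auto
  have c_inv: "c (inv' g) v \<circ> c g v = id" if g: "g \<in> H" "v \<in> V" "g v = v" for g v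
    using c_mul[of "inv' g" g v] g H HA c_one by simp

  \<comment> \<open>Transport along an edge and along its reverse must be mutually inverse. It is
    chosen from even to odd vertices and inverted for the other direction, which is consistent
    because \<open>H\<close> preserves parity.\<close>
  define t where "t u = even (d v0 u)" for u
  have t_app: "t (g u) = t u" if "g \<in> H" "u \<in> V" for g u
    using nofi_even[OF H that] parity_add[OF that(2) HV[OF that] v0] by (auto simp: t_def)
  have t_adj: "t u \<longleftrightarrow> \<not> t w" if "adj u w" for u w using parity[OF that v0] by (simp add: t_def)
  define eo where "eo x y = (\<lambda>k. (k x, k y)) ` H" for x y
  have eo_app: "eo (g x) (g y) = eo x y" if g: "g \<in> H" "x \<in> V" "y \<in> V" for g x y
  proof
    show "eo (g x) (g y) \<subseteq> eo x y"
    proof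
      fix z assume "z \<in> eo (g x) (g y)"
      then obtain k where k: "k \<in> H" "z = (k (g x), k (g y))" by (auto simp: eo_def)
      then have "z = ((k \<odot> g) x, (k \<odot> g) y)" using g HA by simp
      then show "z \<in> eo x y" unfolding eo_def using k g H by blast
    qed
    show "eo x y \<subseteq> eo (g x) (g y)"
    proof
      fix z assume "z \<in> eo x y"
      then obtain k where k: "k \<in> H" "z = (k x, k y)" by (auto simp: eo_def)
      then have "z = ((k \<odot> inv' g) (g x), (k \<odot> inv' g) (g y))" using g HA by simp
      then show "z \<in> eo (g x) (g y)" unfolding eo_def using k g H by blast
    qed
  qed
  define r2 where "r2 x y = (SOME e. e \<in> eo x y)" for x y
  have r2_app: "r2 (g x) (g y) = r2 x y" if "g \<in> H" "x \<in> V" "y \<in> V" for g x y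
    using eo_app[OF that] by (simp add: r2_def)
  have "\<forall>x y. adj x y \<longrightarrow> (\<exists>k. k \<in> H \<and> adj (fst (r2 x y)) (snd (r2 x y)) \<and> k (fst (r2 x y)) = x \<and> k (snd (r2 x y)) = y)"
  proof (intro allI impI)
    fix x y assume xy: "adj x y"
    have "eo x y \<noteq> {}" using H by (auto simp: eo_def)
    then have "r2 x y \<in> eo x y" unfolding r2_def by (rule some_in_eq[THEN iffD2])
    then obtain k where k: "k \<in> H" "r2 x y = (k x, k y)" by (auto simp: eo_def)
    have "inv' k \<in> H \<and> adj (k x) (k y) \<and> inv' k (k x) = x \<and> inv' k (k y) = y"
      using k HA H xy adjD[OF xy] adj_app'[OF HA[OF k(1)] xy] by simp
    then show "\<exists>k. k \<in> H \<and> adj (fst (r2 x y)) (snd (r2 x y)) \<and> k (fst (r2 x y)) = x \<and> k (snd (r2 x y)) = y"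
      using k by auto
  qed
  then obtain b where b: "\<And>x y. adj x y \<Longrightarrow> b x y \<in> H \<and> adj (fst (r2 x y)) (snd (r2 x y)) \<and>
      b x y (fst (r2 x y)) = x \<and> b x y (snd (r2 x y)) = y" by metis
  have "\<forall>x y. adj x y \<longrightarrow> (\<exists>\<sigma>. \<sigma> permutes F \<and> (\<forall>g\<in>Fix H {x, y}. \<sigma> \<circ> c g x = c g y \<circ> \<sigma>))"
  proof (intro allI impI)
    fix x y assume xy: "adj x y"
    have xyV: "x \<in> V" "y \<in> V" using adjD[OF xy] by auto
    have K: "sub (Fix H {x, y})" using sub_Fix[OF H(1)] xyV by simp
    have KD: "g \<in> H" "g x = x" "g y = y" if "g \<in> Fix H {x, y}" for g using that by (auto simp: Fix_def)
    obtain \<sigma> where "\<sigma> permutes F" "\<And>g. g \<in> Fix H {x, y} \<Longrightarrow> \<sigma> \<circ> c g x = c g y \<circ> \<sigma>"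
    proof (rule semiregular_conjugate[OF finF, of "Fix H {x, y}" "(\<odot>)" one' "inv'" "\<lambda>g. c g x" "\<lambda>g. c g y"])
      fix g k assume g: "g \<in> Fix H {x, y}" and k: "k \<in> Fix H {x, y}"
      show "g \<odot> k \<in> Fix H {x, y}" using K g k by blast
      show "c (g \<odot> k) x = c g x \<circ> c k x" "c (g \<odot> k) y = c g y \<circ> c k y"
        using c_mul KD[OF g] KD[OF k] xyV by auto
    next
      fix g assume g: "g \<in> Fix H {x, y}"
      show "inv' g \<in> Fix H {x, y}" using K g by blast
      show "c g x permutes F" "c g y permutes F" using c_perm KD[OF g] xyV by auto
      show "c (inv' g) x \<circ> c g x = id" "c (inv' g) y \<circ> c g y = id" using c_inv KD[OF g] xyV by auto
    next
      show "one' \<in> Fix H {x, y}" using K by blast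
      show "c one' x = id" "c one' y = id" using c_one xyV by auto
    next
      fix g f f' assume "g \<in> Fix H {x, y}" "f \<in> F" "f' \<in> F"
      then show "c g x f = f \<longleftrightarrow> c g y f' = f'" using c_fix[of g x f] c_fix[of g y f'] KD[of g] xyV by simp
    qed (use that in blast)
    then show "\<exists>\<sigma>. \<sigma> permutes F \<and> (\<forall>g\<in>Fix H {x, y}. \<sigma> \<circ> c g x = c g y \<circ> \<sigma>)" by blast
  qed
  then obtain \<sigma> where \<sigma>: "\<And>x y. adj x y \<Longrightarrow> \<sigma> x y permutes F"
    "\<And>x y g. adj x y \<Longrightarrow> g \<in> Fix H {x, y} \<Longrightarrow> \<sigma> x y \<circ> c g x = c g y \<circ> \<sigma> x y" by metis
  define P where "P x y = c (b x y) (snd (r2 x y)) \<circ> \<sigma> (fst (r2 x y)) (snd (r2 x y)) \<circ>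
    inv_into UNIV (c (b x y) (fst (r2 x y)))" for x y
  have P_perm: "P x y permutes F" if "adj x y" for x y
    unfolding P_def using b[OF that] \<sigma>(1) c_perm adjD
    by (intro permutes_compose permutes_inv) blast+
  have P_app: "P (g x) (g y) \<circ> c g x = c g y \<circ> P x y" if g: "g \<in> H" and xy: "adj x y" for g x y
  proof -
    obtain x1 y1 where r2: "r2 x y = (x1, y1)" by fastforce
    have xyV: "x \<in> V" "y \<in> V" using adjD[OF xy] by auto
    have gxy: "adj (g x) (g y)" using adj_app'[OF HA[OF g] xy] .
    have r2': "r2 (g x) (g y) = (x1, y1)" using r2_app[OF g xyV] r2 by simp
    let ?b = "b x y" and ?b' = "b (g x) (g y)"
    have b1: "?b \<in> H" "adj x1 y1" "?b x1 = x" "?b y1 = y" using b[OF xy] r2 by auto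
    have b2: "?b' \<in> H" "?b' x1 = g x" "?b' y1 = g y" using b[OF gxy] r2' by auto
    have V1: "x1 \<in> V" "y1 \<in> V" using adjD[OF b1(2)] by auto
    \<comment> \<open>The two ways from the representative edge to the translated one, by
      \<open>?b'\<close> and by \<open>g \<odot> ?b\<close>, differ by an element of the stabiliser
      of the representative edge. As \<open>\<sigma>\<close> intertwines its two actions,
      \<open>P\<close> is equivariant.\<close>
    let ?s = "inv' ?b' \<odot> (g \<odot> ?b)"
    have bs: "?b' \<odot> ?s = g \<odot> ?b" using b1 b2 g HA by (simp add: mul_assoc[symmetric])
    have sH: "?s \<in> H" using b1 b2 g H by simp
    have sx: "?s x1 = x1" "?s y1 = y1"
      using b1 b2 g HA V1 xyV app_inv(1)[of ?b' x1] app_inv(1)[of ?b' y1] by auto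
    then have sF: "?s \<in> Fix H {x1, y1}" using sH by (auto simp: Fix_def)
    have e1: "P x y \<circ> c ?b x1 = c ?b y1 \<circ> \<sigma> x1 y1"
      using permutes_inv_o(2)[OF c_perm[OF b1(1) V1(1)]] by (simp add: P_def r2 comp_assoc)
    have e2: "P (g x) (g y) \<circ> c ?b' x1 = c ?b' y1 \<circ> \<sigma> x1 y1"
      using permutes_inv_o(2)[OF c_perm[OF b2(1) V1(1)]] by (simp add: P_def r2' comp_assoc)
    have e3: "c g x \<circ> c ?b x1 = c ?b' x1 \<circ> c ?s x1"
      using c_mul[OF g b1(1) V1(1)] c_mul[OF b2(1) sH V1(1)] bs b1 sx by simp
    have e4: "c g y \<circ> c ?b y1 = c ?b' y1 \<circ> c ?s y1"
      using c_mul[OF g b1(1) V1(2)] c_mul[OF b2(1) sH V1(2)] bs b1 sx by simp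
    have "(P (g x) (g y) \<circ> c g x) \<circ> c ?b x1 = (P (g x) (g y) \<circ> c ?b' x1) \<circ> c ?s x1"
      using e3 by (simp add: comp_assoc)
    also have "\<dots> = c ?b' y1 \<circ> (\<sigma> x1 y1 \<circ> c ?s x1)" using e2 by (simp add: comp_assoc)
    also have "\<dots> = (c ?b' y1 \<circ> c ?s y1) \<circ> \<sigma> x1 y1" using \<sigma>(2)[OF b1(2) sF] by (simp add: comp_assoc)
    also have "\<dots> = c g y \<circ> (P x y \<circ> c ?b x1)" unfolding e4[symmetric] e1 by (simp only: comp_assoc)
    finally have "(P (g x) (g y) \<circ> c g x) \<circ> c ?b x1 = (c g y \<circ> P x y) \<circ> c ?b x1"
      by (simp add: comp_assoc)
    then show ?thesis by (rule permutes_cancel_right[OF c_perm[OF b1(1) V1(1)]])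
  qed
  define p where "p x y = (if t x then P x y else inv_into UNIV (P y x))" for x y
  obtain \<gamma> \<Phi> where \<gamma>: "\<gamma> v0 = id" "\<And>v. v \<in> V \<Longrightarrow> \<gamma> v permutes F"
    and \<Phi>: "\<And>g. g \<in> H \<Longrightarrow> \<Phi> g permutes F" "\<And>g k. g \<in> H \<Longrightarrow> k \<in> H \<Longrightarrow> \<Phi> (g \<odot> k) = \<Phi> g \<circ> \<Phi> k"
    "\<And>g v. g \<in> H \<Longrightarrow> v \<in> V \<Longrightarrow> \<gamma> (g v) \<circ> \<Phi> g = c g v \<circ> \<gamma> v"
  proof (rule cocycle_representation[OF H(1) v0, of c F p])
    show "c g v permutes F" if "g \<in> H" "v \<in> V" for g v by (rule c_perm[OF that])
    show "c (g \<odot> k) v = c g (k v) \<circ> c k v" if "g \<in> H" "k \<in> H" "v \<in> V" for g k v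
      by (rule c_mul[OF that])
  next
    fix x y assume xy: "adj x y"
    show "p x y permutes F" using P_perm[OF xy] permutes_inv[OF P_perm[OF adj_sym[OF xy]]] by (simp add: p_def)
    show "p y x \<circ> p x y = id"
      using t_adj[OF xy] permutes_inv_o[OF P_perm[OF xy]] permutes_inv_o[OF P_perm[OF adj_sym[OF xy]]]
      by (auto simp: p_def)
    fix g assume g: "g \<in> H"
    have tg: "t (g x) = t x" using t_app g adjD[OF xy] by blast
    show "p (g x) (g y) \<circ> c g x = c g y \<circ> p x y"
    proof (cases "t x")
      case True
      then show ?thesis using tg P_app[OF g xy] by (simp add: p_def)
    next
      case False
      let ?P = "P y x" and ?P' = "P (g y) (g x)"
      have q: "?P' \<circ> c g y = c g x \<circ> ?P" using P_app[OF g adj_sym[OF xy]] .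
      have pp: "?P permutes F" "?P' permutes F"
        using P_perm adj_sym[OF xy] adj_app'[OF HA[OF g] adj_sym[OF xy]] by auto
      have "(inv_into UNIV ?P' \<circ> c g x) \<circ> ?P = inv_into UNIV ?P' \<circ> (?P' \<circ> c g y)" using q by (simp add: comp_assoc)
      also have "\<dots> = c g y" using permutes_inv_o(2)[OF pp(2)] by (simp add: o_assoc)
      also have "\<dots> = (c g y \<circ> inv_into UNIV ?P) \<circ> ?P" using permutes_inv_o(2)[OF pp(1)] by (simp add: comp_assoc)
      finally have "inv_into UNIV ?P' \<circ> c g x = c g y \<circ> inv_into UNIV ?P" by (rule permutes_cancel_right[OF pp(1)])
      then show ?thesis using False tg by (simp add: p_def)
    qed
  qed (rule that; assumption)
  \<comment> \<open>For elements fixing \<open>v0\<close>, \<open>\<Phi>\<close> is \<open>c\<close>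
    at \<open>v0\<close> because \<open>\<gamma> v0 = id\<close>; it is then trivial exactly on
    elements of \<open>N\<close>.\<close>
  have q: "finite_quotient H F \<Phi> (insert v0 S)"
    unfolding finite_quotient_def
  proof (intro conjI ballI)
    fix g assume g: "g \<in> Fix H (insert v0 S)"
    then have *: "g \<in> H" "g v0 = v0" "g \<in> N" using S by (auto simp: Fix_def)
    show "\<Phi> g = id" using \<Phi>(3)[OF *(1) v0] c_id[OF *(3) v0 *(2)] *(2) \<gamma>(1) by simp
  qed (use finF \<Phi> S v0 in auto)
  show ?thesis
  proof
    fix g assume "g \<in> Fix H {v0}"
    then have g: "g \<in> H" "g v0 = v0" by (auto simp: Fix_def)
    have "\<Phi> g = id" using nofi_quotient_trivial[OF H q g(1)] .
    then have "c g v0 = id" using \<Phi>(3)[OF g(1) v0] g(2) \<gamma>(1) by simp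
    then show "g \<in> N" using c_fix[OF g(1) v0 g(2) f0] by simp
  qed
qed

text \<open>A group without proper open subgroups of finite index has no nontrivial discrete quotient.\<close>

lemma nofi_open_normal:
  assumes H: "sub H" "nofi H" and fin: "finite (orb H ` V)"
    and N: "sub N" "N \<subseteq> H" "\<And>g n. g \<in> H \<Longrightarrow> n \<in> N \<Longrightarrow> g \<odot> n \<odot> inv' g \<in> N"
    and S: "finite S" "S \<subseteq> V" "Fix H S \<subseteq> N"
  shows "N = H"
  using nofi_generated_by_stabilizers[OF H N(1) stabilizers_le_open_normal[OF H fin N S]] N(2) by blast

section \<open>Chabauty neighbourhoods\<close>

text \<open>The finite data seen by a basic Chabauty neighbourhood: the compact set consists of the
  elements that move \<open>v\<close> by at most \<open>D\<close>, and the identity neighbourhood is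
  the pointwise stabiliser of \<open>B v r\<close>.\<close>

definition germs :: "'v \<Rightarrow> nat \<Rightarrow> nat \<Rightarrow> ('v \<Rightarrow> 'v) set \<Rightarrow> ('v \<Rightarrow> 'v) set" where
  "germs v r D H = (\<lambda>g. restrict g (B v r)) ` {g \<in> H. d v (g v) \<le> D}"

lemma germs_agree:
  assumes "germs v r D J \<subseteq> germs v r D H" "j \<in> J" "d v (j v) \<le> D"
  obtains k where "k \<in> H" "\<And>x. x \<in> B v r \<Longrightarrow> k x = j x"
proof -
  have "restrict j (B v r) \<in> germs v r D J" using assms by (auto simp: germs_def)
  then have "restrict j (B v r) \<in> germs v r D H" using assms(1) by blast
  then obtain k where k: "k \<in> H" "restrict j (B v r) = restrict k (B v r)" by (auto simp: germs_def)
  have "k x = j x" if "x \<in> B v r" for x using k(2) that by (metis restrict_apply')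
  then show thesis using that k by blast
qed

lemma openin_Fix_B: "v \<in> V \<Longrightarrow> openin X (Fix (auts V E) (B v r))"
  unfolding openin_aut Fix_def using finite_B[of v r] B_sub[of v r] by auto

lemma openin_germs:
  assumes v: "v \<in> V"
  shows "openin (chabauty (Aut V E) X) {J \<in> closed_subgroups (Aut V E) X. germs v r D J = G}"
  unfolding openin_chabauty
proof (intro conjI ballI)
  fix J assume J: "J \<in> {J \<in> closed_subgroups (Aut V E) X. germs v r D J = G}"
  let ?K = "{g \<in> auts V E. d v (g v) \<le> D}" and ?U = "Fix (auts V E) (B v r)"
  have le: "germs v r D J1 \<subseteq> germs v r D J2"
    if "sub J1" and J2: "sub J2" and JJ: "J1 \<inter> ?K \<subseteq> J2 <#>\<^bsub>Aut V E\<^esub> ?U" for J1 J2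
  proof
    fix f assume "f \<in> germs v r D J1"
    then obtain j where j: "j \<in> J1" "d v (j v) \<le> D" "f = restrict j (B v r)" by (auto simp: germs_def)
    then have "j \<in> J1 \<inter> ?K" using sub_auts that by blast
    then have "j \<in> J2 <#>\<^bsub>Aut V E\<^esub> ?U" using JJ by (rule rev_subsetD)
    then obtain k u where k: "k \<in> J2" "u \<in> ?U" "j = k \<odot> u" by (auto simp: set_mult_def)
    have kA: "k \<in> auts V E" using k J2 sub_auts by blast
    have eq: "j x = k x" if "x \<in> B v r" for x
    proof -
      have "u x = x" "x \<in> V" "u \<in> auts V E" using k(2) that B_sub by (auto simp: Fix_def)
      then show ?thesis using k kA by simp
    qed
    have "d v (k v) \<le> D" using eq[OF B_self[OF v]] j by simp
    moreover have "f = restrict k (B v r)" using j eq by auto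
    ultimately show "f \<in> germs v r D J2" using k by (auto simp: germs_def)
  qed
  have "chabauty_nbhd (Aut V E) X ?K ?U J \<subseteq> {J \<in> closed_subgroups (Aut V E) X. germs v r D J = G}"
  proof
    fix J' assume J': "J' \<in> chabauty_nbhd (Aut V E) X ?K ?U J"
    have subs: "sub J" "sub J'" using J J' by (auto simp: closed_subgroups_def chabauty_nbhd_def)
    have "germs v r D J = germs v r D J'"
      using le[OF subs(1,2)] le[OF subs(2,1)] J' by (auto simp: chabauty_nbhd_def)
    then show "J' \<in> {J \<in> closed_subgroups (Aut V E) X. germs v r D J = G}"
      using J J' by (auto simp: chabauty_nbhd_def)
  qed
  moreover have "one' \<in> ?U" using B_sub[of v r] by (auto simp: Fix_def subset_iff)
  ultimately show "\<exists>K U. compactin X K \<and> openin X U \<and> one' \<in> U \<and>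
      chabauty_nbhd (Aut V E) X K U J \<subseteq> {J \<in> closed_subgroups (Aut V E) X. germs v r D J = G}"
    using compactin_displacement[OF v] openin_Fix_B[OF v] by blast
qed auto

text \<open>If \<open>H\<close> had too many orbits, finitely many representatives inside one ball
  would already show it, and a nearby \<open>J\<close> cannot merge two of them without
  \<open>H\<close> merging them too.\<close>

lemma few_orbits_of_germs:
  assumes H: "sub H" and v: "v \<in> V"
    and approx: "\<And>r D. \<exists>J. sub J \<and> germs v r D J = germs v r D H \<and>
      finite (orb J ` V) \<and> real (card (orb J ` V)) \<le> C"
  shows "finite (orb H ` V) \<and> real (card (orb H ` V)) \<le> C"
proof (rule ccontr)
  assume neg: "\<not> ?thesis"
  obtain Q where Q: "Q \<subseteq> orb H ` V" "finite Q" "real (card Q) > C"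
  proof (cases "finite (orb H ` V)")
    case True
    then show ?thesis using neg that[of "orb H ` V"] by simp
  next
    case False
    obtain n :: nat where n: "real n > C" using reals_Archimedean2 by blast
    obtain Q where "finite Q" "card Q = n" "Q \<subseteq> orb H ` V" using infinite_arbitrarily_large[OF False, of n] by blast
    then show ?thesis using that[of Q] n by simp
  qed
  have "\<forall>q\<in>Q. \<exists>w. w \<in> V \<and> orb H w = q" using Q(1) by auto
  then obtain w where w: "\<And>q. q \<in> Q \<Longrightarrow> w q \<in> V \<and> orb H (w q) = q" by metis
  obtain R where R: "w ` Q \<subseteq> B v R" using finite_in_B[OF v, of "w ` Q"] Q(2) w by blast
  \<comment> \<open>An element carrying one vertex of \<open>B v R\<close> to another moves
    \<open>v\<close> by at most \<open>2 * R\<close>.\<close>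
  obtain J where J: "sub J" "germs v R (2 * R) J = germs v R (2 * R) H"
    "finite (orb J ` V)" "real (card (orb J ` V)) \<le> C" using approx by blast
  have "inj_on (\<lambda>q. orb J (w q)) Q"
  proof (rule inj_onI)
    fix q q' assume q: "q \<in> Q" "q' \<in> Q" "orb J (w q) = orb J (w q')"
    have wV: "w q \<in> V" "w q' \<in> V" using w q by auto
    have wB: "w q \<in> B v R" "w q' \<in> B v R" using R q by auto
    obtain j where j: "j \<in> J" "j (w q) = w q'" using orb_eq_iff[OF J(1) wV] q(3) by blast
    have jA: "j \<in> auts V E" using sub_auts J j by blast
    have "d v (j v) \<le> d v (w q') + d (j (w q)) (j v)" using d_triangle[of v "w q'" "j v"] j wV v jA by simp
    also have "\<dots> \<le> 2 * R" using wB jA wV v d_sym[of "w q" v] by (simp add: B_def)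
    finally obtain k where k: "k \<in> H" "\<And>x. x \<in> B v R \<Longrightarrow> k x = j x"
      using germs_agree[OF eq_refl[OF J(2)] j(1)] by blast
    then have "k (w q) = w q'" using j wB by simp
    then have "orb H (w q) = orb H (w q')" using orb_eq_iff[OF H wV] k by blast
    then show "q = q'" using w q by simp
  qed
  moreover have "(\<lambda>q. orb J (w q)) ` Q \<subseteq> orb J ` V" using w by blast
  ultimately have "card Q \<le> card (orb J ` V)" using card_inj_on_le J(3) by blast
  then show False using Q J by linarith
qed

text \<open>A finite quotient of \<open>H\<close> restricts to a partial homomorphism on the elements of small
  displacement of any nearby group \<open>J\<close>. The latter extends to all of \<open>J\<close>, which permutes cocompactly
  the vertices of a tree.\<close>

lemma not_nofi_of_germs:
  assumes H: "sub H" "\<not> nofi H" and v0: "v0 \<in> V"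
  obtains r D where "\<And>J. sub J \<Longrightarrow> finite (orb J ` V) \<Longrightarrow> card (orb J ` V) \<le> n \<Longrightarrow>
    germs v0 r D J = germs v0 r D H \<Longrightarrow> \<not> nofi J"
proof -
  obtain F :: "('v \<Rightarrow> 'v) set set" and \<pi> S h0 where q: "finite_quotient H F \<pi> S" "h0 \<in> H" "\<pi> h0 \<noteq> id"
    using not_nofi_quotient[OF H] .
  note HA = sub_auts[OF H(1)]
  have S: "finite S" "S \<subseteq> V" using q by (auto simp: finite_quotient_def)
  obtain s where s: "S \<subseteq> B v0 s" using finite_in_B[OF v0 S] .
  define D0 where "D0 = d v0 (h0 v0)"
  \<comment> \<open>Covers three kinds of elements: those carrying a vertex within
    \<open>n + 1\<close> of \<open>v0\<close> to another such vertex, which move \<open>v0\<close>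
    by at most \<open>2 * n + 2\<close>; \<open>h0\<close>, which moves it by \<open>D0\<close>; and
    the inverses of \<open>a u\<close> for \<open>u\<close> within \<open>D0\<close> of
    \<open>v0\<close>, which move it by at most \<open>n + D0\<close>.\<close>
  define M where "M = 2 * n + 2 + D0"
  \<comment> \<open>An element moving \<open>v0\<close> by at most \<open>M\<close> maps the ball of
    radius \<open>s\<close> into this larger ball, so germs of two factors determine their product
    on the ball of radius \<open>s\<close>, which contains \<open>S\<close>.\<close>
  define r where "r = s + M"
  have Bsr: "B v0 s \<subseteq> B v0 r" using B_mono by (simp add: r_def)
  have "\<not> nofi J" if J: "sub J" "finite (orb J ` V)" "card (orb J ` V) \<le> n"
    and g: "germs v0 r M J = germs v0 r M H" for J
  proof
    assume nofi: "nofi J"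
    have JA: "k \<in> auts V E" if "k \<in> J" for k using sub_auts J that by blast
    define \<Sigma> where "\<Sigma> = {j \<in> J. d v0 (j v0) \<le> M}"
    have \<Sigma>A: "k \<in> auts V E" if "k \<in> \<Sigma>" for k using JA that by (auto simp: \<Sigma>_def)
    define \<eta> where "\<eta> j = (SOME k. k \<in> H \<and> (\<forall>x\<in>B v0 r. k x = j x))" for j
    define \<phi> where "\<phi> j = \<pi> (\<eta> j)" for j
    have \<eta>: "\<eta> j \<in> H \<and> (\<forall>x\<in>B v0 r. \<eta> j x = j x)" if "j \<in> \<Sigma>" for j
    proof -
      have j: "j \<in> J" "d v0 (j v0) \<le> M" using that by (auto simp: \<Sigma>_def)
      obtain k where "k \<in> H" "\<And>x. x \<in> B v0 r \<Longrightarrow> k x = j x"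
        using germs_agree[OF eq_refl[OF g] j] by blast
      then have "\<exists>k. k \<in> H \<and> (\<forall>x\<in>B v0 r. k x = j x)" by blast
      from someI_ex[OF this] show ?thesis by (simp add: \<eta>_def)
    qed
    have \<phi>_eq: "\<phi> j = \<pi> k" if j: "j \<in> \<Sigma>" and k: "k \<in> H" "\<And>x. x \<in> B v0 s \<Longrightarrow> k x = j x" for j k
    proof -
      have e: "\<eta> j \<in> H" using \<eta>[OF j] by blast
      have "(inv' k \<odot> \<eta> j) x = x" if "x \<in> S" for x
      proof -
        have "\<eta> j x = k x" using \<eta>[OF j] k(2) that s Bsr by (simp add: subset_iff)
        then show ?thesis using e k(1) HA that S by (simp add: subset_iff)
      qed
      then have "inv' k \<odot> \<eta> j \<in> Fix H S" using e k H by (auto simp: Fix_def)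
      then have 1: "\<pi> (inv' k \<odot> \<eta> j) = id" using q by (auto simp: finite_quotient_def)
      have "\<pi> (k \<odot> (inv' k \<odot> \<eta> j)) = \<pi> k \<circ> \<pi> (inv' k \<odot> \<eta> j)"
        using q(1) k(1) e H by (auto simp: finite_quotient_def)
      then show ?thesis using 1 e k(1) HA by (simp add: \<phi>_def mul_inv_cancel)
    qed
    have \<phi>_mul: "\<phi> (j \<odot> j') = \<phi> j \<circ> \<phi> j'" if j: "j \<in> \<Sigma>" "j' \<in> \<Sigma>" "j \<odot> j' \<in> \<Sigma>" for j j'
    proof -
      have e: "\<eta> j \<in> H" "\<eta> j' \<in> H" using \<eta> j by auto
      have "\<phi> (j \<odot> j') = \<pi> (\<eta> j \<odot> \<eta> j')"
      proof (rule \<phi>_eq[OF j(3)])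
        fix x assume x: "x \<in> B v0 s"
        have xV: "x \<in> V" using x B_sub by blast
        have A: "j \<in> auts V E" "j' \<in> auts V E" "\<eta> j \<in> auts V E" "\<eta> j' \<in> auts V E" using \<Sigma>A j e HA by auto
        have 1: "\<eta> j' x = j' x" using \<eta>[OF j(2)] x Bsr by blast
        have "d v0 (j' x) \<le> d v0 (j' v0) + d (j' v0) (j' x)" using d_triangle[of v0 "j' v0" "j' x"] A v0 xV by simp
        also have "\<dots> \<le> r" using x j(2) A v0 xV by (simp add: \<Sigma>_def B_def r_def)
        finally have "j' x \<in> B v0 r" using A xV by (simp add: B_def)
        then show "(\<eta> j \<odot> \<eta> j') x = (j \<odot> j') x" using 1 \<eta>[OF j(1)] A xV by simp
      qed (use e H in auto)
      then show ?thesis using q(1) e by (auto simp: finite_quotient_def \<phi>_def)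
    qed
    have \<phi>_perm: "\<phi> j permutes F" if "j \<in> \<Sigma>" for j
      using \<eta>[OF that] q(1) by (simp add: finite_quotient_def \<phi>_def)
    have one\<Sigma>: "one' \<in> \<Sigma>" using J v0 by (auto simp: \<Sigma>_def)
    have \<phi>_one: "\<phi> one' = id"
      using \<phi>_eq[OF one\<Sigma>, of one'] finite_quotient_one[OF H(1) q(1)] H by auto
    have "\<forall>u. \<exists>k. u \<in> V \<longrightarrow> k \<in> J \<and> d v0 (inv' k u) \<le> n"
    proof (intro allI)
      fix u show "\<exists>k. u \<in> V \<longrightarrow> k \<in> J \<and> d v0 (inv' k u) \<le> n"
      proof (cases "u \<in> V")
        case True
        obtain k where k: "k \<in> J" "k u \<in> B v0 n" using orbits_meet_ball[OF J v0 True] .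
        then have "inv' k \<in> J \<and> d v0 (inv' (inv' k) u) \<le> n" using J JA by (auto simp: B_def)
        then show ?thesis by blast
      qed auto
    qed
    then obtain a' where a': "\<And>u. u \<in> V \<Longrightarrow> a' u \<in> J \<and> d v0 (inv' (a' u) u) \<le> n" by metis
    \<comment> \<open>Normalised at \<open>v0\<close>, so that \<open>c\<close> at \<open>v0\<close>
      and the initial value of \<open>\<gamma>\<close> involve no correction.\<close>
    define a where "a u = (if u = v0 then one' else a' u)" for u
    have inv_one: "inv' one' = one'" by (rule A.inv_one)
    have a: "a u \<in> J \<and> d v0 (inv' (a u) u) \<le> n" if "u \<in> V" for u
      using a'[OF that] J v0 inv_one by (auto simp: a_def)
    have aA: "a u \<in> auts V E" if "u \<in> V" for u using a[OF that] JA by blast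
    have JV: "k u \<in> V" if "k \<in> J" "u \<in> V" for k u using JA that by blast
    have in\<Sigma>: "k \<in> \<Sigma>" if k: "k \<in> J" and x: "x \<in> V" "d v0 x \<le> n + 1" "d v0 (k x) \<le> n + 1" for k x
    proof -
      have "d v0 (k v0) \<le> d v0 (k x) + d (k x) (k v0)" using d_triangle[of v0 "k x" "k v0"] JV[OF k] x v0 by simp
      also have "\<dots> \<le> M" using x JA[OF k] v0 d_sym[of x v0] by (simp add: M_def)
      finally show ?thesis using k by (simp add: \<Sigma>_def)
    qed
    define e where "e g u w = inv' (a w) \<odot> (g \<odot> a u)" for g u w
    have eJ: "e g u w \<in> J" if "g \<in> J" "u \<in> V" "w \<in> V" for g u w
      using a that J by (simp add: e_def)
    text \<open>\<open>e g u w\<close> maps a vertex near \<open>v0\<close> to a vertex near \<open>v0\<close> as soon as \<open>g u\<close> and \<open>w\<close>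
      are equal or adjacent.\<close>
    have e\<Sigma>: "e g u w \<in> \<Sigma>" if g: "g \<in> J" and u: "u \<in> V" and w: "w \<in> V" and gu: "d (g u) w \<le> 1" for g u w
    proof (rule in\<Sigma>[OF eJ[OF g u w]])
      have xV: "inv' (a u) u \<in> V" using aA[OF u] u by simp
      show "inv' (a u) u \<in> V" "d v0 (inv' (a u) u) \<le> n + 1" using xV a[OF u] by auto
      have guV: "g u \<in> V" using JV g u by blast
      have "e g u w (inv' (a u) u) = inv' (a w) (g u)"
        using aA[OF u] aA[OF w] JA[OF g] u xV by (simp add: e_def)
      moreover have "d v0 (inv' (a w) (g u)) \<le> d v0 (inv' (a w) w) + d (inv' (a w) w) (inv' (a w) (g u))"
        using d_triangle[of v0 "inv' (a w) w" "inv' (a w) (g u)"] v0 aA[OF w] w guV by simp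
      moreover have "d (inv' (a w) w) (inv' (a w) (g u)) = d (g u) w"
        using aA[OF w] w guV d_sym[of w "g u"] by simp
      ultimately show "d v0 (e g u w (inv' (a u) u)) \<le> n + 1" using a[OF w] gu by simp
    qed
    have e_mul: "e g w x \<odot> e k u w = e (g \<odot> k) u x" if "g \<in> J" "k \<in> J" "u \<in> V" "w \<in> V" "x \<in> V" for g k u w x
      using aA[OF that(3)] aA[OF that(4)] aA[OF that(5)] JA[OF that(1)] JA[OF that(2)]
      by (simp add: e_def mul_assoc mul_inv_cancel)
    \<comment> \<open>Action and transport are values of the partial homomorphism on elements of
      small displacement; \<open>e_mul\<close> and \<open>\<phi>_mul\<close> give all required
      identities.\<close>
    define c where "c g u = \<phi> (e g u (g u))" for g u
    define p where "p u w = \<phi> (e one' u w)" for u w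
    obtain \<gamma> \<Phi> where \<gamma>: "\<gamma> v0 = id" "\<And>v w. adj v w \<Longrightarrow> \<gamma> w = p v w \<circ> \<gamma> v" "\<And>v. v \<in> V \<Longrightarrow> \<gamma> v permutes F"
      and \<Phi>: "\<And>g. g \<in> J \<Longrightarrow> \<Phi> g permutes F" "\<And>g k. g \<in> J \<Longrightarrow> k \<in> J \<Longrightarrow> \<Phi> (g \<odot> k) = \<Phi> g \<circ> \<Phi> k"
      "\<And>g v. g \<in> J \<Longrightarrow> v \<in> V \<Longrightarrow> \<gamma> (g v) \<circ> \<Phi> g = c g v \<circ> \<gamma> v"
    proof (rule cocycle_representation[OF J(1) v0, of c F p])
      fix g u assume g: "g \<in> J" "u \<in> V"
      show "c g u permutes F" unfolding c_def using \<phi>_perm e\<Sigma> g JV by simp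
      fix k assume k: "k \<in> J"
      note V = g(2) JV[OF k g(2)] JV[OF g(1) JV[OF k g(2)]]
      have gk: "(g \<odot> k) u = g (k u)" using g k JA by simp
      show "c (g \<odot> k) u = c g (k u) \<circ> c k u" unfolding c_def gk
        using \<phi>_mul[of "e g (k u) (g (k u))" "e k u (k u)"] e\<Sigma> e_mul[OF g(1) k V] g k V gk J by simp
    next
      fix u w assume uw: "adj u w"
      note V = adjD[OF uw]
      have one: "one' \<in> J" using J by blast
      have d1: "d u w \<le> 1" "d w u \<le> 1" using d_adj[OF uw] d_adj[OF adj_sym[OF uw]] by auto
      have puw: "e one' u w \<in> \<Sigma>" "e one' w u \<in> \<Sigma>" using e\<Sigma>[OF one] V d1 by auto
      show "p u w permutes F" using \<phi>_perm puw by (simp add: p_def)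
      have "e one' w u \<odot> e one' u w = e (one' \<odot> one') u u" by (rule e_mul[OF one one]) (use V in auto)
      also have "\<dots> = one'" using aA[OF V(1)] by (simp add: e_def)
      finally show "p w u \<circ> p u w = id"
        using \<phi>_mul[OF puw(2,1)] one\<Sigma> \<phi>_one by (simp add: p_def)
      fix g assume g: "g \<in> J"
      have gV: "g u \<in> V" "g w \<in> V" using JV g V by auto
      have gd: "d (g u) (g w) \<le> 1" using d1 JA g V by simp
      have m: "e one' (g u) (g w) \<odot> e g u (g u) = e g u (g w)" "e g w (g w) \<odot> e one' u w = e g u (g w)"
        using e_mul[OF one g V(1) gV] e_mul[OF g one V(1,2) gV(2)] JA[OF g] by auto
      have i: "e one' (g u) (g w) \<in> \<Sigma>" "e g u (g u) \<in> \<Sigma>" "e g w (g w) \<in> \<Sigma>" "e g u (g w) \<in> \<Sigma>"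
        using e\<Sigma>[OF one gV] e\<Sigma>[OF g V(1)] e\<Sigma>[OF g V(2)] gV gd by auto
      show "p (g u) (g w) \<circ> c g u = c g w \<circ> p u w"
        using \<phi>_mul[OF i(1,2)] \<phi>_mul[OF i(3) puw(1)] m i(4) by (simp add: p_def c_def)
    qed (rule that; assumption)
    have ainv\<Sigma>: "inv' (a u) \<in> \<Sigma>" if u: "u \<in> V" "d v0 u \<le> D0" for u
    proof -
      have "d v0 (inv' (a u) v0) \<le> d v0 (inv' (a u) u) + d (inv' (a u) u) (inv' (a u) v0)"
        using d_triangle[of v0 "inv' (a u) u" "inv' (a u) v0"] aA[OF u(1)] u v0 by simp
      also have "d (inv' (a u) u) (inv' (a u) v0) = d v0 u" using aA[OF u(1)] u v0 d_sym[of u v0] by simp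
      finally show ?thesis using a[OF u(1)] u J by (simp add: \<Sigma>_def M_def)
    qed
    \<comment> \<open>Near \<open>v0\<close> the transport is computed by \<open>\<phi>\<close>
      itself. This is what allows \<open>\<Phi>\<close> and \<open>\<phi>\<close> to be compared on
      an element with the germ of \<open>h0\<close>.\<close>
    have \<gamma>_near: "\<gamma> u = \<phi> (inv' (a u))" if u: "u \<in> V" "d u v0 \<le> D0" for u
      using u
    proof (induction "d u v0" arbitrary: u)
      case 0
      have "u = v0" using d_eq_0[OF 0(2) v0] 0(1) by simp
      then show ?case using \<gamma>(1) \<phi>_one inv_one by (simp add: a_def)
    next
      case (Suc m)
      obtain w where w: "adj u w" "d w v0 = m" using d_step[OF Suc.prems(1) v0] Suc.hyps(2) by metis
      note V = adjD[OF w(1)]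
      have IH: "\<gamma> w = \<phi> (inv' (a w))" using Suc.hyps(1)[of w] w V Suc.hyps(2) Suc.prems by simp
      have 1: "inv' (a u) = e one' w u \<odot> inv' (a w)"
        using aA[OF V(1)] aA[OF V(2)] by (simp add: e_def mul_assoc)
      have "e one' w u \<in> \<Sigma>" using e\<Sigma>[of one' w u] J V d_adj[OF adj_sym[OF w(1)]] by simp
      moreover have "inv' (a w) \<in> \<Sigma>" "inv' (a u) \<in> \<Sigma>"
        using ainv\<Sigma> V Suc.prems Suc.hyps(2) w d_sym[of u v0] d_sym[of w v0] v0 by auto
      ultimately have "\<phi> (inv' (a u)) = p w u \<circ> \<phi> (inv' (a w))"
        using \<phi>_mul[of "e one' w u" "inv' (a w)"] 1 by (simp add: p_def)
      then show ?case using \<gamma>(2)[OF adj_sym[OF w(1)]] IH by simp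
    qed
    have c0: "c g v0 = \<phi> (inv' (a (g v0)) \<odot> g)" if "g \<in> J" for g
      using JA[OF that] by (simp add: c_def e_def a_def[of v0])
    have quot: "finite_quotient J F \<Phi> (B v0 r)"
      unfolding finite_quotient_def
    proof (intro conjI ballI)
      fix g assume "g \<in> Fix J (B v0 r)"
      then have g: "g \<in> J" "\<And>x. x \<in> B v0 r \<Longrightarrow> g x = x" by (auto simp: Fix_def)
      have gv0: "g v0 = v0" using g B_self[OF v0] by blast
      have g\<Sigma>: "g \<in> \<Sigma>" using g(1) gv0 by (simp add: \<Sigma>_def)
      have "\<phi> g = \<pi> one'"
      proof (rule \<phi>_eq[OF g\<Sigma>])
        fix x assume "x \<in> B v0 s"
        then have "x \<in> B v0 r" "x \<in> V" using Bsr B_sub by blast+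
        then show "one' x = g x" using g(2)[of x] by simp
      qed (use H in auto)
      then have "\<phi> g = id" using finite_quotient_one[OF H(1) q(1)] by simp
      moreover have "\<Phi> g = \<phi> g" using \<Phi>(3)[OF g(1) v0] gv0 \<gamma>(1) c0[OF g(1)] JA[OF g(1)] inv_one by (simp add: a_def)
      ultimately show "\<Phi> g = id" by simp
    qed (use q(1) \<Phi> finite_B[OF v0] B_sub in \<open>auto simp: finite_quotient_def\<close>)
    \<comment> \<open>Some \<open>j0\<close> in \<open>J\<close> has the germ of \<open>h0\<close>.
      Triviality of \<open>\<Phi> j0\<close> would force \<open>\<phi> j0\<close>, which is
      \<open>\<pi> h0\<close>, to be trivial.\<close>
    have "d v0 (h0 v0) \<le> M" by (simp add: M_def D0_def)
    then obtain j0 where j0: "j0 \<in> J" "\<And>x. x \<in> B v0 r \<Longrightarrow> j0 x = h0 x"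
      using germs_agree[OF eq_refl[OF g[symmetric]] q(2)] by blast
    have j0v0: "j0 v0 = h0 v0" using j0 B_self[OF v0] by blast
    have j0\<Sigma>: "j0 \<in> \<Sigma>" using j0 j0v0 by (simp add: \<Sigma>_def M_def D0_def)
    have "\<phi> j0 = \<pi> h0" by (rule \<phi>_eq[OF j0\<Sigma> q(2)]) (use j0 Bsr in auto)
    let ?a = "inv' (a (j0 v0))"
    have V: "j0 v0 \<in> V" using JV[OF j0(1) v0] .
    have D0: "d v0 (j0 v0) \<le> D0" by (simp add: j0v0 D0_def)
    have a\<Sigma>: "?a \<in> \<Sigma>" using ainv\<Sigma>[OF V D0] .
    have "?a \<odot> j0 = e j0 v0 (j0 v0)" using JA[OF j0(1)] by (simp add: e_def a_def[of v0])
    then have "?a \<odot> j0 \<in> \<Sigma>" using e\<Sigma>[OF j0(1) v0 V] by simp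
    then have "c j0 v0 = \<phi> ?a \<circ> \<phi> j0" using c0[OF j0(1)] \<phi>_mul[OF a\<Sigma> j0\<Sigma>] by simp
    moreover have "\<gamma> (j0 v0) = \<phi> ?a" using \<gamma>_near[OF V] D0 d_sym[OF v0 V] by simp
    moreover have "\<Phi> j0 = id" by (rule nofi_quotient_trivial[OF J(1) nofi quot j0(1)])
    ultimately have "\<phi> ?a \<circ> \<phi> j0 = \<phi> ?a \<circ> id" using \<Phi>(3)[OF j0(1) v0] \<gamma>(1) by simp
    then have "\<phi> j0 = id" using permutes_inj[OF \<phi>_perm[OF a\<Sigma>]] by (simp add: fun_eq_iff inj_eq)
    then show False using \<open>\<phi> j0 = \<pi> h0\<close> q by simp
  qed
  then show thesis using that by blast
qed

section \<open>Topologically simple groups\<close>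

lemma closedin_sub:
  assumes H: "sub H" and L: "sub L" "L \<subseteq> H" and S: "finite S" "S \<subseteq> V" "Fix H S \<subseteq> L"
  shows "closedin (subtopology X H) L"
proof -
  define T where "T = {g \<in> auts V E. \<exists>l\<in>H - L. \<forall>v\<in>S. g v = l v}"
  have HA: "H \<subseteq> auts V E" using sub_auts[OF H] by blast
  have "openin X T" unfolding openin_aut
  proof (intro conjI ballI)
    fix g assume g: "g \<in> T"
    then obtain l where "l \<in> H - L" "\<forall>v\<in>S. g v = l v" by (auto simp: T_def)
    then show "\<exists>S. finite S \<and> S \<subseteq> V \<and> (\<forall>g'\<in>auts V E. (\<forall>v\<in>S. g' v = g v) \<longrightarrow> g' \<in> T)"
      using S by (intro exI[of _ S]) (auto simp: T_def)
  qed (auto simp: T_def)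
  moreover have "H - L = T \<inter> H"
  proof
    show "H - L \<subseteq> T \<inter> H" using HA by (auto simp: T_def)
    show "T \<inter> H \<subseteq> H - L"
    proof
      fix g assume g: "g \<in> T \<inter> H"
      then obtain l where l: "l \<in> H" "l \<notin> L" "\<forall>v\<in>S. g v = l v" by (auto simp: T_def)
      have A: "g \<in> auts V E" "l \<in> auts V E" using g l HA by auto
      have "inv' g \<odot> l \<in> Fix H S" using g l H S A by (auto simp: Fix_def subset_iff) (metis app_inv(1) subsetD S(2))
      then have "inv' g \<odot> l \<in> L" using S by blast
      then have "g \<in> L \<Longrightarrow> g \<odot> (inv' g \<odot> l) \<in> L" using L by blast
      then show "g \<in> H - L" using A g l by (auto simp: mul_inv_cancel)
    qed
  qed
  ultimately have "openin (subtopology X H) (H - L)" by (auto simp: openin_subtopology)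
  moreover have "topspace (subtopology X H) = H" using HA by auto
  ultimately show ?thesis using L by (simp add: closedin_def)
qed

lemma normal_iff:
  assumes H: "sub H"
  shows "N \<lhd> Aut V E\<lparr>carrier := H\<rparr> \<longleftrightarrow> sub N \<and> N \<subseteq> H \<and> (\<forall>g\<in>H. \<forall>n\<in>N. g \<odot> n \<odot> inv' g \<in> N)"
proof -
  interpret G: group "Aut V E\<lparr>carrier := H\<rparr>" by (rule A.subgroup_imp_group[OF H])
  have "subgroup N (Aut V E\<lparr>carrier := H\<rparr>) \<longleftrightarrow> sub N \<and> N \<subseteq> H"
    using A.incl_subgroup[OF H, of N] A.subgroup_incl[of N H] H subgroup.subset[of N "Aut V E\<lparr>carrier := H\<rparr>"]
    by auto
  moreover have "(\<forall>x\<in>H. \<forall>n\<in>N. x \<odot> n \<odot> inv\<^bsub>Aut V E\<lparr>carrier := H\<rparr>\<^esub> x \<in> N) \<longleftrightarrow>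
     (\<forall>g\<in>H. \<forall>n\<in>N. g \<odot> n \<odot> inv' g \<in> N)"
    using inv_sub[OF H] by simp
  ultimately show ?thesis by (simp add: G.normal_inv_iff)
qed

text \<open>The kernel of a nontrivial finite quotient is closed, normal and proper, hence trivial.
  Then \<open>H\<close> is finite, and so is the union of its finitely many orbits, although
  \<open>V\<close> is infinite.\<close>

lemma simple_nofi:
  assumes H: "sub H" and fin: "finite (orb H ` V)"
    and simple: "topologically_simple (Aut V E\<lparr>carrier := H\<rparr>) (subtopology X H)"
  shows "nofi H"
proof (rule ccontr)
  assume "\<not> nofi H"
  then obtain F :: "('v \<Rightarrow> 'v) set set" and \<pi> S h0 where q: "finite_quotient H F \<pi> S" "h0 \<in> H" "\<pi> h0 \<noteq> id"
    using not_nofi_quotient[OF H] by blast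
  note HA = sub_auts[OF H]
  let ?N = "{g \<in> H. \<pi> g = id}"
  have subN: "sub ?N" using sub_kernel[OF H q(1)] .
  have "closedin (subtopology X H) ?N"
    by (rule closedin_sub[OF H subN, of S]) (use q(1) in \<open>auto simp: finite_quotient_def Fix_def\<close>)
  moreover have "\<forall>g\<in>H. \<forall>n\<in>?N. g \<odot> n \<odot> inv' g \<in> ?N"
  proof (intro ballI)
    fix g n assume g: "g \<in> H" "n \<in> ?N"
    have "\<pi> (g \<odot> n \<odot> inv' g) = \<pi> g \<circ> \<pi> n \<circ> \<pi> (inv' g)"
      using q(1) g H by (auto simp: finite_quotient_def)
    then have "\<pi> (g \<odot> n \<odot> inv' g) = id" using g finite_quotient_inv(1)[OF H q(1) g(1)] by simp
    then show "g \<odot> n \<odot> inv' g \<in> ?N" using g H by simp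
  qed
  then have "?N \<lhd> Aut V E\<lparr>carrier := H\<rparr>" using normal_iff[OF H] subN by blast
  ultimately have "?N = {one'} \<or> ?N = H" using simple by (simp add: topologically_simple_def)
  then have N: "?N = {one'}" using q by blast
  have "inj_on \<pi> H"
  proof (rule inj_onI)
    fix g k assume gk: "g \<in> H" "k \<in> H" "\<pi> g = \<pi> k"
    have "g \<odot> inv' k \<in> ?N" using finite_quotient_kernel[OF H q(1) gk] gk H by simp
    then have "g \<odot> inv' k = one'" using N by blast
    then have "g \<odot> inv' k \<odot> k = k" using HA gk by simp
    then show "g = k" using HA gk by (simp add: mul_assoc)
  qed
  moreover have "\<pi> ` H \<subseteq> {p. p permutes F}" using q by (auto simp: finite_quotient_def)
  then have "finite (\<pi> ` H)" using q finite_subset finite_permutations by (auto simp: finite_quotient_def)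
  ultimately have "finite H" using finite_imageD by blast
  then have "finite (orb H v)" for v by (simp add: orb_def)
  then have "finite (\<Union> (orb H ` V))" using fin by blast
  moreover have "V \<subseteq> \<Union> (orb H ` V)" using orb_self[OF H] by blast
  ultimately show False using infinite_V finite_subset by blast
qed

section \<open>Translates of half-trees\<close>

text \<open>Deep inside \<open>h c e\<close> every sufficiently large ball stays in it and contains
  a translate of the edge. One side of the translated edge then avoids \<open>h e c\<close>, but its
  orientation is not controlled.\<close>

lemma translate_near:
  assumes H: "sub H" and fin: "finite (orb H ` V)" and ab: "adj a b" and ce: "adj c e"
  obtains g where "g \<in> H" "g a \<in> h c e" "g b \<in> h c e" "h (g a) (g b) \<subseteq> h c e \<or> h (g b) (g a) \<subseteq> h c e"
proof -
  let ?n = "card (orb H ` V)"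
  \<comment> \<open>The translates of \<open>a\<close> and \<open>b\<close> lie within
    \<open>n\<close> and \<open>n + 1\<close> of \<open>u\<close>, and leaving the half-tree takes
    at least \<open>n + 2\<close> steps, where \<open>n\<close> is the number of orbits.\<close>
  obtain u where u: "u \<in> h c e" "d u c = Suc (Suc ?n)" using h_deep[OF ce] by blast
  note V = adjD[OF ab] adjD[OF ce]
  have uV: "u \<in> V" using u h_sub by blast
  obtain g where g: "g \<in> H" "g a \<in> B u ?n" using orbits_meet_ball[OF H fin le_refl uV V(1)] .
  have gA: "g \<in> auts V E" using g H sub_auts by blast
  have gab: "adj (g a) (g b)" using adj_app'[OF gA ab] .
  note gV = adjD[OF gab]
  have in_h: "x \<in> h c e" if x: "x \<in> V" "d u x \<le> Suc ?n" for x
  proof (rule ccontr)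
    assume "x \<notin> h c e"
    then have "d u x = d u e + 1 + d c x" using d_h_sep[OF ce u(1) x(1)] by blast
    moreover have "d u c = d u e + 1 + d c c" using d_h_sep[OF ce u(1) V(4) h_fst[OF ce]] .
    ultimately show False using u x by simp
  qed
  have ga: "g a \<in> h c e" using in_h[OF gV(1)] g by (simp add: B_def)
  have "d u (g b) \<le> Suc ?n"
    using d_adj_le[OF adj_sym[OF gab] uV] g d_sym[OF uV gV(2)] d_sym[OF uV gV(1)] by (simp add: B_def)
  then have gb: "g b \<in> h c e" using in_h[OF gV(2)] by blast
  have out: "g a \<notin> h e c" "g b \<notin> h e c" using ga gb h_compl_iff[OF ce] gV by auto
  have "h (g a) (g b) \<subseteq> h c e \<or> h (g b) (g a) \<subseteq> h c e"
  proof (rule h_outside_cases[OF adj_sym[OF ce] gab out])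
    assume "h e c \<subseteq> h (g a) (g b)"
    then have "h (g b) (g a) \<subseteq> h c e" using h_compl[OF gab] h_compl[OF adj_sym[OF ce]] by blast
    then show ?thesis ..
  next
    assume "h e c \<inter> h (g a) (g b) = {}"
    then have "h (g a) (g b) \<subseteq> h c e" using h_compl[OF adj_sym[OF ce]] h_sub by blast
    then show ?thesis ..
  qed
  then show thesis using that g ga gb by blast
qed

lemma h_mul:
  assumes g: "g \<in> auts V E" "k \<in> auts V E" and ab: "adj a b"
  shows "h ((inv' g \<odot> k) a) ((inv' g \<odot> k) b) = inv' g ` h (k a) (k b)" "h a b = inv' g ` h (g a) (g b)"
proof -
  note V = adjD[OF ab]
  show "h ((inv' g \<odot> k) a) ((inv' g \<odot> k) b) = inv' g ` h (k a) (k b)"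
    using image_h[of "inv' g" "k a" "k b"] g V by simp
  show "h a b = inv' g ` h (g a) (g b)" using image_h[of "inv' g" "g a" "g b"] g V by simp
qed

lemma image_auts_disjoint:
  assumes "g \<in> auts V E" "P \<subseteq> V" "Q \<subseteq> V" "P \<inter> Q = {}" shows "g ` P \<inter> g ` Q = {}"
proof (rule ccontr)
  assume "g ` P \<inter> g ` Q \<noteq> {}"
  then obtain x y where "x \<in> P" "y \<in> Q" "g x = g y" by blast
  then show False using app_inj[OF assms(1), of x y] assms by blast
qed

text \<open>Since the flow vanishes, some translate of the edge is crossed backwards between \<open>a\<close> and \<open>g a\<close>.\<close>

lemma nested_imp_disjoint_translate:
  assumes H: "sub H" "nofi H" and ab: "adj a b"
    and g: "g \<in> H" "g a \<in> h a b" "h (g a) (g b) \<subseteq> h a b"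
  obtains k where "k \<in> H" "h (k a) (k b) \<inter> h a b = {}"
proof -
  note HA = sub_auts[OF H(1)]
  note V = adjD[OF ab]
  have gab: "adj (g a) (g b)" using adj_app'[OF HA[OF g(1)] ab] .
  have gaV: "g a \<in> V" using HA g V by blast
  define D where "D = (\<lambda>k. (k a, k b)) ` H"
  have D: "\<forall>(x, y)\<in>D. adj x y" using adj_app'[OF HA ab] by (auto simp: D_def)
  have inv: "\<forall>k\<in>H. \<forall>(x, y)\<in>D. (k x, k y) \<in> D"
  proof (clarify)
    fix k x y assume k: "k \<in> H" "(x, y) \<in> D"
    obtain l where l: "l \<in> H" "x = l a" "y = l b" using k(2) by (auto simp: D_def)
    then have "(k x, k y) = ((k \<odot> l) a, (k \<odot> l) b)" using HA k V by simp
    then show "(k x, k y) \<in> D" using l k H by (auto simp: D_def)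
  qed
  have "flow D a (g a) = 0" using nofi_flow_zero[OF H D inv g(1) V(1)] .
  moreover have "(one' a, one' b) \<in> D" unfolding D_def using H by blast
  then have "(a, b) \<in> D" using V by simp
  moreover have "(a, b) \<in> Sep a (g a)" using ab g h_fst by (auto simp: Sep_def)
  ultimately obtain a' b' where "(a', b') \<in> D" and sep: "(a', b') \<in> Sep (g a) a"
    using flow_zero_reverse[OF D V(1) gaV] by blast
  then obtain g' where g': "g' \<in> H" "a' = g' a" "b' = g' b" by (auto simp: D_def)
  have s: "adj a' b'" "g a \<notin> h a' b'" "a \<in> h a' b'" using sep by (auto simp: Sep_def)
  \<comment> \<open>\<open>a\<close> lies in \<open>h a' b'\<close> but not in
    \<open>h (g a) (g b)\<close>. This excludes nesting, so the two half-trees are disjoint;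
    applying \<open>inv' g\<close> moves the second to \<open>h a b\<close>.\<close>
  have a: "a \<notin> h (g a) (g b)" using g(3) h_fst[OF ab] by blast
  have gb: "g b \<notin> h a' b'"
  proof
    assume "g b \<in> h a' b'"
    then have "g b = b'" "g a = a'" using h_cross[OF s(1) adj_sym[OF gab]] s(2) by auto
    then show False using s(3) a by simp
  qed
  have "h a' b' \<inter> h (g a) (g b) = {}"
    by (rule h_outside_cases[OF s(1) gab s(2) gb]) (use s a in auto)
  then have "inv' g ` h (g' a) (g' b) \<inter> inv' g ` h (g a) (g b) = {}"
    using image_auts_disjoint[of "inv' g"] h_sub HA g g' by simp
  then have "h ((inv' g \<odot> g') a) ((inv' g \<odot> g') b) \<inter> h a b = {}"
    using h_mul(1)[OF HA HA ab, of g g'] h_mul(2)[OF HA HA ab, of g g] g g' by simp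
  then show thesis using that[of "inv' g \<odot> g'"] H g g' by blast
qed

text \<open>If the first translate is nested with its orientation preserved, the previous lemma
  applies. Otherwise a second translate is placed inside \<open>h (g1 b) (g1 a)\<close>: it either
  is disjoint from the first, or contains it, and then pulling back by \<open>g2\<close> gives a
  nested pair with the right orientation.\<close>

lemma disjoint_translate:
  assumes H: "sub H" "nofi H" and fin: "finite (orb H ` V)" and ab: "adj a b"
  obtains k where "k \<in> H" "h (k a) (k b) \<inter> h a b = {}"
proof -
  note HA = sub_auts[OF H(1)]
  obtain g1 where g1: "g1 \<in> H" "g1 a \<in> h a b" "g1 b \<in> h a b"
    "h (g1 a) (g1 b) \<subseteq> h a b \<or> h (g1 b) (g1 a) \<subseteq> h a b" using translate_near[OF H(1) fin ab ab] .
  show thesis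
  proof (cases "h (g1 a) (g1 b) \<subseteq> h a b")
    case True
    then show thesis using nested_imp_disjoint_translate[OF H ab g1(1,2)] that by blast
  next
    case False
    have A1: "adj (g1 a) (g1 b)" using adj_app'[OF HA[OF g1(1)] ab] .
    obtain g2 where g2: "g2 \<in> H" "g2 a \<in> h (g1 b) (g1 a)" "g2 b \<in> h (g1 b) (g1 a)"
      "h (g2 a) (g2 b) \<subseteq> h (g1 b) (g1 a) \<or> h (g2 b) (g2 a) \<subseteq> h (g1 b) (g1 a)"
      using translate_near[OF H(1) fin ab adj_sym[OF A1]] .
    have A2: "adj (g2 a) (g2 b)" using adj_app'[OF HA[OF g2(1)] ab] .
    show thesis
    proof (cases "h (g2 a) (g2 b) \<subseteq> h (g1 b) (g1 a)")
      case True
      then have "h (g2 a) (g2 b) \<inter> h (g1 a) (g1 b) = {}" using h_compl[OF A1] by blast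
      then have "inv' g1 ` h (g2 a) (g2 b) \<inter> inv' g1 ` h (g1 a) (g1 b) = {}"
        using image_auts_disjoint[of "inv' g1"] h_sub HA g1 g2 by simp
      then have "h ((inv' g1 \<odot> g2) a) ((inv' g1 \<odot> g2) b) \<inter> h a b = {}"
        using h_mul(1)[OF HA HA ab, of g1 g2] h_mul(2)[OF HA HA ab, of g1 g1] g1 g2 by simp
      then show thesis using that[of "inv' g1 \<odot> g2"] H g1 g2 by blast
    next
      case False
      then have sub: "h (g1 a) (g1 b) \<subseteq> h (g2 a) (g2 b)"
        using g2(4) h_compl[OF adj_sym[OF A1]] h_compl[OF adj_sym[OF A2]] by blast
      let ?g = "inv' g2 \<odot> g1"
      have g1a: "g1 a \<in> h (g2 a) (g2 b)"
      proof (rule ccontr)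
        assume "g1 a \<notin> h (g2 a) (g2 b)"
        moreover have "g1 b \<in> h (g2 a) (g2 b)" using sub h_snd[OF A1] by blast
        ultimately have "g1 b = g2 b" using h_cross[OF A2 adj_sym[OF A1]] by blast
        then show False using g2(3) h_fst[OF adj_sym[OF A1]] by simp
      qed
      have "?g a \<in> h a b"
        using g1a h_mul(2)[OF HA HA ab, of g2 g2] g1 g2 HA adjD[OF ab] by auto
      moreover have "h (?g a) (?g b) \<subseteq> h a b"
        using sub h_mul(1)[OF HA HA ab, of g2 g1] h_mul(2)[OF HA HA ab, of g2 g2] g1 g2 by auto
      moreover have "?g \<in> H" using g1 g2 H by blast
      ultimately show thesis using nested_imp_disjoint_translate[OF H ab, of ?g] that by blast
    qed
  qed
qed

text \<open>If \<open>translate_near\<close> puts the opposite half-tree inside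
  \<open>h c e\<close>, a disjoint translate of \<open>h a b\<close>, which lies in
  \<open>h b a\<close>, corrects the orientation.\<close>

lemma translate_inside:
  assumes H: "sub H" "nofi H" and fin: "finite (orb H ` V)" and ab: "adj a b" and ce: "adj c e"
  obtains k where "k \<in> H" "h (k a) (k b) \<subseteq> h c e"
proof -
  note HA = sub_auts[OF H(1)]
  note V = adjD[OF ab]
  obtain g where g: "g \<in> H" "h (g a) (g b) \<subseteq> h c e \<or> h (g b) (g a) \<subseteq> h c e"
    using translate_near[OF H(1) fin ab ce] by metis
  show thesis
  proof (cases "h (g a) (g b) \<subseteq> h c e")
    case True then show thesis using that g by blast
  next
    case False
    obtain k where k: "k \<in> H" "h (k a) (k b) \<inter> h a b = {}" using disjoint_translate[OF H fin ab] .
    have "h (k a) (k b) \<subseteq> h b a" using k(2) h_compl[OF ab] h_sub by blast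
    then have "g ` h (k a) (k b) \<subseteq> h (g b) (g a)" using image_h[OF HA[OF g(1)] V(2,1)] by blast
    then have "h ((g \<odot> k) a) ((g \<odot> k) b) \<subseteq> h c e"
      using g False image_h[OF HA[OF g(1)], of "k a" "k b"] HA k V by simp
    then show thesis using that[of "g \<odot> k"] g k H by blast
  qed
qed

text \<open>The element found acts as a translation whose axis crosses the edge from
  \<open>a\<close> to \<open>b\<close>. For the first edge on the way from \<open>u\<close> to
  \<open>n0 u\<close>, the half-tree containing \<open>u\<close> is either contained in its image,
  and then \<open>inv' n0\<close> serves, or disjoint from it.\<close>

lemma exists_nested:
  assumes H: "sub H" "nofi H" and fin: "finite (orb H ` V)"
    and N: "sub N" "\<And>g n. g \<in> H \<Longrightarrow> n \<in> N \<Longrightarrow> g \<odot> n \<odot> inv' g \<in> N" and n0: "n0 \<in> N" "n0 \<noteq> one'"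
  obtains n a b where "n \<in> N" "adj a b" "n a \<in> h a b" "h (n a) (n b) \<subseteq> h a b"
proof -
  note HA = sub_auts[OF H(1)]
  note NA = sub_auts[OF N(1)]
  have n0A: "n0 \<in> auts V E" using NA n0 by blast
  obtain u where u: "u \<in> V" "n0 u \<noteq> u" using auts_eqI[OF n0A one_closed] n0 by auto
  have n0u: "n0 u \<in> V" using n0A u by blast
  obtain m where m: "d u (n0 u) = Suc m" using d_eq_0[OF u(1) n0u] u(2) not0_implies_Suc by metis
  obtain u' where u': "adj u u'" "d u' (n0 u) = m" using d_step[OF u(1) n0u m] .
  have u'V: "u' \<in> V" using adjD[OF u'(1)] by blast
  have A: "adj u' u" using adj_sym[OF u'(1)] .
  have n0u_out: "n0 u \<notin> h u' u" using u' m d_sym[OF n0u u(1)] d_sym[OF n0u u'V] by (simp add: h_def)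
  have An: "adj (n0 u') (n0 u)" using adj_app'[OF n0A A] .
  have n0u'V: "n0 u' \<in> V" using n0A u'V by blast
  have "(h u' u \<subseteq> h (n0 u') (n0 u)) \<or> h u' u \<inter> h (n0 u') (n0 u) = {}"
  proof (cases "n0 u' \<in> h u' u")
    case True
    \<comment> \<open>Here \<open>n0\<close> inverts the edge and exchanges its two
      half-trees.\<close>
    then have "n0 u' = u" "n0 u = u'" using h_cross[OF A An True n0u_out] by auto
    then have "h (n0 u') (n0 u) = V - h u' u" using h_compl[OF A] by simp
    then show ?thesis by blast
  next
    case False
    show ?thesis by (rule h_outside_cases[OF A An False n0u_out]) auto
  qed
  then show thesis
  proof
    assume sub: "h u' u \<subseteq> h (n0 u') (n0 u)"
    let ?n = "inv' n0"
    have nA: "?n \<in> auts V E" using n0A by simp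
    have u'_in: "u' \<in> h (n0 u') (n0 u)"
    proof (rule ccontr)
      assume no: "u' \<notin> h (n0 u') (n0 u)"
      have "u \<in> h (n0 u') (n0 u)" using sub h_snd[OF A] by blast
      then have "u = n0 u" by (rule h_cross(1)[OF An u'(1) _ no])
      then show False using u(2) by simp
    qed
    have img: "?n ` h (n0 u') (n0 u) = h u' u" using image_h[OF nA n0u'V n0u] n0A u u'V by simp
    have "?n u' \<in> h u' u" using img u'_in by blast
    moreover have "h (?n u') (?n u) = ?n ` h u' u" using image_h[OF nA u'V u(1)] by simp
    then have "h (?n u') (?n u) \<subseteq> h u' u" using img sub by blast
    moreover have "?n \<in> N" using N n0 by blast
    ultimately show thesis using that[OF _ A] by blast
  next
    assume dis: "h u' u \<inter> h (n0 u') (n0 u) = {}"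
    \<comment> \<open>Ping-pong between \<open>n0\<close> and its conjugate \<open>?n1\<close>. The
      half-tree \<open>h ?a ?b\<close> is the translate by \<open>g\<close> of
      \<open>h u' u\<close>, and its complement lies in \<open>h u w\<close>. So \<open>?n1\<close>
      maps \<open>h ?a ?b\<close> into \<open>h u w\<close>, and \<open>n0\<close> maps
      \<open>h u w\<close> outside \<open>h u' u\<close>, thus back into
      \<open>h ?a ?b\<close>.\<close>
    obtain w where w: "adj u w" "d w u' = Suc (d u u')" using exists_farther[OF u(1) u'V] .
    have wV: "w \<in> V" using adjD[OF w(1)] by blast
    have "u' \<noteq> w" using w(2) by auto
    have u'_out: "u' \<notin> h u w"
    proof
      assume "u' \<in> h u w"
      then have "u' = w" using h_cross[OF w(1) A _ h_fst[OF w(1)]] by blast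
      then show False using \<open>u' \<noteq> w\<close> by blast
    qed
    have w_in: "w \<in> h u' u" using w d_adj[OF adj_sym[OF w(1)]] d_adj[OF u'(1)] wV by (simp add: h_def)
    have sub: "h u w \<subseteq> h u' u"
      by (rule h_outside_cases[OF w(1) A u'_out h_fst[OF w(1)]]) (use w_in h_snd[OF w(1)] in auto)
    obtain g where g: "g \<in> H" "h (g u) (g u') \<subseteq> h u w"
      using translate_inside[OF H fin u'(1) w(1)] .
    have gA: "g \<in> auts V E" using g HA by blast
    let ?n1 = "g \<odot> n0 \<odot> inv' g" and ?a = "g u'" and ?b = "g u"
    let ?n = "n0 \<odot> ?n1"
    have n1N: "?n1 \<in> N" using N(2) g n0 by blast
    have nN: "?n \<in> N" using N(1) n0 n1N by blast
    have nA: "?n \<in> auts V E" using NA nN by blast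
    have Ag: "adj ?a ?b" using adj_app'[OF gA A] .
    note gV = adjD[OF Ag]
    have n1: "?n1 z \<in> h u w" if z: "z \<in> h ?a ?b" for z
    proof -
      have zV: "z \<in> V" using z h_sub by blast
      have "inv' g z \<in> h u' u" using app_h[OF gA u'V u(1), of "inv' g z"] z zV gA by simp
      then have "n0 (inv' g z) \<in> h (n0 u') (n0 u)" using app_h[OF n0A u'V u(1)] zV gA by simp
      then have "n0 (inv' g z) \<in> h u u'" using dis h_compl[OF A] h_sub by blast
      then have "g (n0 (inv' g z)) \<in> h (g u) (g u')" using app_h[OF gA u(1) u'V] zV gA n0A by simp
      then show ?thesis using g(2) gA n0A zV by auto
    qed
    have n0Y: "n0 z \<notin> h u' u" if z: "z \<in> h u' u" for z
    proof -
      have "n0 z \<in> h (n0 u') (n0 u)" using app_h[OF n0A u'V u(1)] z h_sub by blast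
      then show ?thesis using dis by blast
    qed
    have nZ: "?n z \<notin> h u' u" if z: "z \<in> h ?a ?b" for z
      using n0Y[of "?n1 z"] n1[OF z] sub z h_sub gA n0A by (auto simp: subset_iff)
    have Zout: "x \<in> h ?a ?b" if "x \<in> V" "x \<notin> h u w" for x
      using that g(2) h_compl[OF adj_sym[OF Ag]] by blast
    have nZZ: "?n z \<in> h ?a ?b" if z: "z \<in> h ?a ?b" for z
      using Zout[of "?n z"] nZ[OF z] sub z h_sub nA by (auto simp: subset_iff)
    have img: "h (?n ?a) (?n ?b) = ?n ` h ?a ?b" using image_h[OF nA gV(1,2)] by simp
    have nsub: "h (?n ?a) (?n ?b) \<subseteq> h ?a ?b" unfolding img using nZZ by blast
    \<comment> \<open>The nesting is strict, as \<open>u\<close> lies in \<open>h ?a ?b\<close> but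
      not in its image; hence \<open>?n\<close> cannot fix the edge.\<close>
    have "?n ?a \<in> h ?a ?b"
    proof (rule ccontr)
      assume no: "?n ?a \<notin> h ?a ?b"
      have "?n ?b \<in> h ?a ?b" using nZZ h_snd[OF Ag] by blast
      then have "?n ?b = ?b" "?n ?a = ?a"
        using h_cross[OF Ag adj_sym[OF adj_app'[OF nA Ag]] _ no] by auto
      then have "h ?a ?b = ?n ` h ?a ?b" using img by simp
      moreover have "u \<in> h ?a ?b" using Zout[OF u(1)] h_fst[OF w(1)] by blast
      ultimately obtain z where "z \<in> h ?a ?b" "u = ?n z" by blast
      then show False using nZ[of z] h_snd[OF A] by simp
    qed
    then show thesis using that[OF nN Ag] nsub by blast
  qed
qed

section \<open>Powers of an element that nests a half-tree\<close>

lemma pow_closed [simp, intro]: "g \<in> auts V E \<Longrightarrow> g [^]\<^bsub>Aut V E\<^esub> (i::nat) \<in> auts V E"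
  using A.nat_pow_closed by simp

abbreviation pw :: "('v \<Rightarrow> 'v) \<Rightarrow> nat \<Rightarrow> 'v \<Rightarrow> 'v" where
  "pw g i \<equiv> g [^]\<^bsub>Aut V E\<^esub> i"

lemma pw_sub: "sub H \<Longrightarrow> g \<in> H \<Longrightarrow> pw g i \<in> H"
  by (induction i) auto

lemma pw_Suc: "g \<in> auts V E \<Longrightarrow> v \<in> V \<Longrightarrow> pw g (Suc i) v = g (pw g i v)"
  using A.nat_pow_Suc2[of g i] by simp

lemma pw_add: "g \<in> auts V E \<Longrightarrow> v \<in> V \<Longrightarrow> pw g (i + j) v = pw g i (pw g j v)"
  using A.nat_pow_mult[of g i j] app_mul[of "pw g i" "pw g j" v] by simp

lemma pw_inv: "g \<in> auts V E \<Longrightarrow> v \<in> V \<Longrightarrow> pw (inv' g) i (pw g i v) = v"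
  using A.nat_pow_inv[of g i] by simp

text \<open>For \<open>y\<close> in \<open>h a b\<close>, the image \<open>n y\<close> lies beyond
  the edge from \<open>n a\<close> to \<open>n b\<close>. Its distance to \<open>a\<close> is
  therefore that of \<open>y\<close> plus the positive distance from \<open>n a\<close> to
  \<open>a\<close>.\<close>

lemma nested_depth:
  assumes n: "n \<in> auts V E" and ab: "adj a b" and nest: "n a \<in> h a b" "h (n a) (n b) \<subseteq> h a b"
    and x: "x \<in> h a b"
  shows "pw n i x \<in> h a b \<and> d (pw n i x) a \<ge> Suc i"
proof (induction i)
  case 0
  have "x \<in> V" using x h_sub by blast
  moreover have "d x a \<noteq> 0" using x by (auto simp: h_def)
  ultimately show ?case using x by simp
next
  case (Suc i)
  let ?y = "pw n i x"
  note V = adjD[OF ab]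
  have xV: "x \<in> V" using x h_sub by blast
  have yV: "?y \<in> V" using Suc h_sub by blast
  have nab: "adj (n a) (n b)" using adj_app'[OF n ab] .
  have ny: "n ?y \<in> h (n a) (n b)" using app_h[OF n V(1,2) yV] Suc by blast
  have a_out: "a \<notin> h (n a) (n b)" using nest(2) h_fst[OF ab] by blast
  have "d (n ?y) a = d (n ?y) (n b) + 1 + d (n a) a" using d_h_sep[OF nab ny V(1) a_out] .
  moreover have "d (n ?y) (n a) = d (n ?y) (n b) + 1 + d (n a) (n a)"
    using d_h_sep[OF nab ny _ h_fst[OF nab]] adjD[OF nab] by blast
  moreover have "d (n ?y) (n a) = d ?y a" using n yV V by simp
  moreover have "d (n a) a \<noteq> 0" using nest(1) h_fst[OF ab] d_eq_0[of "n a" a] V n by auto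
  ultimately have "d (n ?y) a \<ge> Suc (Suc i)" using Suc by simp
  moreover have "n ?y \<in> h a b" using ny nest(2) by blast
  ultimately show ?case using pw_Suc[OF n xV] by simp
qed

lemma nested_inverse:
  assumes n: "n \<in> auts V E" and ab: "adj a b" and nest: "n a \<in> h a b" "h (n a) (n b) \<subseteq> h a b"
  shows "inv' n b \<in> h b a" "h (inv' n b) (inv' n a) \<subseteq> h b a"
proof -
  note V = adjD[OF ab]
  have i: "inv' n \<in> auts V E" using n by simp
  have iV: "inv' n a \<in> V" "inv' n b \<in> V" using i V by auto
  have nab: "adj (n a) (n b)" using adj_app'[OF n ab] .
  have a_out: "a \<notin> h (n a) (n b)" using nest(2) h_fst[OF ab] by blast
  have "b \<notin> h (n a) (n b)"
  proof
    assume "b \<in> h (n a) (n b)"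
    then have "a = n a" by (rule h_cross(2)[OF nab adj_sym[OF ab] _ a_out])
    then show False using nest(1) h_fst[OF ab] by simp
  qed
  then have "inv' n b \<notin> h a b" using app_h[OF n V(1,2) iV(2)] n V by simp
  then show "inv' n b \<in> h b a" using h_compl_iff[OF ab iV(2)] by blast
  show "h (inv' n b) (inv' n a) \<subseteq> h b a"
  proof
    fix x assume x: "x \<in> h (inv' n b) (inv' n a)"
    have xV: "x \<in> V" using x h_sub by blast
    have "n x \<in> h b a" using app_h[OF n iV(2,1) xV] x n V by simp
    then have "n x \<notin> h a b" using h_compl[OF ab] by blast
    then have "n x \<notin> h (n a) (n b)" using nest(2) by blast
    then have "x \<notin> h a b" using app_h[OF n V(1,2) xV] by blast
    then show "x \<in> h b a" using h_compl_iff[OF ab xV] by blast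
  qed
qed

lemma star_disjoint:
  assumes "adj u w" "adj u w'" "w \<noteq> w'" shows "h u w \<inter> h u w' = {}"
proof (rule ccontr)
  assume "h u w \<inter> h u w' \<noteq> {}"
  then obtain x where x: "x \<in> h u w" "x \<in> h u w'" by blast
  have xV: "x \<in> V" using x h_sub by blast
  have "d w x < d u x" "d w' x < d u x"
    using x xV d_sym adjD[OF assms(1)] adjD[OF assms(2)] by (auto simp: h_def)
  then show False using parent_unique[OF assms(1,2) xV] assms(3) by blast
qed

text \<open>Let \<open>n\<close> translate along an axis. Of three disjoint translates of the half-tree, at least one contains
  neither end of the axis, hence is disjoint from two half-trees \<open>P\<close> and \<open>M\<close> around these ends.\<close>

lemma exists_skewer:
  assumes H: "sub H" "nofi H" and fin: "finite (orb H ` V)"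
    and N: "sub N" "\<And>g n. g \<in> H \<Longrightarrow> n \<in> N \<Longrightarrow> g \<odot> n \<odot> inv' g \<in> N" "\<exists>n\<in>N. n \<noteq> one'"
    and branch: "adj u w1" "adj u w2" "adj u w3" "w1 \<noteq> w2" "w1 \<noteq> w3" "w2 \<noteq> w3"
    and vw: "adj v w"
  obtains n Z where "n \<in> N" "Z \<subseteq> V" "n ` (h v w \<union> Z) \<subseteq> Z" "\<And>y z. y \<in> h v w \<Longrightarrow> z \<in> Z \<Longrightarrow> d y z > k"
proof -
  note HA = sub_auts[OF H(1)]
  note NA = sub_auts[OF N(1)]
  obtain n0 where "n0 \<in> N" "n0 \<noteq> one'" using N(3) by blast
  then obtain n a b where n: "n \<in> N" "adj a b" "n a \<in> h a b" "h (n a) (n b) \<subseteq> h a b"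
    using exists_nested[OF H fin N(1,2)] by blast
  have nA: "n \<in> auts V E" using NA n by blast
  have iA: "inv' n \<in> auts V E" using nA by simp
  have ba: "adj b a" using adj_sym[OF n(2)] .
  note V = adjD[OF n(2)] and vwV = adjD[OF vw]
  note inv = nested_inverse[OF nA n(2,3,4)]
  obtain g1 where g1: "g1 \<in> H" "h (g1 v) (g1 w) \<subseteq> h u w1" using translate_inside[OF H fin vw branch(1)] .
  obtain g2 where g2: "g2 \<in> H" "h (g2 v) (g2 w) \<subseteq> h u w2" using translate_inside[OF H fin vw branch(2)] .
  obtain g3 where g3: "g3 \<in> H" "h (g3 v) (g3 w) \<subseteq> h u w3" using translate_inside[OF H fin vw branch(3)] .
  define W where "W = {g1 v, g1 w, g2 v, g2 w, g3 v, g3 w}"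
  \<comment> \<open>All endpoints of the three translated edges lie within \<open>j\<close> of both
    \<open>a\<close> and \<open>b\<close>, while points of \<open>P\<close> are farther than
    \<open>j\<close> from \<open>a\<close> and points of \<open>M\<close> farther than
    \<open>j\<close> from \<open>b\<close>. So neither half-tree contains such an endpoint.\<close>
  define j where "j = Max (d a ` W \<union> d b ` W)"
  have finW: "finite (d a ` W \<union> d b ` W)" by (simp add: W_def)
  have j: "d a x \<le> j" "d b x \<le> j" if "x \<in> W" for x
    using Max_ge[OF finW, of "d a x"] Max_ge[OF finW, of "d b x"] imageI[OF that]
    unfolding j_def by blast+
  define P where "P = h (pw n j a) (pw n j b)"
  define M where "M = h (pw (inv' n) j b) (pw (inv' n) j a)"
  have Pi: "P = pw n j ` h a b" unfolding P_def using image_h[of "pw n j" a b] nA V by simp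
  have Mi: "M = pw (inv' n) j ` h b a" unfolding M_def using image_h[of "pw (inv' n) j" b a] iA V by simp
  have adjP: "adj (pw n j a) (pw n j b)" using adj_app'[OF _ n(2)] nA by blast
  have adjM: "adj (pw (inv' n) j b) (pw (inv' n) j a)" using adj_app'[OF _ ba] iA by blast
  have Pd: "d x a \<ge> Suc j" if x: "x \<in> P" for x
    using nested_depth[OF nA n(2,3,4), of _ j] x unfolding Pi by blast
  have Md: "d x b \<ge> Suc j" if x: "x \<in> M" for x
    using nested_depth[OF iA ba inv, of _ j] x unfolding Mi by blast
  have dich: "(P \<subseteq> h (g v) (g w) \<or> P \<inter> h (g v) (g w) = {}) \<and> (M \<subseteq> h (g v) (g w) \<or> M \<inter> h (g v) (g w) = {})
      \<and> g v \<notin> P"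
    if g: "g \<in> H" and gs: "g v \<in> W" "g w \<in> W" for g
  proof -
    have gvw: "adj (g v) (g w)" using adj_app'[OF HA[OF g] vw] .
    note gV = adjD[OF gvw]
    have "d (g v) a \<le> j" "d (g w) a \<le> j" "d (g v) b \<le> j" "d (g w) b \<le> j"
      using j[OF gs(1)] j[OF gs(2)] d_sym[OF gV(1)] d_sym[OF gV(2)] V by auto
    then have out: "g v \<notin> P" "g w \<notin> P" "g v \<notin> M" "g w \<notin> M"
      using Pd Md by (meson Suc_n_not_le_n le_trans)+
    have "P \<subseteq> h (g v) (g w) \<or> P \<inter> h (g v) (g w) = {}"
      using h_outside_cases[OF adjP gvw] out unfolding P_def by blast
    moreover have "M \<subseteq> h (g v) (g w) \<or> M \<inter> h (g v) (g w) = {}"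
      using h_outside_cases[OF adjM gvw] out unfolding M_def by blast
    ultimately show ?thesis using out by blast
  qed
  have dis: "h (g1 v) (g1 w) \<inter> h (g2 v) (g2 w) = {}" "h (g1 v) (g1 w) \<inter> h (g3 v) (g3 w) = {}"
      "h (g2 v) (g2 w) \<inter> h (g3 v) (g3 w) = {}"
    using star_disjoint[OF branch(1,2,4)] star_disjoint[OF branch(1,3,5)] star_disjoint[OF branch(2,3,6)]
      g1 g2 g3 by blast+
  obtain x where x: "x \<in> P" using h_snd[OF adjP] by (auto simp: P_def)
  obtain y where y: "y \<in> M" using h_snd[OF adjM] by (auto simp: M_def)
  have "\<exists>g\<in>{g1, g2, g3}. P \<inter> h (g v) (g w) = {} \<and> M \<inter> h (g v) (g w) = {}"
    using dich[OF g1(1)] dich[OF g2(1)] dich[OF g3(1)] dis x y unfolding W_def by blast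
  then obtain g where g: "g \<in> {g1, g2, g3}" "P \<inter> h (g v) (g w) = {}" "M \<inter> h (g v) (g w) = {}" by blast
  have gH: "g \<in> H" using g g1 g2 g3 by blast
  have gA: "g \<in> auts V E" using HA gH by blast
  have gvP: "g v \<notin> P" using dich[OF gH] g(1) unfolding W_def by blast
  let ?g = "inv' g"
  have gi: "?g \<in> auts V E" "?g \<in> H" using gA gH H by auto
  \<comment> \<open>Of the exponent, one \<open>j\<close> carries the complement of \<open>M\<close>
    into \<open>h a b\<close>, the other reaches \<open>P\<close>, and \<open>k\<close> gives the
    required distance from \<open>h v w\<close>.\<close>
  define N' where "N' = ?g \<odot> pw n (2 * j + k) \<odot> inv' ?g"
  define Z where "Z = (\<lambda>x. ?g (pw n (j + k) x)) ` h a b"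
  have N'N: "N' \<in> N" unfolding N'_def using N(2)[OF gi(2)] pw_sub[OF N(1) n(1)] by blast
  have habV: "x \<in> V" if "x \<in> h a b" for x using that h_sub by blast
  have N'app: "N' x = ?g (pw n (2 * j + k) (g x))" if "x \<in> V" for x
    using that gA gi nA by (simp add: N'_def)
  have gY: "g y \<in> h (g v) (g w)" "y \<in> V" "g y \<in> V" if "y \<in> h v w" for y
    using app_h[OF gA vwV(1,2), of y] that h_sub gA by auto
  have "Z \<subseteq> V" using habV gi nA by (auto simp: Z_def)
  moreover have "N' ` (h v w \<union> Z) \<subseteq> Z"
  proof
    fix x' assume "x' \<in> N' ` (h v w \<union> Z)"
    then obtain x where x: "x' = N' x" "x \<in> h v w \<or> x \<in> Z" by blast
    from x(2) show "x' \<in> Z"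
    proof
      assume y: "x \<in> h v w"
      have "g x \<notin> M" using gY[OF y] g(3) by blast
      have "pw n j (g x) \<in> h a b"
      proof (rule ccontr)
        assume "pw n j (g x) \<notin> h a b"
        then have "pw n j (g x) \<in> h b a" using h_compl_iff[OF n(2)] gY[OF y] nA by blast
        then have "pw (inv' n) j (pw n j (g x)) \<in> M" unfolding Mi by blast
        then show False using \<open>g x \<notin> M\<close> pw_inv[OF nA] gY[OF y] by simp
      qed
      moreover have "pw n (2 * j + k) (g x) = pw n (j + k) (pw n j (g x))"
      proof -
        have e: "2 * j + k = (j + k) + j" by simp
        show ?thesis unfolding e by (rule pw_add[OF nA gY(3)[OF y]])
      qed
      ultimately show ?thesis using N'app[OF gY(2)[OF y]] x(1) by (simp add: Z_def)
    next
      assume "x \<in> Z"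
      then obtain z where z: "z \<in> h a b" "x = ?g (pw n (j + k) z)" by (auto simp: Z_def)
      have zV: "z \<in> V" using habV z by blast
      have "pw n (2 * j + k) z \<in> h a b" using nested_depth[OF nA n(2,3,4) z(1)] by blast
      moreover have "N' x = ?g (pw n (j + k) (pw n (2 * j + k) z))"
      proof -
        have "N' x = ?g (pw n (2 * j + k) (pw n (j + k) z))"
          using N'app[of x] z zV gA gi nA by simp
        then show ?thesis using pw_add[OF nA zV, of "2 * j + k" "j + k"] pw_add[OF nA zV, of "j + k" "2 * j + k"]
          by (simp add: add.commute)
      qed
      ultimately show ?thesis using x(1) by (simp add: Z_def)
    qed
  qed
  moreover have "d y z > k" if y: "y \<in> h v w" and zZ: "z \<in> Z" for y z
  proof -
    obtain x where x: "x \<in> h a b" "z = ?g (pw n (j + k) x)" using zZ by (auto simp: Z_def)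
    have xV: "x \<in> V" using habV x by blast
    have xP: "pw n (j + k) x \<in> P"
    proof -
      have "pw n k x \<in> h a b" using nested_depth[OF nA n(2,3,4) x(1)] by blast
      then show ?thesis using pw_add[OF nA xV, of j k] unfolding Pi by simp
    qed
    have gyP: "g y \<notin> P" using gY[OF y] g(2) by blast
    let ?x = "pw n (j + k) x"
    have xV': "?x \<in> V" using xV nA by simp
    have ajV: "pw n j a \<in> V" using V nA by simp
    have "d ?x (g y) = d ?x (pw n j b) + 1 + d (pw n j a) (g y)"
      using d_h_sep[OF adjP _ gY(3)[OF y]] xP gyP unfolding P_def by blast
    moreover have "d ?x (pw n j a) = d ?x (pw n j b) + 1 + d (pw n j a) (pw n j a)"
      using d_h_sep[OF adjP _ ajV h_fst[OF adjP]] xP unfolding P_def by blast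
    moreover have "d ?x (pw n j a) = d (pw n k x) a"
      using pw_add[OF nA xV, of j k] nA xV V by simp
    moreover have "d (pw n k x) a \<ge> Suc k" using nested_depth[OF nA n(2,3,4) x(1)] by blast
    moreover have "d y z = d (g y) ?x" using d_app[OF gA gY(2)[OF y], of z] x(2) xV' gA gi by simp
    moreover have "d (g y) ?x = d ?x (g y)" using d_sym gY[OF y] xV' by blast
    ultimately show ?thesis using d_self[of "pw n j a"] by linarith
  qed
  ultimately show thesis using that N'N by blast
qed

section \<open>The \<open>k\<close>-closure\<close>

definition kclosure :: "('v \<Rightarrow> 'v) set \<Rightarrow> nat \<Rightarrow> ('v \<Rightarrow> 'v) set" where
  "kclosure H k = {g \<in> auts V E. \<forall>v\<in>V. \<exists>l\<in>H. \<forall>x\<in>B v k. g x = l x}"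

lemma kclosure_superset: "sub H \<Longrightarrow> H \<subseteq> kclosure H k"
  using sub_auts by (auto simp: kclosure_def)

lemma kclosure_auts: "kclosure H k \<subseteq> auts V E"
  by (auto simp: kclosure_def)

lemma sub_kclosure:
  assumes H: "sub H" shows "sub (kclosure H k)"
proof (rule subI[OF kclosure_auts])
  note HA = sub_auts[OF H(1)]
  show "one' \<in> kclosure H k" using kclosure_superset[OF H] H by blast
  fix g assume g: "g \<in> kclosure H k"
  have gA: "g \<in> auts V E" using g kclosure_auts by blast
  show "inv' g \<in> kclosure H k" unfolding kclosure_def
  proof (intro CollectI conjI ballI)
    show "inv' g \<in> auts V E" using gA by simp
    fix v assume v: "v \<in> V"
    then have "inv' g v \<in> V" using gA by simp
    then obtain l where l: "l \<in> H" "\<And>x. x \<in> B (inv' g v) k \<Longrightarrow> g x = l x" using g by (auto simp: kclosure_def)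
    have "inv' g x = inv' l x" if x: "x \<in> B v k" for x
    proof -
      have xV: "x \<in> V" using x B_sub by blast
      have "inv' g x \<in> B (inv' g v) k" using app_B[of "inv' g" x v k] gA xV v x by simp
      then have "l (inv' g x) = x" using l(2) gA xV by fastforce
      then show ?thesis using app_inv(1)[OF HA[OF l(1)], of "inv' g x"] gA xV by simp
    qed
    then show "\<exists>l\<in>H. \<forall>x\<in>B v k. inv' g x = l x" using l H by blast
  qed
  fix g' assume g': "g' \<in> kclosure H k"
  have g'A: "g' \<in> auts V E" using g' kclosure_auts by blast
  show "g \<odot> g' \<in> kclosure H k" unfolding kclosure_def
  proof (intro CollectI conjI ballI)
    show "g \<odot> g' \<in> auts V E" using gA g'A by simp
    fix v assume v: "v \<in> V"
    obtain l' where l': "l' \<in> H" "\<And>x. x \<in> B v k \<Longrightarrow> g' x = l' x" using g' v by (auto simp: kclosure_def)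
    have g'v: "g' v \<in> V" using g'A v by simp
    then obtain l where l: "l \<in> H" "\<And>x. x \<in> B (g' v) k \<Longrightarrow> g x = l x" using g by (auto simp: kclosure_def)
    have "(g \<odot> g') x = (l \<odot> l') x" if x: "x \<in> B v k" for x
    proof -
      have xV: "x \<in> V" using x B_sub by blast
      have "g' x \<in> B (g' v) k" using app_B[OF g'A xV v] x by blast
      then show ?thesis using l l' x xV gA g'A HA by simp
    qed
    then show "\<exists>l\<in>H. \<forall>x\<in>B v k. (g \<odot> g') x = l x" using l l' H by blast
  qed
qed

lemma closedin_kclosure: "closedin X (kclosure H k)"
  unfolding closedin_def
proof
  show "kclosure H k \<subseteq> topspace X" using kclosure_auts by simp
  show "openin X (topspace X - kclosure H k)" unfolding openin_aut
  proof (intro conjI ballI)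
    fix g assume g: "g \<in> topspace X - kclosure H k"
    then obtain v where v: "v \<in> V" "\<And>l. l \<in> H \<Longrightarrow> \<exists>x\<in>B v k. g x \<noteq> l x" by (auto simp: kclosure_def)
    show "\<exists>S. finite S \<and> S \<subseteq> V \<and> (\<forall>g'\<in>auts V E. (\<forall>v\<in>S. g' v = g v) \<longrightarrow> g' \<in> topspace X - kclosure H k)"
    proof (intro exI[of _ "B v k"] conjI ballI impI)
      fix g' assume g': "g' \<in> auts V E" "\<forall>x\<in>B v k. g' x = g x"
      have "\<exists>x\<in>B v k. g' x \<noteq> l x" if "l \<in> H" for l using v(2)[OF that] g' by metis
      then have "\<not> (\<exists>l\<in>H. \<forall>x\<in>B v k. g' x = l x)" by blast
      then have "g' \<notin> kclosure H k" using v(1) unfolding kclosure_def by blast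
      then show "g' \<in> topspace X - kclosure H k" using g' by simp
    qed (use finite_B[OF v(1)] B_sub in auto)
  qed auto
qed

lemma kclosure_locally:
  assumes "g \<in> auts V E" "\<And>v. v \<in> V \<Longrightarrow> \<exists>l\<in>kclosure H k. \<forall>x\<in>B v k. g x = l x"
  shows "g \<in> kclosure H k"
  unfolding kclosure_def
proof (intro CollectI conjI ballI assms(1))
  fix v assume v: "v \<in> V"
  obtain l where l: "l \<in> kclosure H k" "\<forall>x\<in>B v k. g x = l x" using assms(2)[OF v] by blast
  obtain l' where "l' \<in> H" "\<forall>x\<in>B v k. l x = l' x" using l(1) v by (auto simp: kclosure_def)
  then show "\<exists>l\<in>H. \<forall>x\<in>B v k. g x = l x" using l(2) by auto
qed

text \<open>The tool for building elements of the k-closure piecewise. Since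
  \<open>k \<ge> 1\<close>, agreement on balls controls all neighbours of a vertex, so such a
  bijection preserves adjacency in both directions.\<close>

lemma kclosure_glue:
  assumes k: "k \<ge> 1"
    and \<xi>: "\<And>v. v \<in> V \<Longrightarrow> \<xi> v \<in> V" "\<And>v. v \<in> V \<Longrightarrow> \<xi>' v \<in> V"
      "\<And>v. v \<in> V \<Longrightarrow> \<xi> (\<xi>' v) = v" "\<And>v. v \<in> V \<Longrightarrow> \<xi>' (\<xi> v) = v"
    and loc: "\<And>v. v \<in> V \<Longrightarrow> \<exists>l\<in>kclosure H k. \<forall>x\<in>B v k. \<xi> x = l x"
  shows "restrict \<xi> V \<in> kclosure H k"
proof (rule kclosure_locally)
  show "\<exists>l\<in>kclosure H k. \<forall>x\<in>B v k. restrict \<xi> V x = l x" if v: "v \<in> V" for v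
    using loc[OF v] B_sub[of v k] by (auto simp: subset_iff)
  have inj: "\<xi> u = \<xi> v \<Longrightarrow> u = v" if "u \<in> V" "v \<in> V" for u v using \<xi>(4) that by metis
  have fwd: "adj (\<xi> u) (\<xi> v) \<longleftrightarrow> adj u v" if uv: "u \<in> V" "v \<in> V" for u v
  proof -
    obtain l where l: "l \<in> kclosure H k" "\<forall>x\<in>B u k. \<xi> x = l x" using loc[OF uv(1)] by blast
    have lA: "l \<in> auts V E" using l(1) kclosure_auts by blast
    have lu: "\<xi> u = l u" using l(2) B_self uv by blast
    show ?thesis
    proof
      assume a: "adj u v"
      then have "\<xi> v = l v" using l(2) B_adj k by blast
      then show "adj (\<xi> u) (\<xi> v)" using adj_app'[OF lA a] lu by simp
    next
      assume a: "adj (\<xi> u) (\<xi> v)"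
      have \<xi>vV: "\<xi> v \<in> V" using \<xi>(1) uv by blast
      let ?w = "inv' l (\<xi> v)"
      have wV: "?w \<in> V" using lA \<xi>vV by simp
      have "adj (l u) (l ?w)" using a lu lA \<xi>vV by simp
      then have w: "adj u ?w" using adj_app[OF lA uv(1) wV] by blast
      then have "\<xi> ?w = l ?w" using l(2) B_adj k by blast
      then have "\<xi> ?w = \<xi> v" using lA \<xi>vV by simp
      then have "?w = v" using inj wV uv by blast
      then show "adj u v" using w by simp
    qed
  qed
  show "restrict \<xi> V \<in> auts V E"
  proof (rule autsI)
    show "inj_on (restrict \<xi> V) V" using inj by (auto simp: inj_on_def)
    show "V \<subseteq> restrict \<xi> V ` V"
    proof
      fix v assume "v \<in> V"
      then have "\<xi>' v \<in> V" "v = restrict \<xi> V (\<xi>' v)" using \<xi> by auto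
      then show "v \<in> restrict \<xi> V ` V" by blast
    qed
  qed (use \<xi> fwd in auto)
qed

lemma fixed_half_tree:
  assumes "g \<in> auts V E" "adj v w" "g v = v" "g w = w" "u \<in> V"
  shows "g u \<in> h v w \<longleftrightarrow> u \<in> h v w"
  using app_h[OF assms(1) adjD(1,2)[OF assms(2)] assms(5)] assms by simp

text \<open>The independence property of the \<open>k\<close>-closure.\<close>

lemma kclosure_half_tree:
  assumes H: "sub H" and k: "k \<ge> 1" and g: "g \<in> kclosure H k" "\<And>x. x \<in> B v k \<Longrightarrow> g x = x" and vw: "adj v w"
  obtains g1 where "g1 \<in> kclosure H k" "\<And>x. x \<in> h v w \<Longrightarrow> g1 x = g x"
    "\<And>x. x \<in> V \<Longrightarrow> x \<notin> h v w \<Longrightarrow> g1 x = x"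
proof -
  note V = adjD[OF vw]
  have gA: "g \<in> auts V E" using g kclosure_auts by blast
  have gvw: "g v = v" "g w = w" using g(2) B_self[OF V(1)] B_adj[OF vw k] by auto
  have fh: "g u \<in> h v w \<longleftrightarrow> u \<in> h v w" if "u \<in> V" for u using fixed_half_tree[OF gA vw gvw that] .
  have fhi: "inv' g u \<in> h v w \<longleftrightarrow> u \<in> h v w" if "u \<in> V" for u
    using fh[of "inv' g u"] gA that by simp
  define \<xi> where "\<xi> u = (if u \<in> h v w then g u else u)" for u
  define \<xi>' where "\<xi>' u = (if u \<in> h v w then inv' g u else u)" for u
  have "restrict \<xi> V \<in> kclosure H k"
  proof (rule kclosure_glue[OF k, of _ \<xi>'])
    fix u assume u: "u \<in> V"
    show "\<xi> u \<in> V" "\<xi>' u \<in> V" "\<xi> (\<xi>' u) = u" "\<xi>' (\<xi> u) = u"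
      using u fh fhi gA by (auto simp: \<xi>_def \<xi>'_def)
    show "\<exists>l\<in>kclosure H k. \<forall>x\<in>B u k. \<xi> x = l x"
    proof (cases "u \<in> h v w")
      case True
      have "\<xi> x = g x" if x: "x \<in> B u k" for x
      proof (cases "x \<in> h v w")
        case False
        have xV: "x \<in> V" using x B_sub by blast
        \<comment> \<open>The path from \<open>u\<close> to \<open>x\<close> crosses the edge, so
          \<open>x\<close> is nearer to \<open>v\<close> than to \<open>u\<close> and lies in the
          ball fixed by \<open>g\<close>.\<close>
        have "d u x = d u w + 1 + d v x" using d_h_sep[OF vw True xV False] .
        then have "x \<in> B v k" using x xV by (simp add: B_def)
        then show ?thesis using g(2) False by (simp add: \<xi>_def)
      qed (simp add: \<xi>_def)
      then show ?thesis using g(1) by blast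
    next
      case False
      have "\<xi> x = one' x" if x: "x \<in> B u k" for x
      proof (cases "x \<in> h v w")
        case True
        have xV: "x \<in> V" using x B_sub by blast
        have "d x u = d x w + 1 + d v u" using d_h_sep[OF vw True u False] .
        moreover have "d v x \<le> Suc (d w x)" using d_adj_le[OF vw xV] .
        ultimately have "x \<in> B v k" using x xV d_sym[OF xV u] d_sym[OF xV V(2)] by (simp add: B_def)
        then show ?thesis using g(2) True xV by (simp add: \<xi>_def)
      next
        case xF: False
        have "x \<in> V" using x B_sub by blast
        then show ?thesis using xF by (simp add: \<xi>_def)
      qed
      then show ?thesis using sub_kclosure[OF H] by blast
    qed
  qed
  moreover have "restrict \<xi> V x = g x" if "x \<in> h v w" for x using that h_sub by (auto simp: \<xi>_def)
  moreover have "restrict \<xi> V x = x" if "x \<in> V" "x \<notin> h v w" for x using that by (simp add: \<xi>_def)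
  ultimately show thesis using that by blast
qed

text \<open>Writing \<open>g\<close> as a commutator: with \<open>x\<close> the infinite product of the conjugates
  \<open>n\<^sup>i g n\<^sup>-\<^sup>i\<close>, whose supports are far apart, one has \<open>g = x (n x\<^sup>-\<^sup>1 n\<^sup>-\<^sup>1)\<close>.\<close>

lemma kclosure_commutator:
  assumes H: "sub H" and k: "k \<ge> 1" and vw: "adj v w"
    and g: "g \<in> kclosure H k" "\<And>x. x \<in> B v k \<Longrightarrow> g x = x" "\<And>x. x \<in> V \<Longrightarrow> x \<notin> h v w \<Longrightarrow> g x = x"
    and n: "n \<in> kclosure H k" "Z \<subseteq> V" "n ` (h v w \<union> Z) \<subseteq> Z"
    and far: "\<And>y z. y \<in> h v w \<Longrightarrow> z \<in> Z \<Longrightarrow> d y z > k"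
  obtains x where "x \<in> kclosure H k" "g = x \<odot> (n \<odot> inv' x \<odot> inv' n)"
proof -
  let ?G = "kclosure H k"
  have G: "sub ?G" using sub_kclosure[OF H] .
  have GA: "l \<in> auts V E" if "l \<in> ?G" for l using that kclosure_auts by blast
  have gA: "g \<in> auts V E" and nA: "n \<in> auts V E" using GA g n by auto
  note V = adjD[OF vw]
  have gvw: "g v = v" "g w = w" using g(2) B_self[OF V(1)] B_adj[OF vw k] by auto
  \<comment> \<open>\<open>Y i\<close> carries the support of the conjugate of \<open>g\<close> by
    the i-th power of \<open>n\<close>; from index 1 on these sets lie in \<open>Z\<close>.\<close>
  define Y where "Y i = pw n i ` h v w" for i
  have YV: "Y i \<subseteq> V" for i using h_sub nA by (auto simp: Y_def)
  have Yin: "pw n i y \<in> Y i" if "y \<in> h v w" for i y using that by (auto simp: Y_def)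
  have Y0: "Y 0 = h v w" using h_sub by (force simp: Y_def)
  have YS: "n y \<in> Y (Suc i)" if y: "y \<in> Y i" for i y
  proof -
    obtain z where "z \<in> h v w" "y = pw n i z" using y by (auto simp: Y_def)
    then show ?thesis using pw_Suc[OF nA, of z i] h_sub Yin[of z "Suc i"] by (simp add: subset_iff)
  qed
  have YS': "\<exists>z\<in>Y i. y = n z" if y: "y \<in> Y (Suc i)" for i y
  proof -
    obtain z where z: "z \<in> h v w" "y = pw n (Suc i) z" using y by (auto simp: Y_def)
    then have "y = n (pw n i z)" using pw_Suc[OF nA, of z i] h_sub by (simp add: subset_iff)
    then show ?thesis using Yin[OF z(1)] by blast
  qed
  have YZ: "Y (Suc i) \<subseteq> Z" for i
  proof (induction i)
    case 0
    show ?case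
    proof
      fix y assume "y \<in> Y (Suc 0)"
      then obtain z where "z \<in> Y 0" "y = n z" using YS' by blast
      then show "y \<in> Z" using n(3) Y0 by blast
    qed
  next
    case (Suc i)
    show ?case
    proof
      fix y assume "y \<in> Y (Suc (Suc i))"
      then obtain z where "z \<in> Y (Suc i)" "y = n z" using YS' by blast
      then show "y \<in> Z" using n(3) Suc by blast
    qed
  qed
  \<comment> \<open>Moving back by the i-th power of \<open>n\<close> turns the pair into a point of
    \<open>h v w\<close> and a point of \<open>Z\<close>.\<close>
  have sep: "d y z > k" if yz: "y \<in> Y i" "z \<in> Y j" and ij: "i < j" for y z i j
  proof -
    obtain m where m: "j = i + Suc m" using ij less_natE by (metis add_Suc_right)
    obtain y' where y': "y' \<in> h v w" "y = pw n i y'" using yz by (auto simp: Y_def)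
    obtain z' where z': "z' \<in> h v w" "z = pw n j z'" using yz by (auto simp: Y_def)
    have zy: "y' \<in> V" "z' \<in> V" using y' z' h_sub by auto
    have "z = pw n i (pw n (Suc m) z')" using pw_add[OF nA zy(2), of i "Suc m"] z' m by simp
    moreover have "pw n (Suc m) z' \<in> Z" using YZ Yin[OF z'(1)] by blast
    moreover have "pw n (Suc m) z' \<in> V" using calculation(2) n(2) by blast
    ultimately show ?thesis using far[OF y'(1)] y'(2) d_app[of "pw n i" y' "pw n (Suc m) z'"] nA zy by simp
  qed
  have sep': "d y z > k" if "y \<in> Y i" "z \<in> Y j" "i \<noteq> j" for y z i j
  proof (cases "i < j")
    case True then show ?thesis using sep that by blast
  next
    case False
    then have "d z y > k" using sep that by (meson linorder_neqE_nat)
    moreover have "y \<in> V" "z \<in> V" using that YV by auto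
    ultimately show ?thesis using d_sym by simp
  qed
  have uniq: "i = j" if "y \<in> Y i" "y \<in> Y j" for y i j using sep'[OF that] by fastforce
  define idx where "idx y = (THE i. y \<in> Y i)" for y
  have idx: "idx y = i" if "y \<in> Y i" for y i
    unfolding idx_def by (rule the_equality) (use that uniq in auto)
  define g' where "g' i = pw n i \<odot> g \<odot> inv' (pw n i)" for i
  have g'G: "g' i \<in> ?G" for i unfolding g'_def using G g(1) pw_sub[OF G n(1)] by simp
  have g'A: "g' i \<in> auts V E" for i using GA g'G by blast
  have g'app: "g' i (pw n i y) = pw n i (g y)" if "y \<in> V" for i y
    using that nA gA by (simp add: g'_def)
  have rep: "\<exists>y\<in>V. u = pw n i y" if "u \<in> V" for u i
  proof (rule bexI[of _ "inv' (pw n i) u"])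
    show "u = pw n i (inv' (pw n i) u)" using that nA by simp
  qed (use that nA in simp)
  have Y_iff: "pw n i y \<in> Y i \<longleftrightarrow> y \<in> h v w" if "y \<in> V" for i y
  proof
    assume "pw n i y \<in> Y i"
    then obtain z where z: "z \<in> h v w" "pw n i y = pw n i z" by (auto simp: Y_def)
    then have "y = z" using app_inj[of "pw n i" y z] that h_sub nA by auto
    then show "y \<in> h v w" using z by simp
  qed (rule Yin)
  have g'Y: "g' i u \<in> Y i \<longleftrightarrow> u \<in> Y i" if u: "u \<in> V" for i u
  proof -
    obtain y where y: "y \<in> V" "u = pw n i y" using rep[OF u] by blast
    then show ?thesis using g'app Y_iff fixed_half_tree[OF gA vw gvw y(1)] gA by simp
  qed
  have g'Yi: "inv' (g' i) u \<in> Y i \<longleftrightarrow> u \<in> Y i" if u: "u \<in> V" for i u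
    using g'Y[of "inv' (g' i) u" i] u g'A[of i] by simp
  have g'out: "g' i u = u" if u: "u \<in> V" "u \<notin> Y i" for i u
  proof -
    obtain y where y: "y \<in> V" "u = pw n i y" using rep[OF u(1)] by blast
    then show ?thesis using g'app Y_iff g(3) u by simp
  qed
  \<comment> \<open>A point of \<open>Y i\<close> within \<open>k\<close> of the complement is a
    translate of a point of \<open>B v k\<close>, where \<open>g\<close> is trivial.\<close>
  have g'near: "g' i y = y" if y: "y \<in> Y i" and u: "u \<in> V" "u \<notin> Y i" and dk: "d u y \<le> k" for i u y
  proof -
    obtain y' where y': "y' \<in> V" "y = pw n i y'" using rep y YV by blast
    obtain u' where u': "u' \<in> V" "u = pw n i u'" using rep[OF u(1)] by blast
    have "y' \<in> h v w" "u' \<notin> h v w" using y y' u u' Y_iff by auto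
    then have "d y' u' = d y' w + 1 + d v u'" using d_h_sep[OF vw _ u'(1)] by blast
    moreover have "d v y' \<le> Suc (d w y')" using d_adj_le[OF vw y'(1)] .
    moreover have "d u y = d y' u'" using u' y' nA d_sym[OF u'(1) y'(1)] by simp
    ultimately have "y' \<in> B v k" using dk y'(1) d_sym[OF y'(1) V(2)] by (simp add: B_def)
    then show ?thesis using g(2) g'app y' by simp
  qed
  define \<xi> where "\<xi> u = (if \<exists>i. u \<in> Y i then g' (idx u) u else u)" for u
  define \<xi>' where "\<xi>' u = (if \<exists>i. u \<in> Y i then inv' (g' (idx u)) u else u)" for u
  have \<xi>in: "\<xi> u = g' i u" "\<xi>' u = inv' (g' i) u" if "u \<in> Y i" for u i
    using that idx[OF that] by (auto simp: \<xi>_def \<xi>'_def)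
  have \<xi>out: "\<xi> u = u" "\<xi>' u = u" if "\<And>i. u \<notin> Y i" for u using that by (auto simp: \<xi>_def \<xi>'_def)
  have x: "restrict \<xi> V \<in> ?G"
  proof (rule kclosure_glue[OF k, of _ \<xi>'])
    fix u assume u: "u \<in> V"
    have "\<xi> u \<in> V \<and> \<xi>' u \<in> V \<and> \<xi> (\<xi>' u) = u \<and> \<xi>' (\<xi> u) = u"
    proof (cases "\<exists>i. u \<in> Y i")
      case True
      then obtain i where i: "u \<in> Y i" by blast
      have "g' i u \<in> Y i" "inv' (g' i) u \<in> Y i" using g'Y[OF u] g'Yi[OF u] i by auto
      then show ?thesis using \<xi>in i g'A[of i] u by simp
    next
      case False
      then show ?thesis using \<xi>out u by simp
    qed
    then show "\<xi> u \<in> V" "\<xi>' u \<in> V" "\<xi> (\<xi>' u) = u" "\<xi>' (\<xi> u) = u" by auto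
    \<comment> \<open>A k-ball centred in \<open>Y i\<close> meets no other \<open>Y j\<close>, so
      \<open>\<xi>\<close> agrees there with \<open>g' i\<close>. A k-ball centred outside all of
      them meets them only where \<open>\<xi>\<close> is trivial.\<close>
    show "\<exists>l\<in>?G. \<forall>x\<in>B u k. \<xi> x = l x"
    proof (cases "\<exists>i. u \<in> Y i")
      case True
      then obtain i where i: "u \<in> Y i" by blast
      have "\<xi> x = g' i x" if x: "x \<in> B u k" for x
      proof (cases "\<exists>j. x \<in> Y j")
        case True
        then obtain j where j: "x \<in> Y j" by blast
        have "i = j" using sep'[OF i j] x by (fastforce simp: B_def)
        then show ?thesis using \<xi>in j by blast
      next
        case False
        then show ?thesis using \<xi>out g'out[of x i] x B_sub by (auto simp: subset_iff)
      qed
      then show ?thesis using g'G by blast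
    next
      case False
      have "\<xi> x = one' x" if x: "x \<in> B u k" for x
      proof -
        have xV: "x \<in> V" using x B_sub by blast
        show ?thesis
        proof (cases "\<exists>j. x \<in> Y j")
          case True
          then obtain j where j: "x \<in> Y j" by blast
          have "g' j x = x" using g'near[OF j u] False x by (auto simp: B_def)
          then show ?thesis using \<xi>in[OF j] xV by simp
        next
          case False
          then show ?thesis using \<xi>out xV by simp
        qed
      qed
      then show ?thesis using G by blast
    qed
  qed
  let ?x = "restrict \<xi> V"
  have xA: "?x \<in> auts V E" using GA x by blast
  \<comment> \<open>Conjugation by \<open>n\<close> shifts the factor \<open>g' i\<close> of the
    product to \<open>g' (Suc i)\<close>, and the missing factor \<open>g' 0\<close> is
    \<open>g\<close>. The identity is checked pointwise in this form, which is free of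
    inverses.\<close>
  have "g \<odot> (n \<odot> ?x) = ?x \<odot> n"
  proof (rule auts_eqI)
    show "g \<odot> (n \<odot> ?x) \<in> auts V E" "?x \<odot> n \<in> auts V E" using gA nA xA by auto
    fix u assume u: "u \<in> V"
    have nu: "n u \<in> V" using nA u by simp
    have l: "(g \<odot> (n \<odot> ?x)) u = g (n (\<xi> u))" and r: "(?x \<odot> n) u = \<xi> (n u)"
      using gA nA xA u nu by auto
    show "(g \<odot> (n \<odot> ?x)) u = (?x \<odot> n) u"
    proof (cases "\<exists>i. u \<in> Y i")
      case True
      then obtain i where i: "u \<in> Y i" by blast
      obtain y where y: "y \<in> V" "u = pw n i y" using rep[OF u] by blast
      have "n (\<xi> u) = n (pw n i (g y))" using \<xi>in(1)[OF i] g'app y by simp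
      also have "\<dots> = pw n (Suc i) (g y)" using pw_Suc[OF nA, of "g y"] gA y by simp
      also have "\<dots> = g' (Suc i) (n u)" using g'app[OF y(1), of "Suc i"] pw_Suc[OF nA y(1)] y by simp
      finally have e: "n (\<xi> u) = g' (Suc i) (n u)" .
      have "g' (Suc i) (n u) \<in> Y (Suc i)" using g'Y[OF nu] YS[OF i] by blast
      then have "g' (Suc i) (n u) \<notin> h v w" using uniq[of _ "Suc i" 0] Y0 by blast
      then have "g (n (\<xi> u)) = g' (Suc i) (n u)" using g(3) e g'A nu by simp
      then show ?thesis using l r \<xi>in(1)[OF YS[OF i]] by simp
    next
      case False
      then have \<xi>u: "\<xi> u = u" using \<xi>out by blast
      have "g (n u) = \<xi> (n u)"
      proof (cases "n u \<in> h v w")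
        case True
        then have "\<xi> (n u) = g' 0 (n u)" using \<xi>in(1)[of "n u" 0] Y0 by blast
        also have "\<dots> = g (n u)" using g'app[OF nu, of 0] gA nu by simp
        finally show ?thesis by simp
      next
        case nuF: False
        have "n u \<notin> Y i" for i
        proof (cases i)
          case 0 then show ?thesis using nuF Y0 by simp
        next
          case (Suc m)
          show ?thesis
          proof
            assume "n u \<in> Y i"
            then obtain z where "z \<in> Y m" "n u = n z" using YS' Suc by blast
            then have "u \<in> Y m" using app_inj[OF nA u, of z] YV by blast
            then show False using False by blast
          qed
        qed
        then show ?thesis using \<xi>out g(3)[OF nu nuF] by simp
      qed
      then show ?thesis using l r \<xi>u by simp
    qed
  qed
  then have "g \<odot> (n \<odot> ?x) \<odot> (inv' ?x \<odot> inv' n) = ?x \<odot> n \<odot> (inv' ?x \<odot> inv' n)" by simp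
  then have "g = ?x \<odot> (n \<odot> inv' ?x \<odot> inv' n)" using gA nA xA by (simp add: mul_assoc mul_inv_cancel)
  then show thesis using that x by blast
qed

text \<open>Without branching, triviality on a ball of radius 1 propagates outwards: once
  \<open>y\<close> and its neighbour \<open>z\<close> are fixed, the other neighbour
  \<open>x\<close> of \<open>y\<close> has nowhere to go. The branch vertex is what
  \<open>exists_skewer\<close> needs for its three half-trees.\<close>

lemma exists_branch:
  assumes g: "g \<in> auts V E" "v \<in> V" "\<And>x. x \<in> B v 1 \<Longrightarrow> g x = x" "g \<noteq> one'"
  obtains u w1 w2 w3 where "adj u w1" "adj u w2" "adj u w3" "w1 \<noteq> w2" "w1 \<noteq> w3" "w2 \<noteq> w3"
proof -
  have "\<exists>u w1 w2 w3. adj u w1 \<and> adj u w2 \<and> adj u w3 \<and> w1 \<noteq> w2 \<and> w1 \<noteq> w3 \<and> w2 \<noteq> w3"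
  proof (rule ccontr)
    assume no: "\<not> ?thesis"
    have "g x = x" if "x \<in> V" for x
      using that
    proof (induction "d x v" arbitrary: x rule: less_induct)
      case less
      have xV: "x \<in> V" using less.prems .
      show ?case
      proof (cases "d x v \<le> 1")
        case True
        then show ?thesis using g(3)[of x] xV d_sym[OF xV g(2)] by (simp add: B_def)
      next
        case False
        then obtain m where m: "d x v = Suc (Suc m)" by (metis One_nat_def Suc_le_mono not0_implies_Suc not_less_eq_eq zero_le)
        obtain y where y: "adj x y" "d y v = Suc m" using d_step[OF xV g(2) m] .
        have yV: "y \<in> V" using adjD[OF y(1)] by blast
        obtain z where z: "adj y z" "d z v = m" using d_step[OF yV g(2) y(2)] .
        have zV: "z \<in> V" using adjD[OF z(1)] by blast
        have gy: "g y = y" "g z = z" using less.hyps[of y] less.hyps[of z] yV zV y z m by auto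
        have yx: "adj y x" using adj_sym[OF y(1)] .
        have ygx: "adj y (g x)" using adj_app'[OF g(1) yx] gy by simp
        have "x \<noteq> z" using m z by auto
        moreover have "g x \<noteq> z" using app_inj[OF g(1) xV zV] gy \<open>x \<noteq> z\<close> by simp
        ultimately show ?thesis using no yx ygx z by metis
      qed
    qed
    then have "g = one'" using g by (intro auts_eqI) auto
    then show False using g by blast
  qed
  then show thesis using that by blast
qed

text \<open>By independence, an element of the k-closure that fixes \<open>B v k\<close> is a
  product of such elements supported in single half-trees at \<open>v\<close>. Each factor is a
  commutator with an element of \<open>N\<close>, hence lies in \<open>N\<close>.\<close>

lemma kclosure_simple:
  assumes H: "sub H" "nofi H" and fin: "finite (orb H ` V)" and k: "k \<ge> 1"
    and N: "sub N" "N \<subseteq> kclosure H k" "\<And>g n. g \<in> kclosure H k \<Longrightarrow> n \<in> N \<Longrightarrow> g \<odot> n \<odot> inv' g \<in> N"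
      "\<exists>n\<in>N. n \<noteq> one'"
  shows "N = kclosure H k"
proof -
  let ?G = "kclosure H k"
  have G: "sub ?G" using sub_kclosure[OF H(1)] .
  have GA: "l \<in> auts V E" if "l \<in> ?G" for l using that kclosure_auts by blast
  have HG: "H \<subseteq> ?G" using kclosure_superset[OF H(1)] .
  have HA: "l \<in> auts V E" if "l \<in> H" for l using that HG GA by blast
  obtain v0 where v0: "v0 \<in> V" using V_ne by blast
  text \<open>\<open>H\<close> has no proper open normal subgroup, and \<open>?G = H Fix(B v k)\<close> for every \<open>v\<close>.\<close>
  have top: "M = ?G" if M: "sub M" "M \<subseteq> ?G" and norm: "\<And>g n. g \<in> ?G \<Longrightarrow> n \<in> M \<Longrightarrow> g \<odot> n \<odot> inv' g \<in> M"
    and FixM: "\<And>v. v \<in> V \<Longrightarrow> Fix ?G (B v k) \<subseteq> M" for M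
  proof -
    have "H \<inter> M = H"
    proof (rule nofi_open_normal[OF H fin])
      show "sub (H \<inter> M)"
        by (rule subI) (use H M HA in auto)
      show "finite (B v0 k)" "B v0 k \<subseteq> V" using finite_B[OF v0] B_sub by auto
      show "Fix H (B v0 k) \<subseteq> H \<inter> M" using FixM[OF v0] HG by (auto simp: Fix_def)
      show "g \<odot> n \<odot> inv' g \<in> H \<inter> M" if "g \<in> H" "n \<in> H \<inter> M" for g n
        using that norm[of g n] HG H by auto
    qed auto
    then have HM: "H \<subseteq> M" by blast
    show "M = ?G"
    proof
      show "?G \<subseteq> M"
      proof
        fix g assume g: "g \<in> ?G"
        obtain l where l: "l \<in> H" "\<And>x. x \<in> B v0 k \<Longrightarrow> g x = l x" using g v0 by (auto simp: kclosure_def)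
        have A: "g \<in> auts V E" "l \<in> auts V E" using g l GA HA by auto
        have "(inv' l \<odot> g) x = x" if x: "x \<in> B v0 k" for x
          using l(2)[OF x] A x B_sub by (auto simp: subset_iff)
        moreover have "inv' l \<odot> g \<in> ?G" using g l HG G by blast
        ultimately have "inv' l \<odot> g \<in> M" using FixM[OF v0] by (auto simp: Fix_def)
        then have "l \<odot> (inv' l \<odot> g) \<in> M" using HM l M by blast
        then show "g \<in> M" using A by (simp add: mul_inv_cancel)
      qed
    qed (rule M)
  qed
  \<comment> \<open>If all these stabilisers were trivial, \<open>top\<close> applied to the trivial
    subgroup would make \<open>?G\<close> trivial, against the nontriviality of \<open>N\<close>. A
    nontrivial element fixing a ball then provides a branch vertex.\<close>
  have "\<exists>v g. v \<in> V \<and> g \<in> Fix ?G (B v k) \<and> g \<noteq> one'"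
  proof (rule ccontr)
    assume no: "\<not> ?thesis"
    have "{one'} = ?G"
    proof (rule top)
      show "sub {one'}" using A.triv_subgroup .
      show "{one'} \<subseteq> ?G" using G by blast
      show "g \<odot> n \<odot> inv' g \<in> {one'}" if "g \<in> ?G" "n \<in> {one'}" for g n using GA that by auto
      show "Fix ?G (B v k) \<subseteq> {one'}" if "v \<in> V" for v using no that by blast
    qed
    then show False using N by blast
  qed
  then obtain v1 g1 where g1: "v1 \<in> V" "g1 \<in> Fix ?G (B v1 k)" "g1 \<noteq> one'" by blast
  obtain u w1 w2 w3 where branch: "adj u w1" "adj u w2" "adj u w3" "w1 \<noteq> w2" "w1 \<noteq> w3" "w2 \<noteq> w3"
  proof (rule exists_branch[of g1 v1])
    show "g1 \<in> auts V E" using g1 GA by (auto simp: Fix_def)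
    show "g1 x = x" if "x \<in> B v1 1" for x using g1 that B_mono[OF k] by (auto simp: Fix_def)
  qed (use g1 in auto)
  have half: "g \<in> N" if vw: "adj v w" and g: "g \<in> Fix ?G (B v k)" "\<And>x. x \<in> V \<Longrightarrow> x \<notin> h v w \<Longrightarrow> g x = x" for v w g
  proof -
    obtain n Z where n: "n \<in> N" "Z \<subseteq> V" "n ` (h v w \<union> Z) \<subseteq> Z" "\<And>y z. y \<in> h v w \<Longrightarrow> z \<in> Z \<Longrightarrow> d y z > k"
    proof (rule exists_skewer[OF H fin N(1) _ N(4) branch vw])
      show "g \<odot> n \<odot> inv' g \<in> N" if "g \<in> H" "n \<in> N" for g n using N(3) HG that by blast
    qed (rule that; assumption)
    have nG: "n \<in> ?G" using n N by blast
    have gG: "g \<in> ?G" "\<And>x. x \<in> B v k \<Longrightarrow> g x = x" using g by (auto simp: Fix_def)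
    obtain x where x: "x \<in> ?G" "g = x \<odot> (n \<odot> inv' x \<odot> inv' n)"
      using kclosure_commutator[OF H(1) k vw gG g(2) nG n(2,3,4)] by blast
    \<comment> \<open>Regrouped as a conjugate of \<open>n\<close> times the inverse of
      \<open>n\<close>, so that normality applies.\<close>
    have "g = (x \<odot> n \<odot> inv' x) \<odot> inv' n" using x(2) GA[OF x(1)] GA[OF nG] by (simp add: mul_assoc)
    then show ?thesis using N(3)[OF x(1) n(1)] n(1) N(1) by simp
  qed
  have "N = ?G"
  proof (rule top[OF N(1,2,3)])
    fix v assume v: "v \<in> V"
    have fin_n: "finite {w. adj v w}"
    proof (rule finite_subset)
      show "{w. adj v w} \<subseteq> B v 1" using B_adj by auto
    qed (rule finite_B[OF v])
    have cover: "\<exists>w. adj v w \<and> x \<in> h v w" if x: "x \<in> V" "x \<noteq> v" for x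
    proof -
      obtain m where m: "d v x = Suc m" using d_eq_0[OF v x(1)] x(2) not0_implies_Suc by metis
      obtain w where w: "adj v w" "d w x = m" using d_step[OF v x(1) m] .
      then have "x \<in> h v w" using m x d_sym[OF v x(1)] d_sym[OF _ x(1), of w] adjD[OF w(1)] by (simp add: h_def)
      then show ?thesis using w by blast
    qed
    \<comment> \<open>The half-trees at \<open>v\<close> are peeled off one by one:
      \<open>g1\<close> is the part of \<open>g\<close> in \<open>h v w\<close>, and
      \<open>inv' g1 \<odot> g\<close> is trivial there.\<close>
    have gen: "g \<in> N" if "finite W" "W \<subseteq> {w. adj v w}" "g \<in> Fix ?G (B v k)"
      "\<And>x. x \<in> V \<Longrightarrow> x \<notin> (\<Union>w\<in>W. h v w) \<Longrightarrow> g x = x" for W g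
      using that
    proof (induction W arbitrary: g rule: finite_induct)
      case empty
      have "g \<in> auts V E" using empty GA by (auto simp: Fix_def)
      then have "g = one'" using empty(3) by (intro auts_eqI) auto
      then show ?case using N by blast
    next
      case (insert w W)
      have vw: "adj v w" using insert by blast
      have gG: "g \<in> ?G" "\<And>x. x \<in> B v k \<Longrightarrow> g x = x" using insert(5) by (auto simp: Fix_def)
      obtain g1 where g1: "g1 \<in> ?G" "\<And>x. x \<in> h v w \<Longrightarrow> g1 x = g x" "\<And>x. x \<in> V \<Longrightarrow> x \<notin> h v w \<Longrightarrow> g1 x = x"
        using kclosure_half_tree[OF H(1) k gG vw] by blast
      have g1_fix: "g1 x = x" if "x \<in> B v k" for x
        using g1(2,3)[of x] gG(2)[OF that] subsetD[OF B_sub that] by (cases "x \<in> h v w") auto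
      have g1F: "g1 \<in> Fix ?G (B v k)" using g1 g1_fix by (auto simp: Fix_def)
      have g1N: "g1 \<in> N" by (rule half[OF vw g1F g1(3)])
      have A: "g \<in> auts V E" "g1 \<in> auts V E" using gG g1 GA by auto
      have fixi: "inv' g1 x = x" if "x \<in> V" "g1 x = x" for x using app_inv(1)[OF A(2) that(1)] that(2) by simp
      let ?g = "inv' g1 \<odot> g"
      have "?g \<in> N"
      proof (rule insert.IH)
        show "W \<subseteq> {w. adj v w}" using insert by blast
        have "?g x = x" if x: "x \<in> B v k" for x
          using x B_sub gG(2) g1_fix fixi A by (auto simp: subset_iff)
        moreover have "?g \<in> ?G" using G g1 gG by blast
        ultimately show "?g \<in> Fix ?G (B v k)" by (auto simp: Fix_def)
        fix x assume x: "x \<in> V" "x \<notin> (\<Union>w\<in>W. h v w)"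
        show "?g x = x"
        proof (cases "x \<in> h v w")
          case True
          then have "?g x = inv' g1 (g1 x)" using g1(2) A x by simp
          then show ?thesis using A x by simp
        next
          case False
          then have "g x = x" using insert.prems(3)[OF x(1)] x by blast
          then show ?thesis using fixi[OF x(1) g1(3)[OF x(1) False]] A x by simp
        qed
      qed
      then have "g1 \<odot> ?g \<in> N" using g1N N(1) by blast
      then show ?case using A by (simp add: mul_inv_cancel)
    qed
    show "Fix ?G (B v k) \<subseteq> N"
    proof
      fix g assume g: "g \<in> Fix ?G (B v k)"
      show "g \<in> N"
      proof (rule gen[OF fin_n subset_refl g])
        fix x assume x: "x \<in> V" "x \<notin> (\<Union>w\<in>{w. adj v w}. h v w)"
        then have "x = v" using cover by blast
        then show "g x = x" using g B_self[OF v] by (auto simp: Fix_def)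
      qed
    qed
  qed
  then show ?thesis .
qed

section \<open>The two inclusions\<close>

lemma closed_subgroup_iff: "H \<in> closed_subgroups (Aut V E) X \<longleftrightarrow> sub H \<and> closedin X H"
  by (simp add: closed_subgroups_def)

lemma one_top: "\<one>\<^bsub>Aut V E\<^esub> \<in> topspace X"
  by simp

text \<open>Every finite set of germs of \<open>H\<close> at \<open>v0\<close> is realised by some
  member of \<open>S\<close>, so the bound on orbits passes to the limit, while a proper open
  subgroup of finite index in \<open>H\<close> would force one in a member of
  \<open>S\<close>.\<close>

lemma closure_imp_nofi:
  assumes H: "H \<in> chabauty (Aut V E) X closure_of S" and S: "S \<subseteq> Sub_le V E C" "\<And>J. J \<in> S \<Longrightarrow> nofi J"
  shows "H \<in> Sub_le V E C \<and> nofi H"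
proof -
  obtain v0 where v0: "v0 \<in> V" using V_ne by blast
  have Hc: "sub H" "closedin X H"
    using H by (auto simp: in_closure_of topspace_chabauty[OF one_top] closed_subgroup_iff)
  have approx: "\<exists>J\<in>S. germs v0 r D J = germs v0 r D H" for r D
  proof -
    let ?T = "{J \<in> closed_subgroups (Aut V E) X. germs v0 r D J = germs v0 r D H}"
    have "openin (chabauty (Aut V E) X) ?T" using openin_germs[OF v0] .
    moreover have "H \<in> ?T" using Hc by (simp add: closed_subgroup_iff)
    moreover have "\<And>T. H \<in> T \<Longrightarrow> openin (chabauty (Aut V E) X) T \<Longrightarrow> \<exists>J. J \<in> S \<and> J \<in> T"
      using H by (simp add: in_closure_of)
    ultimately obtain J where "J \<in> S" "J \<in> ?T" by meson
    then show ?thesis by blast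
  qed
  have "finite (orb H ` V) \<and> real (card (orb H ` V)) \<le> C"
  proof (rule few_orbits_of_germs[OF Hc(1) v0])
    fix r D
    obtain J where J: "J \<in> S" "germs v0 r D J = germs v0 r D H" using approx by blast
    then have "J \<in> Sub_le V E C" using S by blast
    then show "\<exists>J. sub J \<and> germs v0 r D J = germs v0 r D H \<and> finite (orb J ` V) \<and> real (card (orb J ` V)) \<le> C"
      using J unfolding Sub_le_iff by blast
  qed
  then have "H \<in> Sub_le V E C" using Hc by (simp add: Sub_le_iff)
  moreover have "nofi H"
  proof (rule ccontr)
    assume nn: "\<not> nofi H"
    \<comment> \<open>\<open>C\<close> is real; a number of orbits is at most \<open>C\<close> iff
      it is at most its integer part.\<close>
    obtain r D where rD: "\<And>J. sub J \<Longrightarrow> finite (orb J ` V) \<Longrightarrow> card (orb J ` V) \<le> nat \<lfloor>C\<rfloor> \<Longrightarrow>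
      germs v0 r D J = germs v0 r D H \<Longrightarrow> \<not> nofi J"
      using not_nofi_of_germs[OF Hc(1) nn v0, of "nat \<lfloor>C\<rfloor>"] by blast
    obtain J where J: "J \<in> S" "germs v0 r D J = germs v0 r D H" using approx by blast
    have "J \<in> Sub_le V E C" using S J by blast
    then have "\<not> nofi J" using rD[of J] J(2) le_nat_floor[of "card (orb J ` V)" C] by (simp add: Sub_le_iff)
    then show False using S(2)[OF J(1)] by blast
  qed
  ultimately show ?thesis by blast
qed

lemma orbits_superset:
  assumes H: "sub H" "finite (orb H ` V)" and J: "sub J" "H \<subseteq> J"
  shows "finite (orb J ` V)" "card (orb J ` V) \<le> card (orb H ` V)"
proof -
  let ?f = "\<lambda>A. orb J (SOME x. x \<in> A)"
  have "orb J ` V \<subseteq> ?f ` orb H ` V"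
  proof
    fix A assume "A \<in> orb J ` V"
    then obtain v where v: "v \<in> V" "A = orb J v" by blast
    have "(SOME x. x \<in> orb H v) \<in> orb H v"
      by (rule someI[of "\<lambda>x. x \<in> orb H v"]) (rule orb_self[OF H(1) v(1)])
    then obtain g where "g \<in> J" "(SOME x. x \<in> orb H v) = g v" using J by (auto simp: orb_def)
    then have "orb J (SOME x. x \<in> orb H v) = orb J v" using orb_app[OF J(1) v(1)] by simp
    then show "A \<in> ?f ` orb H ` V" using v by blast
  qed
  moreover have "finite (?f ` orb H ` V)" using H by simp
  ultimately show "finite (orb J ` V)" "card (orb J ` V) \<le> card (orb H ` V)"
    using finite_subset card_mono[of "?f ` orb H ` V" "orb J ` V"] card_image_le[OF H(2), of ?f]
    by (blast, linarith)
qed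

lemma kclosure_topologically_simple:
  assumes H: "sub H" "nofi H" and fin: "finite (orb H ` V)" and k: "k \<ge> 1"
  shows "topologically_simple (Aut V E\<lparr>carrier := kclosure H k\<rparr>) (subtopology X (kclosure H k))"
proof -
  let ?G = "kclosure H k"
  have G: "sub ?G" using sub_kclosure[OF H(1)] .
  have "?G \<noteq> {one'}"
  proof
    assume "?G = {one'}"
    then have "orb ?G v = {v}" if "v \<in> V" for v using that by (auto simp: orb_def)
    then have "\<Union> (orb ?G ` V) = V" by auto
    moreover have "finite (orb ?G v)" for v using \<open>?G = {one'}\<close> by (simp add: orb_def)
    ultimately have "finite V"
      using orbits_superset(1)[OF H(1) fin G kclosure_superset[OF H(1)]] by (metis (no_types, lifting) finite_UN_I finite_UN finite_Union imageE)
    then show False using infinite_V by blast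
  qed
  moreover have "N = {one'} \<or> N = ?G" if N: "N \<lhd> Aut V E\<lparr>carrier := ?G\<rparr>" for N
  proof (cases "\<exists>n\<in>N. n \<noteq> one'")
    case True
    then have "N = ?G" using kclosure_simple[OF H fin k, of N] N unfolding normal_iff[OF G] by blast
    then show ?thesis ..
  next
    case False
    moreover have "one' \<in> N" using N unfolding normal_iff[OF G] by blast
    ultimately show ?thesis by blast
  qed
  ultimately show ?thesis by (simp add: topologically_simple_def)
qed

lemma nofi_imp_closure:
  assumes H: "H \<in> Sub_le V E C" "nofi H"
  shows "H \<in> chabauty (Aut V E) X closure_of {H \<in> Sub_le V E C.
    topologically_simple (Aut V E \<lparr>carrier := H\<rparr>) (subtopology X H)}"
  unfolding in_closure_of topspace_chabauty[OF one_top]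
proof (intro conjI allI impI)
  have Hc: "sub H" "closedin X H" "finite (orb H ` V)" "real (card (orb H ` V)) \<le> C"
    using H by (auto simp: Sub_le_iff)
  obtain v0 where v0: "v0 \<in> V" using V_ne by blast
  show "H \<in> closed_subgroups (Aut V E) X" using Hc by (simp add: closed_subgroup_iff)
  fix T assume "H \<in> T \<and> openin (chabauty (Aut V E) X) T"
  then obtain K U where KU: "openin X U" "one' \<in> U" "chabauty_nbhd (Aut V E) X K U H \<subseteq> T"
    unfolding openin_chabauty by blast
  obtain S where S: "finite S" "S \<subseteq> V" "\<forall>g\<in>auts V E. (\<forall>v\<in>S. g v = one' v) \<longrightarrow> g \<in> U"
    using KU unfolding openin_aut by blast
  obtain r where r: "S \<subseteq> B v0 r" using finite_in_B[OF v0 S(1,2)] .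
  \<comment> \<open>The successor ensures \<open>k \<ge> 1\<close>, as the results on k-closures
    require.\<close>
  define k where "k = Suc r"
  have Sk: "S \<subseteq> B v0 k" using r B_mono[of r k v0] by (auto simp: k_def)
  let ?J = "kclosure H k"
  have J: "sub ?J" "H \<subseteq> ?J" using sub_kclosure[OF Hc(1)] kclosure_superset[OF Hc(1)] by auto
  have HA: "g \<in> auts V E" if "g \<in> H" for g using that Hc sub_auts by blast
  \<comment> \<open>An element of \<open>?J\<close> agrees on \<open>B v0 k\<close>, hence on
    \<open>S\<close>, with an element of \<open>H\<close>, and so differs from it by an element of
    \<open>U\<close>.\<close>
  have "?J \<subseteq> H <#>\<^bsub>Aut V E\<^esub> U"
  proof
    fix g assume g: "g \<in> ?J"
    obtain l where l: "l \<in> H" "\<And>x. x \<in> B v0 k \<Longrightarrow> g x = l x" using g v0 by (auto simp: kclosure_def)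
    have A: "g \<in> auts V E" "l \<in> auts V E" using g l kclosure_auts HA by auto
    have "(inv' l \<odot> g) x = one' x" if x: "x \<in> S" for x
    proof -
      have "x \<in> V" "g x = l x" using l(2) x Sk S by auto
      then show ?thesis using A by simp
    qed
    then have "inv' l \<odot> g \<in> U" using S(3) A by blast
    moreover have "g = l \<odot> (inv' l \<odot> g)" using A by (simp add: mul_inv_cancel)
    ultimately show "g \<in> H <#>\<^bsub>Aut V E\<^esub> U" using l(1) unfolding set_mult_def by blast
  qed
  moreover have "H \<subseteq> ?J <#>\<^bsub>Aut V E\<^esub> U"
  proof
    fix g assume g: "g \<in> H"
    then have "g = g \<odot> one'" using HA by simp
    then show "g \<in> ?J <#>\<^bsub>Aut V E\<^esub> U" using g J KU(2) unfolding set_mult_def by blast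
  qed
  ultimately have "?J \<in> T"
    using KU(3) J closedin_kclosure by (auto simp: chabauty_nbhd_def closed_subgroup_iff)
  moreover have "?J \<in> Sub_le V E C"
    using orbits_superset[OF Hc(1,3) J] Hc(4) J closedin_kclosure by (simp add: Sub_le_iff)
  moreover have "topologically_simple (Aut V E \<lparr>carrier := ?J\<rparr>) (subtopology X ?J)"
    using kclosure_topologically_simple[OF Hc(1) H(2) Hc(3)] by (simp add: k_def)
  ultimately show "\<exists>y. y \<in> {H \<in> Sub_le V E C. topologically_simple (Aut V E \<lparr>carrier := H\<rparr>) (subtopology X H)} \<and> y \<in> T"
    by blast
qed

end

theorem theorem1p1:
  fixes V :: "'v set" and E :: "'v set set" and C :: real
  assumes "is_tree V E" and "locally_finite V E" and "\<forall>v\<in>V. vertex_degree E v \<ge> 2" and "C > 0"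
  shows "chabauty (Aut V E) (aut_topology V E) closure_of
           {H \<in> Sub_le V E C.
              topologically_simple (Aut V E \<lparr>carrier := H\<rparr>) (subtopology (aut_topology V E) H)}
       = {H \<in> Sub_le V E C.
              no_proper_open_finite_index (Aut V E \<lparr>carrier := H\<rparr>) (subtopology (aut_topology V E) H)}"
    (is "?closure = ?R")
proof -
  interpret leafless_tree V E
    using assms(1-3) by unfold_locales
  show ?thesis
  proof
    show "?closure \<subseteq> ?R"
    proof
      fix H assume H: "H \<in> ?closure"
      have "H \<in> Sub_le V E C \<and> nofi H"
        by (rule closure_imp_nofi[OF H]) (use simple_nofi in \<open>auto simp: Sub_le_iff\<close>)
      then show "H \<in> ?R" by blast
    qed
    show "?R \<subseteq> ?closure" using nofi_imp_closure by blast
  qed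
qed

end
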